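(* Let $a>b>0$ be integers with $\gcd(a,b)=1$. Let $H=\langle a,b\rangle$ be the numerical semigroup generated by $a,b$, and let $R=k[\![H]\!]$ be the numerical semigroup ring of $H$ over a field $k$. Let $\mathfrak{m}$ be the maximal ideal of $R$ and $\mathfrak{c}$ the conductor of $R$. Then the following statements hold. (1) There are equalities $\mathrm{ext}_R(R/\mathfrak{c})=\mathrm{fl}\,R$ and $\mathrm{ext}_R\,\mathfrak{c}=\mathrm{tf}\,R$. (2) The IKE-closed subcategories of $\mathrm{mod}\,R$ are $0$, $\mathrm{fl}\,R$, $\mathrm{tf}\,R$ and $\mathrm{mod}\,R$. In particular, every IKE-closed subcategory of $\mathrm{mod}\,R$ is torsionfree, i.e. closed under submodules and extensions.
   Context: $\mathrm{mod}\,R$ is the category of finitely generated $R$-modules; subcategories are strictly full (full and closed under isomorphism) and nonempty. $\langle a,b\rangle\subseteq\mathbb{N}=\{0,1,2,\dots\}$ is the set of all $\mathbb{N}$-linear combinations of $a,b$. For a numerical semigroup $H$ (a subsemigroup of $\mathbb{N}$ containing $0$ with finite complement), $k[\![H]\!]$ is the completion of $k[t^h\mid h\in H]\subseteq k[t]$ at the ideal generated by the $t^h$ with $0\neq h\in H$; equivalently the ring of power series in $k[\![t]\!]$ supported on exponents in $H$. Its integral closure is $S=k[\![t]\!]$; the conductor is $\mathfrak{c}=R:_QS=\{x\in Q\mid xS\subseteq R\}$, $Q$ being the fraction field of $R$. For $M\in\mathrm{mod}\,R$, $\mathrm{ext}_RM$ is the smallest strictly full subcategory of $\mathrm{mod}\,R$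 containing $M$ and closed under direct summands and extensions. $\mathrm{fl}\,R$ and $\mathrm{tf}\,R$ are the subcategories of modules of finite length and of (finitely generated) torsionfree modules, respectively; $0$ is the subcategory of zero modules. A subcategory $\mathcal{X}$ is closed under extensions if for each exact sequence $0\to L\to M\to N\to0$ with $L,N\in\mathcal{X}$ one has $M\in\mathcal{X}$. It is IKE-closed if it is closed under extensions and the image and kernel of every homomorphism between modules in $\mathcal{X}$ lie in $\mathcal{X}$.
   Formalization: The equality ext_R(R/c) = fl R is stated only for b > 1: if b = 1 then H = N, R = k[[t]], c = R and R/c = 0, so ext_R(R/c) = 0 while fl R contains k. All other claims are stated for all a > b > 0. *)

theory Defs
  imports
    "HOL-Computational_Algebra.Formal_Laurent_Series"
    "HOL-Algebra.QuotRing"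
    "HOL-Algebra.Module"
begin

section \<open>Modules over a commutative ring\<close>

definition fin_gen :: "('r, 'p) ring_scheme \<Rightarrow> ('r, 'v, 'q) module_scheme \<Rightarrow> bool" where
  "fin_gen R M \<longleftrightarrow>
     (\<exists>B. finite B \<and> B \<subseteq> carrier M \<and>
        (\<forall>x\<in>carrier M. \<exists>c\<in>B \<rightarrow> carrier R. x = (\<Oplus>\<^bsub>M\<^esub>v\<in>B. c v \<odot>\<^bsub>M\<^esub> v)))"

text \<open>
  The objects of the category of finitely generated modules whose underlying set lives in the
  type \<open>'v\<close>. Lemma \<open>fg_mod_copy\<close> below shows that nothing is lost when \<open>'v\<close> is at
  least as large as the (infinite) ring: every finitely generated module, over whatever type,
  is isomorphic to one of these.
  The fields \<open>mult\<close> and \<open>one\<close> of a module record play no role, and the other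
  operations matter only on the carrier.
\<close>

definition fg_mod :: "('r, 'p) ring_scheme \<Rightarrow> ('r, 'v) module set" where
  "fg_mod R = {M. module R M \<and> fin_gen R M}"

definition mod_hom ::
  "('r, 'p) ring_scheme \<Rightarrow> ('r, 'v, 'q) module_scheme \<Rightarrow> ('r, 'w, 's) module_scheme \<Rightarrow> ('v \<Rightarrow> 'w) set"
  where
  "mod_hom R M N =
     {f \<in> carrier M \<rightarrow> carrier N.
        (\<forall>x\<in>carrier M. \<forall>y\<in>carrier M. f (x \<oplus>\<^bsub>M\<^esub> y) = f x \<oplus>\<^bsub>N\<^esub> f y) \<and>
        (\<forall>r\<in>carrier R. \<forall>x\<in>carrier M. f (r \<odot>\<^bsub>M\<^esub> x) = r \<odot>\<^bsub>N\<^esub> f x)}"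

definition mod_iso ::
  "('r, 'p) ring_scheme \<Rightarrow> ('r, 'v, 'q) module_scheme \<Rightarrow> ('r, 'w, 's) module_scheme \<Rightarrow> bool" where
  "mod_iso R M N \<longleftrightarrow> (\<exists>f\<in>mod_hom R M N. bij_betw f (carrier M) (carrier N))"

definition mod_image :: "('r, 'w) module \<Rightarrow> ('v \<Rightarrow> 'w) \<Rightarrow> ('r, 'v) module \<Rightarrow> ('r, 'w) module" where
  "mod_image N f M = N\<lparr>carrier := f ` carrier M\<rparr>"

definition mod_kernel :: "('r, 'w) module \<Rightarrow> ('v \<Rightarrow> 'w) \<Rightarrow> ('r, 'v) module \<Rightarrow> ('r, 'v) module" where
  "mod_kernel N f M = M\<lparr>carrier := {x \<in> carrier M. f x = \<zero>\<^bsub>N\<^esub>}\<rparr>"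

definition short_exact ::
  "('r, 'p) ring_scheme \<Rightarrow> ('r, 'u) module \<Rightarrow> ('u \<Rightarrow> 'v) \<Rightarrow> ('r, 'v) module \<Rightarrow> ('v \<Rightarrow> 'w)
     \<Rightarrow> ('r, 'w) module \<Rightarrow> bool" where
  "short_exact R L f M g N \<longleftrightarrow>
     f \<in> mod_hom R L M \<and> g \<in> mod_hom R M N \<and>
     inj_on f (carrier L) \<and> f ` carrier L = {x \<in> carrier M. g x = \<zero>\<^bsub>N\<^esub>} \<and>
     g ` carrier M = carrier N"

definition mod_sum :: "('r, 'v) module \<Rightarrow> ('r, 'w) module \<Rightarrow> ('r, 'v \<times> 'w) module" where
  "mod_sum M N =
     \<lparr>carrier = carrier M \<times> carrier N, mult = undefined, one = undefined,
      zero = (\<zero>\<^bsub>M\<^esub>, \<zero>\<^bsub>N\<^esub>),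
      add = (\<lambda>(x, y) (x', y'). (x \<oplus>\<^bsub>M\<^esub> x', y \<oplus>\<^bsub>N\<^esub> y')),
      smult = (\<lambda>r (x, y). (r \<odot>\<^bsub>M\<^esub> x, r \<odot>\<^bsub>N\<^esub> y))\<rparr>"

definition ideal_module :: "('r, 'p) ring_scheme \<Rightarrow> 'r set \<Rightarrow> ('r, 'r) module" where
  "ideal_module R I =
     \<lparr>carrier = I, mult = mult R, one = one R, zero = \<zero>\<^bsub>R\<^esub>, add = add R, smult = mult R\<rparr>"

definition quot_module :: "('r, 'p) ring_scheme \<Rightarrow> 'r set \<Rightarrow> ('r, 'r set) module" where
  "quot_module R I =
     ring.extend (R Quot I) \<lparr>smult = (\<lambda>r X. (I +>\<^bsub>R\<^esub> r) \<otimes>\<^bsub>R Quot I\<^esub> X)\<rparr>"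


section \<open>Subcategories of the category of finitely generated modules\<close>

text \<open>Full subcategories are identified with their classes of objects.\<close>

definition strict_full_subcat :: "('r, 'p) ring_scheme \<Rightarrow> ('r, 'v) module set \<Rightarrow> bool" where
  "strict_full_subcat R X \<longleftrightarrow>
     X \<subseteq> fg_mod R \<and> X \<noteq> {} \<and> (\<forall>M\<in>X. \<forall>N\<in>fg_mod R. mod_iso R M N \<longrightarrow> N \<in> X)"

definition closed_extensions :: "('r, 'p) ring_scheme \<Rightarrow> ('r, 'v) module set \<Rightarrow> bool" where
  "closed_extensions R X \<longleftrightarrow>
     (\<forall>L\<in>X. \<forall>N\<in>X. \<forall>M\<in>fg_mod R. \<forall>f g. short_exact R L f M g N \<longrightarrow> M \<in> X)"

definition closed_summands :: "('r, 'p) ring_scheme \<Rightarrow> ('r, 'v) module set \<Rightarrow> bool" where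
  "closed_summands R X \<longleftrightarrow>
     (\<forall>M\<in>X. \<forall>A\<in>fg_mod R. \<forall>B\<in>(fg_mod R :: ('r, 'v) module set).
        mod_iso R M (mod_sum A B) \<longrightarrow> A \<in> X)"

definition closed_submodules :: "('r, 'p) ring_scheme \<Rightarrow> ('r, 'v) module set \<Rightarrow> bool" where
  "closed_submodules R X \<longleftrightarrow> (\<forall>M\<in>X. \<forall>N. submodule N R M \<longrightarrow> M\<lparr>carrier := N\<rparr> \<in> X)"

definition IKE_closed :: "('r, 'p) ring_scheme \<Rightarrow> ('r, 'v) module set \<Rightarrow> bool" where
  "IKE_closed R X \<longleftrightarrow>
     closed_extensions R X \<and>
     (\<forall>M\<in>X. \<forall>N\<in>X. \<forall>f\<in>mod_hom R M N. mod_image N f M \<in> X \<and> mod_kernel N f M \<in> X)"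

definition torsionfree_subcat :: "('r, 'p) ring_scheme \<Rightarrow> ('r, 'v) module set \<Rightarrow> bool" where
  "torsionfree_subcat R X \<longleftrightarrow> closed_submodules R X \<and> closed_extensions R X"

text \<open>
  The module \<open>M\<close> may live in a different type than the subcategory it generates;
  containing \<open>M\<close> then means containing the modules of \<^term>\<open>fg_mod R\<close> isomorphic to it.
\<close>

definition ext_closure ::
  "('r, 'p) ring_scheme \<Rightarrow> ('r, 'w) module \<Rightarrow> ('r, 'v) module set" where
  "ext_closure R M =
     \<Inter>{X. strict_full_subcat R X \<and> {N \<in> fg_mod R. mod_iso R M N} \<subseteq> X \<and>
          closed_summands R X \<and> closed_extensions R X}"

definition zero_mod :: "('r, 'p) ring_scheme \<Rightarrow> ('r, 'v) module set" where
  "zero_mod R = {M \<in> fg_mod R. carrier M = {\<zero>\<^bsub>M\<^esub>}}"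

text \<open>Finite length: there is a composition series.\<close>

definition finite_length :: "('r, 'p) ring_scheme \<Rightarrow> ('r, 'v) module \<Rightarrow> bool" where
  "finite_length R M \<longleftrightarrow>
     (\<exists>n::nat. \<exists>F.
        F 0 = {\<zero>\<^bsub>M\<^esub>} \<and> F n = carrier M \<and>
        (\<forall>i\<le>n. submodule (F i) R M) \<and>
        (\<forall>i<n. F i \<subset> F (Suc i) \<and>
           (\<forall>N. submodule N R M \<and> F i \<subseteq> N \<and> N \<subseteq> F (Suc i) \<longrightarrow> N = F i \<or> N = F (Suc i))))"

definition fl_mod :: "('r, 'p) ring_scheme \<Rightarrow> ('r, 'v) module set" where
  "fl_mod R = {M \<in> fg_mod R. finite_length R M}"

text \<open>Torsionfreeness is phrased for a domain \<open>R\<close>, whose regular elements are the nonzero ones.\<close>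

definition tf_mod :: "('r, 'p) ring_scheme \<Rightarrow> ('r, 'v) module set" where
  "tf_mod R =
     {M \<in> fg_mod R. \<forall>r\<in>carrier R. \<forall>x\<in>carrier M.
        r \<odot>\<^bsub>M\<^esub> x = \<zero>\<^bsub>M\<^esub> \<longrightarrow> r = \<zero>\<^bsub>R\<^esub> \<or> x = \<zero>\<^bsub>M\<^esub>}"


section \<open>Numerical semigroup rings\<close>

definition semigroup_gen2 :: "nat \<Rightarrow> nat \<Rightarrow> nat set" where
  "semigroup_gen2 a b = {i * a + j * b | i j. True}"

text \<open>
  The ring of power series with exponents in \<open>H\<close>, placed inside the field of Laurent
  series, where its fraction field can be formed.
\<close>

definition semigroup_ring :: "nat set \<Rightarrow> 'k::field fls ring" where
  "semigroup_ring H =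
     \<lparr>carrier = fps_to_fls ` {f. \<forall>n. fps_nth f n \<noteq> 0 \<longrightarrow> n \<in> H},
      mult = (*), one = 1, zero = 0, add = (+)\<rparr>"

text \<open>
  In the following three definitions, \<open>R\<close> is a subring of the field \<open>'f\<close>.
\<close>

definition fraction_field_in :: "'f::field ring \<Rightarrow> 'f set" where
  "fraction_field_in R = {x / y | x y. x \<in> carrier R \<and> y \<in> carrier R \<and> y \<noteq> 0}"

definition integral_closure_in :: "'f::field ring \<Rightarrow> 'f set" where
  "integral_closure_in R =
     {x \<in> fraction_field_in R.
        \<exists>n::nat. \<exists>c. (\<forall>i<n. c i \<in> carrier R) \<and> x ^ n + (\<Sum>i<n. c i * x ^ i) = 0}"

definition conductor :: "'f::field ring \<Rightarrow> 'f set" where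
  "conductor R =
     {x \<in> fraction_field_in R. \<forall>s\<in>integral_closure_in R. x * s \<in> carrier R}"


section \<open>Every finitely generated module has a copy in a large enough type\<close>

lemma fg_mod_card:
  includes cardinal_syntax
  assumes "module R M" and inf: "infinite (carrier R)"
    and "finite B" "B \<subseteq> carrier M"
  shows "|{(\<Oplus>\<^bsub>M\<^esub>v\<in>B. c v \<odot>\<^bsub>M\<^esub> v) | c. c \<in> B \<rightarrow> carrier R}| \<le>o |carrier R|"
  using assms(3,4)
proof (induction B)
  case empty
  interpret module R M by fact
  have "{(\<Oplus>\<^bsub>M\<^esub>v\<in>{}. c v \<odot>\<^bsub>M\<^esub> v) | c. c \<in> {} \<rightarrow> carrier R} = {\<zero>\<^bsub>M\<^esub>}"
    by auto
  then show ?case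
    using inf by (simp only:) (rule card_of_singl_ordLeq, auto)
next
  case (insert b B)
  interpret module R M by fact
  let ?S = "\<lambda>B. {(\<Oplus>\<^bsub>M\<^esub>v\<in>B. c v \<odot>\<^bsub>M\<^esub> v) | c. c \<in> B \<rightarrow> carrier R}"
  have "?S (insert b B) \<subseteq> (\<lambda>(r, x). r \<odot>\<^bsub>M\<^esub> b \<oplus>\<^bsub>M\<^esub> x) ` (carrier R \<times> ?S B)"
  proof
    fix x assume "x \<in> ?S (insert b B)"
    then obtain c where c: "c \<in> insert b B \<rightarrow> carrier R"
      and x: "x = (\<Oplus>\<^bsub>M\<^esub>v\<in>insert b B. c v \<odot>\<^bsub>M\<^esub> v)" by auto
    have "x = c b \<odot>\<^bsub>M\<^esub> b \<oplus>\<^bsub>M\<^esub> (\<Oplus>\<^bsub>M\<^esub>v\<in>B. c v \<odot>\<^bsub>M\<^esub> v)"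
      unfolding x using insert c by (subst M.finsum_insert) auto
    then show "x \<in> (\<lambda>(r, x). r \<odot>\<^bsub>M\<^esub> b \<oplus>\<^bsub>M\<^esub> x) ` (carrier R \<times> ?S B)"
      using c by (intro image_eqI[where x = "(c b, \<Oplus>\<^bsub>M\<^esub>v\<in>B. c v \<odot>\<^bsub>M\<^esub> v)"]) auto
  qed
  then have "|?S (insert b B)| \<le>o |carrier R \<times> ?S B|"
    by (rule surj_imp_ordLeq)
  also have "|carrier R \<times> ?S B| \<le>o |carrier R \<times> carrier R|"
    using insert by (intro card_of_Times_mono2) auto
  also have "|carrier R \<times> carrier R| =o |carrier R|"
    using inf by (rule card_of_Times_same_infinite)
  finally show ?case .
qed

lemma mod_hom_finsum:
  assumes "module R M" "module R N" "f \<in> mod_hom R M N" "finite B" "g \<in> B \<rightarrow> carrier M"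
  shows "f (\<Oplus>\<^bsub>M\<^esub>v\<in>B. g v) = (\<Oplus>\<^bsub>N\<^esub>v\<in>B. f (g v))"
  using assms(4,5)
proof (induction B)
  case empty
  interpret M: module R M by fact
  interpret N: module R N by fact
  have "f (\<zero>\<^bsub>R\<^esub> \<odot>\<^bsub>M\<^esub> \<zero>\<^bsub>M\<^esub>) = \<zero>\<^bsub>R\<^esub> \<odot>\<^bsub>N\<^esub> f \<zero>\<^bsub>M\<^esub>" "f \<zero>\<^bsub>M\<^esub> \<in> carrier N"
    using assms(3) M.R.zero_closed M.M.zero_closed unfolding mod_hom_def by blast+
  then show ?case by simp
next
  case (insert b B)
  interpret M: module R M by fact
  interpret N: module R N by fact
  have "f \<in> carrier M \<rightarrow> carrier N"
    and add: "\<And>x y. x \<in> carrier M \<Longrightarrow> y \<in> carrier M \<Longrightarrow> f (x \<oplus>\<^bsub>M\<^esub> y) = f x \<oplus>\<^bsub>N\<^esub> f y"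
    using assms(3) unfolding mod_hom_def by auto
  moreover have "g b \<in> carrier M" "g \<in> B \<rightarrow> carrier M" using insert by auto
  ultimately show ?case
    using insert by (simp add: Pi_def)
qed

lemma fg_mod_copy:
  fixes R :: "('r, 'p) ring_scheme" and M :: "('r, 'w) module" and j :: "'r \<Rightarrow> 'v"
  assumes "infinite (carrier R)" "inj j" "module R M" "fin_gen R M"
  shows "\<exists>N :: ('r, 'v) module. N \<in> fg_mod R \<and> mod_iso R M N"
proof -
  include cardinal_syntax
  interpret M: module R M by fact
  obtain B where B: "finite B" "B \<subseteq> carrier M"
    and gen: "\<forall>x\<in>carrier M. \<exists>c\<in>B \<rightarrow> carrier R. x = (\<Oplus>\<^bsub>M\<^esub>v\<in>B. c v \<odot>\<^bsub>M\<^esub> v)"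
    using assms(4) unfolding fin_gen_def by blast
  have "carrier M \<subseteq> {(\<Oplus>\<^bsub>M\<^esub>v\<in>B. c v \<odot>\<^bsub>M\<^esub> v) | c. c \<in> B \<rightarrow> carrier R}"
    using gen by blast
  then have "|carrier M| \<le>o |carrier R|"
    using fg_mod_card[OF assms(3,1) B] card_of_mono1 ordLeq_transitive by blast
  then obtain h :: "'w \<Rightarrow> 'r" where h: "inj_on h (carrier M)"
    unfolding card_of_ordLeq[symmetric] by blast
  define \<phi> where "\<phi> = j \<circ> h"
  define \<psi> where "\<psi> = inv_into (carrier M) \<phi>"
  have "inj_on \<phi> (carrier M)"
    unfolding \<phi>_def using h assms(2) by (metis comp_inj_on inj_on_subset subset_UNIV)
  then have \<psi>: "\<psi> (\<phi> x) = x" if "x \<in> carrier M" for x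
    using that by (simp add: \<psi>_def)
  define N :: "('r, 'v) module" where
    "N = \<lparr>carrier = \<phi> ` carrier M, mult = undefined, one = undefined, zero = \<phi> \<zero>\<^bsub>M\<^esub>,
          add = (\<lambda>x y. \<phi> (\<psi> x \<oplus>\<^bsub>M\<^esub> \<psi> y)), smult = (\<lambda>r x. \<phi> (r \<odot>\<^bsub>M\<^esub> \<psi> x))\<rparr>"
  have "abelian_group N"
  proof (rule abelian_groupI)
    fix x assume "x \<in> carrier N"
    then obtain x' where "x' \<in> carrier M" "x = \<phi> x'" by (auto simp: N_def)
    then show "\<exists>y\<in>carrier N. y \<oplus>\<^bsub>N\<^esub> x = \<zero>\<^bsub>N\<^esub>"
      by (intro bexI[where x = "\<phi> (\<ominus>\<^bsub>M\<^esub> x')"]) (auto simp: N_def \<psi> M.l_neg)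
  qed (auto simp: N_def \<psi> M.a_assoc M.a_comm M.a_lcomm)
  then have N: "module R N"
    by (intro moduleI)
       (auto simp: N_def \<psi> M.smult_l_distr M.smult_r_distr M.smult_assoc1
             intro: M.is_cring)
  have hom: "\<phi> \<in> mod_hom R M N"
    by (auto simp: mod_hom_def N_def \<psi>)
  have "fin_gen R N"
    unfolding fin_gen_def
  proof (intro exI[where x = "\<phi> ` B"] conjI ballI)
    interpret N: module R N by fact
    fix y assume "y \<in> carrier N"
    then obtain x where x: "x \<in> carrier M" "y = \<phi> x" by (auto simp: N_def)
    then obtain c where c: "c \<in> B \<rightarrow> carrier R" "x = (\<Oplus>\<^bsub>M\<^esub>v\<in>B. c v \<odot>\<^bsub>M\<^esub> v)"
      using gen by blast
    have cB: "c v \<odot>\<^bsub>M\<^esub> v \<in> carrier M" if "v \<in> B" for v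
      using that c(1) B(2) by (intro M.smult_closed) auto
    have "y = (\<Oplus>\<^bsub>N\<^esub>v\<in>B. \<phi> (c v \<odot>\<^bsub>M\<^esub> v))"
      unfolding x(2) c(2) using c(1) B assms(3) N hom by (intro mod_hom_finsum) auto
    also have "\<dots> = (\<Oplus>\<^bsub>N\<^esub>v\<in>B. (c (\<psi> (\<phi> v))) \<odot>\<^bsub>N\<^esub> \<phi> v)"
      using B(2) cB by (intro N.finsum_cong') (auto simp: N_def \<psi> subset_iff)
    also have "\<dots> = (\<Oplus>\<^bsub>N\<^esub>w\<in>\<phi> ` B. (c (\<psi> w)) \<odot>\<^bsub>N\<^esub> w)"
    proof (rule N.finsum_reindex[symmetric])
      show "inj_on \<phi> B" using \<open>inj_on \<phi> (carrier M)\<close> B(2) by (rule inj_on_subset)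
      show "(\<lambda>w. c (\<psi> w) \<odot>\<^bsub>N\<^esub> w) \<in> \<phi> ` B \<rightarrow> carrier N"
        using B(2) cB by (auto simp: N_def \<psi> subset_iff)
    qed
    finally have "y = (\<Oplus>\<^bsub>N\<^esub>w\<in>\<phi> ` B. (c (\<psi> w)) \<odot>\<^bsub>N\<^esub> w)" .
    moreover have "(\<lambda>w. c (\<psi> w)) \<in> \<phi> ` B \<rightarrow> carrier R"
      using B(2) c(1) by (auto simp: \<psi> subset_iff)
    ultimately show "\<exists>c\<in>\<phi> ` B \<rightarrow> carrier R. y = (\<Oplus>\<^bsub>N\<^esub>v\<in>\<phi> ` B. c v \<odot>\<^bsub>N\<^esub> v)"
      by (intro bexI[where x = "\<lambda>w. c (\<psi> w)"])
  qed (use B in \<open>auto simp: N_def\<close>)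
  moreover have "mod_iso R M N"
    unfolding mod_iso_def using hom \<open>inj_on \<phi> (carrier M)\<close>
    by (intro bexI[where x = \<phi>]) (auto simp: bij_betw_def N_def)
  ultimately show ?thesis
    using N by (auto simp: fg_mod_def)
qed

end

theory Submission
  imports Defs
begin

text \<open>
  A finitely generated torsionfree module has a filtration whose quotients are fractional ideals,
  and a fractional ideal \<open>A\<close> is reached from shifts of \<open>S = k[[t]]\<close> by iterating
  \<open>0 \<rightarrow> A \<inter> J \<rightarrow> A \<oplus> J \<rightarrow> A + J \<rightarrow> 0\<close> with \<open>J\<close> a shift of \<open>S\<close>. Since the conductor is
  such a shift, \<open>ext \<cc> = tf R\<close>. The analogous sequence for subquotients of \<open>k((t))\<close>, applied to
  \<open>R / I\<close> and \<open>t\<^sup>-\<^sup>b (R / I)\<close> with \<open>I = R \<inter> t\<^sup>m S\<close>, shows that an extension-closed and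
  summand-closed subcategory containing \<open>R / I\<close> contains \<open>R / (I : t\<^sup>b)\<close>; starting from \<open>R / \<cc>\<close> this
  ends at the residue field, which generates \<open>fl R\<close>.

  Let \<open>X\<close> be IKE-closed. If some \<open>M\<close> in \<open>X\<close> has nonzero torsion, this torsion is the kernel of a
  power of \<open>t\<close>; an element of \<open>R\<close> of maximal order not annihilating it has as image a nonzero vector
  space over \<open>k\<close>, so \<open>X\<close> contains \<open>k\<close> and hence \<open>fl R\<close>. If some \<open>M\<close> in \<open>X\<close> is not torsion, a
  torsionfree image of \<open>M\<close> has an endomorphism of rank one, whose image is a fractional ideal; sums of
  shifts of the latter give \<open>S\<close>, hence \<open>tf R \<subseteq> X\<close>. If both happen, then \<open>X\<close> is everything.
\<close>

section \<open>Submodules and homomorphisms\<close>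

text \<open>The two generators enter through a property of gaps. In the descent from I to I : t^b,
  with I the elements of R of order at least m, the part of t^-b I supported outside H has to form a
  submodule together with I. Adding a to a gap n can break this only if n + a lands in H below m.
  But a gap n with n + a and n + b both in H equals ab - a - b, so n + a = (a - 1) b, and this is at
  least m as long as m <= (a - 1) b. That bound holds at the conductor and persists because m only
  decreases. The obstacle to such a descent is that an extension-closed subcategory need not contain
  submodules or quotients of its objects. The way around it is a sequence whose two ends are already
  known to lie in the subcategory and whose middle term is visibly a direct sum; closure under
  summands then releases the new module. In an IKE-closed subcategory a summand is the image of an
  idempotent, so the same arguments serve both halves of the theorem.\<close>

lemma (in module) submodule_iff:
  "submodule N R M \<longleftrightarrow> N \<subseteq> carrier M \<and> \<zero>\<^bsub>M\<^esub> \<in> N \<and> (\<forall>x\<in>N. \<forall>y\<in>N. x \<oplus>\<^bsub>M\<^esub> y \<in> N) \<and>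
     (\<forall>r\<in>carrier R. \<forall>x\<in>N. r \<odot>\<^bsub>M\<^esub> x \<in> N)"
proof
  assume N: "submodule N R M"
  then have "\<zero>\<^bsub>M\<^esub> \<in> N"
    using subgroup.one_closed[OF submodule.axioms(1)[OF N]] by simp
  with submoduleE[OF N] show "N \<subseteq> carrier M \<and> \<zero>\<^bsub>M\<^esub> \<in> N \<and> (\<forall>x\<in>N. \<forall>y\<in>N. x \<oplus>\<^bsub>M\<^esub> y \<in> N) \<and>
     (\<forall>r\<in>carrier R. \<forall>x\<in>N. r \<odot>\<^bsub>M\<^esub> x \<in> N)" by blast
next
  assume *: "N \<subseteq> carrier M \<and> \<zero>\<^bsub>M\<^esub> \<in> N \<and> (\<forall>x\<in>N. \<forall>y\<in>N. x \<oplus>\<^bsub>M\<^esub> y \<in> N) \<and>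
     (\<forall>r\<in>carrier R. \<forall>x\<in>N. r \<odot>\<^bsub>M\<^esub> x \<in> N)"
  have "\<ominus>\<^bsub>M\<^esub> x \<in> N" if "x \<in> N" for x
  proof -
    have "\<ominus>\<^bsub>M\<^esub> x = (\<ominus> \<one>) \<odot>\<^bsub>M\<^esub> x" using that * by (subst smult_l_minus) auto
    then show ?thesis using * that by auto
  qed
  with * show "submodule N R M" by (intro submoduleI) auto
qed

lemma (in module) submodule_zero: "submodule N R M \<Longrightarrow> \<zero>\<^bsub>M\<^esub> \<in> N"
  by (simp add: submodule_iff)

lemma (in module) submodule_minus:
  "submodule N R M \<Longrightarrow> x \<in> N \<Longrightarrow> y \<in> N \<Longrightarrow> x \<ominus>\<^bsub>M\<^esub> y \<in> N"
  using submoduleE[of N] by (simp add: a_minus_def)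

lemma (in module) minus_eq_zero_iff:
  assumes "x \<in> carrier M" "y \<in> carrier M"
  shows "x \<ominus>\<^bsub>M\<^esub> y = \<zero>\<^bsub>M\<^esub> \<longleftrightarrow> x = y"
  using assms M.minus_equality[of x "\<ominus>\<^bsub>M\<^esub> y"] by (auto simp: a_minus_def M.r_neg)

lemma (in module) submodule_zero_submodule: "submodule {\<zero>\<^bsub>M\<^esub>} R M"
  by (simp add: submodule_iff)

lemma (in module) module_restrict: "submodule N R M \<Longrightarrow> module R (M\<lparr>carrier := N\<rparr>)"
  by (rule submodule.submodule_is_module) (assumption, rule module_axioms)

lemma (in module) submodule_restrict_iff:
  assumes "submodule N R M"
  shows "submodule K R (M\<lparr>carrier := N\<rparr>) \<longleftrightarrow> submodule K R M \<and> K \<subseteq> N"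
proof -
  interpret N: module R "M\<lparr>carrier := N\<rparr>" by (rule module_restrict[OF assms])
  show ?thesis using assms unfolding N.submodule_iff submodule_iff by auto
qed

lemma (in module) a_minus_restrict:
  assumes "submodule N R M" "x \<in> N" "y \<in> N"
  shows "x \<ominus>\<^bsub>M\<lparr>carrier := N\<rparr>\<^esub> y = x \<ominus>\<^bsub>M\<^esub> y"
proof -
  interpret N: module R "M\<lparr>carrier := N\<rparr>" by (rule module_restrict[OF assms(1)])
  have "\<ominus>\<^bsub>M\<lparr>carrier := N\<rparr>\<^esub> y = \<ominus>\<^bsub>M\<^esub> y"
    using N.M.l_neg[of y] N.M.a_inv_closed[of y] assms submoduleE(1)[OF assms(1)]
    by (intro M.minus_equality[symmetric]) auto
  then show ?thesis by (simp add: a_minus_def)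
qed

lemma mod_homI:
  assumes "\<And>x. x \<in> carrier M \<Longrightarrow> f x \<in> carrier N"
    and "\<And>x y. x \<in> carrier M \<Longrightarrow> y \<in> carrier M \<Longrightarrow> f (x \<oplus>\<^bsub>M\<^esub> y) = f x \<oplus>\<^bsub>N\<^esub> f y"
    and "\<And>r x. r \<in> carrier R \<Longrightarrow> x \<in> carrier M \<Longrightarrow> f (r \<odot>\<^bsub>M\<^esub> x) = r \<odot>\<^bsub>N\<^esub> f x"
  shows "f \<in> mod_hom R M N"
  using assms by (auto simp: mod_hom_def)

lemma mod_hom_closed: "f \<in> mod_hom R M N \<Longrightarrow> x \<in> carrier M \<Longrightarrow> f x \<in> carrier N"
  by (auto simp: mod_hom_def)

lemma mod_hom_add:
  "f \<in> mod_hom R M N \<Longrightarrow> x \<in> carrier M \<Longrightarrow> y \<in> carrier M \<Longrightarrow> f (x \<oplus>\<^bsub>M\<^esub> y) = f x \<oplus>\<^bsub>N\<^esub> f y"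
  by (auto simp: mod_hom_def)

lemma mod_hom_smult:
  "f \<in> mod_hom R M N \<Longrightarrow> r \<in> carrier R \<Longrightarrow> x \<in> carrier M \<Longrightarrow> f (r \<odot>\<^bsub>M\<^esub> x) = r \<odot>\<^bsub>N\<^esub> f x"
  by (auto simp: mod_hom_def)

lemma mod_hom_zero:
  assumes "module R M" "module R N" "f \<in> mod_hom R M N"
  shows "f \<zero>\<^bsub>M\<^esub> = \<zero>\<^bsub>N\<^esub>"
proof -
  interpret M: module R M by fact
  interpret N: module R N by fact
  have "f (\<zero>\<^bsub>R\<^esub> \<odot>\<^bsub>M\<^esub> \<zero>\<^bsub>M\<^esub>) = \<zero>\<^bsub>R\<^esub> \<odot>\<^bsub>N\<^esub> f \<zero>\<^bsub>M\<^esub>"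
    using assms(3) by (intro mod_hom_smult) auto
  then show ?thesis using mod_hom_closed[OF assms(3)] by simp
qed

lemma mod_hom_minus:
  assumes "module R M" "module R N" "f \<in> mod_hom R M N" "x \<in> carrier M" "y \<in> carrier M"
  shows "f (x \<ominus>\<^bsub>M\<^esub> y) = f x \<ominus>\<^bsub>N\<^esub> f y"
proof -
  interpret M: module R M by fact
  interpret N: module R N by fact
  have "f (\<ominus>\<^bsub>M\<^esub> y) \<oplus>\<^bsub>N\<^esub> f y = f (\<ominus>\<^bsub>M\<^esub> y \<oplus>\<^bsub>M\<^esub> y)"
    using assms by (simp add: mod_hom_add)
  also have "\<dots> = \<zero>\<^bsub>N\<^esub>" using assms mod_hom_zero[OF assms(1-3)] by (simp add: M.M.l_neg)
  finally have "\<ominus>\<^bsub>N\<^esub> f y = f (\<ominus>\<^bsub>M\<^esub> y)"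
    using assms by (intro N.M.minus_equality) (auto intro: mod_hom_closed)
  then show ?thesis using assms by (simp add: a_minus_def mod_hom_add)
qed

lemma mod_hom_eq_iff:
  assumes "module R M" "module R N" "f \<in> mod_hom R M N" "x \<in> carrier M" "y \<in> carrier M"
  shows "f x = f y \<longleftrightarrow> f (x \<ominus>\<^bsub>M\<^esub> y) = \<zero>\<^bsub>N\<^esub>"
proof -
  interpret N: module R N by fact
  show ?thesis
    unfolding mod_hom_minus[OF assms] using assms by (simp add: mod_hom_closed N.minus_eq_zero_iff)
qed

lemma mod_hom_inj_on_iff:
  assumes "module R M" "module R N" "f \<in> mod_hom R M N"
  shows "inj_on f (carrier M) \<longleftrightarrow> (\<forall>x\<in>carrier M. f x = \<zero>\<^bsub>N\<^esub> \<longrightarrow> x = \<zero>\<^bsub>M\<^esub>)"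
proof -
  interpret M: module R M by fact
  show ?thesis
  proof
    assume "inj_on f (carrier M)"
    then show "\<forall>x\<in>carrier M. f x = \<zero>\<^bsub>N\<^esub> \<longrightarrow> x = \<zero>\<^bsub>M\<^esub>"
      using mod_hom_zero[OF assms] by (auto simp: inj_on_def)
  next
    assume *: "\<forall>x\<in>carrier M. f x = \<zero>\<^bsub>N\<^esub> \<longrightarrow> x = \<zero>\<^bsub>M\<^esub>"
    show "inj_on f (carrier M)"
    proof (rule inj_onI)
      fix x y assume xy: "x \<in> carrier M" "y \<in> carrier M" "f x = f y"
      then have "x \<ominus>\<^bsub>M\<^esub> y = \<zero>\<^bsub>M\<^esub>" using * mod_hom_eq_iff[OF assms] by auto
      then show "x = y" using xy by (simp add: M.minus_eq_zero_iff)
    qed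
  qed
qed

lemma mod_hom_comp:
  "f \<in> mod_hom R L M \<Longrightarrow> g \<in> mod_hom R M N \<Longrightarrow> g \<circ> f \<in> mod_hom R L N"
  by (auto simp: mod_hom_def Pi_def)

lemma mod_hom_restrict:
  "f \<in> mod_hom R M N \<Longrightarrow> K \<subseteq> carrier M \<Longrightarrow> f \<in> mod_hom R (M\<lparr>carrier := K\<rparr>) N"
  by (auto simp: mod_hom_def subset_iff)

lemma mod_hom_corestrict:
  "f \<in> mod_hom R M N \<Longrightarrow> f ` carrier M \<subseteq> K \<Longrightarrow> f \<in> mod_hom R M (N\<lparr>carrier := K\<rparr>)"
  by (auto simp: mod_hom_def)

lemma mod_hom_inclusion:
  "K \<subseteq> carrier M \<Longrightarrow> (\<lambda>x. x) \<in> mod_hom R (M\<lparr>carrier := K\<rparr>) M"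
  by (auto simp: mod_hom_def)

lemma (in module) mod_hom_scale: "r \<in> carrier R \<Longrightarrow> (\<lambda>x. r \<odot>\<^bsub>M\<^esub> x) \<in> mod_hom R M M"
  by (intro mod_homI) (auto simp: smult_r_distr smult_assoc1[symmetric] R.m_comm)

lemma (in module) mod_hom_orbit:
  "x \<in> carrier M \<Longrightarrow> (\<lambda>r. r \<odot>\<^bsub>M\<^esub> x) \<in> mod_hom R (ideal_module R (carrier R)) M"
  by (intro mod_homI) (auto simp: ideal_module_def smult_l_distr smult_assoc1)

lemma submodule_image:
  assumes "module R M" "module R N" "f \<in> mod_hom R M N" "submodule K R M"
  shows "submodule (f ` K) R N"
proof -
  interpret M: module R M by fact
  interpret N: module R N by fact
  have K: "K \<subseteq> carrier M" using assms(4) by (simp add: M.submodule_iff)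
  show ?thesis
    unfolding N.submodule_iff
  proof (intro conjI ballI)
    show "f ` K \<subseteq> carrier N" using K mod_hom_closed[OF assms(3)] by auto
    show "\<zero>\<^bsub>N\<^esub> \<in> f ` K"
      using mod_hom_zero[OF assms(1-3)] M.submodule_zero[OF assms(4)] by force
    show "x \<oplus>\<^bsub>N\<^esub> y \<in> f ` K" if "x \<in> f ` K" "y \<in> f ` K" for x y
      using that K assms(4) unfolding M.submodule_iff
      by (auto simp: mod_hom_add[OF assms(3), symmetric] subset_iff)
    show "r \<odot>\<^bsub>N\<^esub> x \<in> f ` K" if "r \<in> carrier R" "x \<in> f ` K" for r x
      using that K assms(4) unfolding M.submodule_iff
      by (auto simp: mod_hom_smult[OF assms(3), symmetric] subset_iff)
  qed
qed

lemma submodule_vimage: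
  assumes "module R M" "module R N" "f \<in> mod_hom R M N" "submodule K R N"
  shows "submodule {x \<in> carrier M. f x \<in> K} R M"
proof -
  interpret M: module R M by fact
  interpret N: module R N by fact
  show ?thesis using assms(4) unfolding M.submodule_iff N.submodule_iff
    using mod_hom_zero[OF assms(1-3)]
    by (auto simp: mod_hom_add[OF assms(3)] mod_hom_smult[OF assms(3)])
qed

lemma submodule_kernel:
  assumes "module R M" "module R N" "f \<in> mod_hom R M N"
  shows "submodule {x \<in> carrier M. f x = \<zero>\<^bsub>N\<^esub>} R M"
  using submodule_vimage[OF assms module.submodule_zero_submodule[OF assms(2)]] by simp

lemma mod_iso_refl: "mod_iso R M M"
  unfolding mod_iso_def by (rule bexI[of _ "\<lambda>x. x"]) (auto simp: mod_hom_def bij_betw_def)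

lemma mod_hom_inv_into:
  assumes "module R M" and f: "f \<in> mod_hom R M N" "bij_betw f (carrier M) (carrier N)"
  shows "inv_into (carrier M) f \<in> mod_hom R N M"
proof -
  interpret M: module R M by fact
  define g where "g = inv_into (carrier M) f"
  have gf: "g (f x) = x" if "x \<in> carrier M" for x
    using that f(2) by (simp add: g_def bij_betw_def)
  have ex: "\<exists>x\<in>carrier M. y = f x" if "y \<in> carrier N" for y
    using that f(2) by (auto simp: bij_betw_def)
  have "g \<in> mod_hom R N M"
  proof (rule mod_homI)
    show "g x \<in> carrier M" if "x \<in> carrier N" for x using ex[OF that] gf by auto
    show "g (x \<oplus>\<^bsub>N\<^esub> y) = g x \<oplus>\<^bsub>M\<^esub> g y" if "x \<in> carrier N" "y \<in> carrier N" for x y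
    proof -
      from that ex obtain x' y' where "x' \<in> carrier M" "y' \<in> carrier M" "x = f x'" "y = f y'"
        by metis
      then show ?thesis by (simp add: mod_hom_add[OF f(1), symmetric] gf)
    qed
    show "g (r \<odot>\<^bsub>N\<^esub> x) = r \<odot>\<^bsub>M\<^esub> g x" if "r \<in> carrier R" "x \<in> carrier N" for r x
    proof -
      from that ex obtain x' where "x' \<in> carrier M" "x = f x'" by metis
      then show ?thesis using that by (simp add: mod_hom_smult[OF f(1), symmetric] gf)
    qed
  qed
  then show ?thesis by (simp add: g_def)
qed

lemma mod_iso_sym:
  assumes "module R M" "mod_iso R M N"
  shows "mod_iso R N M"
  using assms mod_hom_inv_into bij_betw_inv_into unfolding mod_iso_def by blast

lemma mod_iso_trans:
  assumes "mod_iso R L M" "mod_iso R M N"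
  shows "mod_iso R L N"
  using assms unfolding mod_iso_def by (meson bij_betw_trans mod_hom_comp)

text \<open>Maps out of a quotient are built from a surjection \<open>p\<close> alone: the value at
  \<open>y\<close> is \<open>q\<close> at any chosen preimage, and two preimages differ by an
  element of the kernel of \<open>p\<close>, on which \<open>q\<close> vanishes.\<close>

lemma mod_hom_factor:
  assumes "module R P" "module R M" "module R N"
    and p: "p \<in> mod_hom R P M" "p ` carrier P = carrier M"
    and q: "q \<in> mod_hom R P N" "\<And>x. x \<in> carrier P \<Longrightarrow> p x = \<zero>\<^bsub>M\<^esub> \<Longrightarrow> q x = \<zero>\<^bsub>N\<^esub>"
  obtains g where "g \<in> mod_hom R M N" "\<And>x. x \<in> carrier P \<Longrightarrow> g (p x) = q x"
proof
  interpret P: module R P by fact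
  define g where "g y = q (inv_into (carrier P) p y)" for y
  show gp: "g (p x) = q x" if "x \<in> carrier P" for x
  proof -
    let ?x = "inv_into (carrier P) p (p x)"
    have x: "?x \<in> carrier P" "p ?x = p x"
      using that by (auto intro: inv_into_into f_inv_into_f)
    then have "p (?x \<ominus>\<^bsub>P\<^esub> x) = \<zero>\<^bsub>M\<^esub>"
      using mod_hom_eq_iff[OF assms(1,2) p(1)] that by simp
    then have "q (?x \<ominus>\<^bsub>P\<^esub> x) = \<zero>\<^bsub>N\<^esub>" using q(2) that x by simp
    then show ?thesis using mod_hom_eq_iff[OF assms(1,3) q(1)] that x by (simp add: g_def)
  qed
  have ex: "\<exists>x\<in>carrier P. y = p x" if "y \<in> carrier M" for y
    using that p(2) by auto
  show "g \<in> mod_hom R M N"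
  proof (rule mod_homI)
    show "g x \<in> carrier N" if "x \<in> carrier M" for x
      using ex[OF that] gp mod_hom_closed[OF q(1)] by auto
    show "g (x \<oplus>\<^bsub>M\<^esub> y) = g x \<oplus>\<^bsub>N\<^esub> g y" if xy: "x \<in> carrier M" "y \<in> carrier M" for x y
    proof -
      obtain x' y' where "x' \<in> carrier P" "y' \<in> carrier P" "x = p x'" "y = p y'"
        using ex[OF xy(1)] ex[OF xy(2)] by blast
      then show ?thesis
        by (simp add: mod_hom_add[OF p(1), symmetric] gp mod_hom_add[OF q(1)])
    qed
    show "g (r \<odot>\<^bsub>M\<^esub> x) = r \<odot>\<^bsub>N\<^esub> g x" if rx: "r \<in> carrier R" "x \<in> carrier M" for r x
    proof -
      obtain x' where "x' \<in> carrier P" "x = p x'" using ex[OF rx(2)] by blast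
      then show ?thesis using rx(1)
        by (simp add: mod_hom_smult[OF p(1), symmetric] gp mod_hom_smult[OF q(1)])
    qed
  qed
qed

text \<open>Both modules are the quotient of \<open>P\<close> by the same kernel. Because of this,
  the choice of a model for a subquotient does not matter later on.\<close>

lemma mod_iso_same_kernel:
  assumes "module R P" "module R M" "module R N"
    and p: "p \<in> mod_hom R P M" "p ` carrier P = carrier M"
    and q: "q \<in> mod_hom R P N" "q ` carrier P = carrier N"
    and ker: "\<And>x. x \<in> carrier P \<Longrightarrow> p x = \<zero>\<^bsub>M\<^esub> \<longleftrightarrow> q x = \<zero>\<^bsub>N\<^esub>"
  shows "mod_iso R M N"
proof -
  obtain g where g: "g \<in> mod_hom R M N" "\<And>x. x \<in> carrier P \<Longrightarrow> g (p x) = q x"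
    using mod_hom_factor[OF assms(1-3) p q(1)] ker by metis
  have "inj_on g (carrier M)"
    unfolding mod_hom_inj_on_iff[OF assms(2,3) g(1)] using g(2) ker p(2) by force
  moreover have "g ` carrier M = carrier N"
    unfolding p(2)[symmetric] q(2)[symmetric] image_image using g(2) by (intro image_cong) auto
  ultimately show ?thesis using g(1) by (auto simp: mod_iso_def bij_betw_def)
qed

lemma mod_iso_image:
  assumes "module R M" "module R N" "f \<in> mod_hom R M N" "inj_on f (carrier M)" "f ` carrier M = K"
  shows "mod_iso R M (N\<lparr>carrier := K\<rparr>)"
  unfolding mod_iso_def
  by (rule bexI[of _ f]) (use assms in \<open>auto simp: bij_betw_def intro!: mod_hom_corestrict\<close>)

lemma mod_iso_carrier_zero:
  assumes "module R M" "module R N" "mod_iso R M N" "carrier M = {\<zero>\<^bsub>M\<^esub>}"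
  shows "carrier N = {\<zero>\<^bsub>N\<^esub>}"
proof -
  obtain f where f: "f \<in> mod_hom R M N" "f ` carrier M = carrier N"
    using assms(3) by (auto simp: mod_iso_def bij_betw_def)
  then have "carrier N = {f \<zero>\<^bsub>M\<^esub>}" using assms(4) by simp
  then show ?thesis using mod_hom_zero[OF assms(1,2) f(1)] by simp
qed

text \<open>Cosets would live in a type of sets; here each coset is replaced by one chosen
  representative, so that the quotient stays in the type of \<open>M\<close>.\<close>

lemma ex_quotient:
  fixes M :: "('r, 'v) module"
  assumes "module R M" "submodule N R M"
  obtains Q :: "('r, 'v) module" and p where "module R Q" "p \<in> mod_hom R M Q"
    "p ` carrier M = carrier Q" "\<And>x. x \<in> carrier M \<Longrightarrow> p x = \<zero>\<^bsub>Q\<^esub> \<longleftrightarrow> x \<in> N"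
proof -
  interpret M: module R M by fact
  note N = assms(2)[unfolded M.submodule_iff]
  \<comment> \<open>The chosen element depends only on the coset of \<open>x\<close>, since
    congruence modulo \<open>N\<close> is an equivalence relation; hence equal cosets get equal
    representatives.\<close>
  define p where "p x = (SOME y. y \<in> carrier M \<and> y \<ominus>\<^bsub>M\<^esub> x \<in> N)" for x
  have p: "p x \<in> carrier M" "p x \<ominus>\<^bsub>M\<^esub> x \<in> N" if "x \<in> carrier M" for x
  proof -
    have "p x \<in> carrier M \<and> p x \<ominus>\<^bsub>M\<^esub> x \<in> N"
      unfolding p_def by (rule someI[of _ x]) (use that N in \<open>auto simp: M.M.r_neg a_minus_def\<close>)
    then show "p x \<in> carrier M" "p x \<ominus>\<^bsub>M\<^esub> x \<in> N" by auto
  qed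
  have swap: "x \<ominus>\<^bsub>M\<^esub> y \<in> N \<longleftrightarrow> y \<ominus>\<^bsub>M\<^esub> x \<in> N" if "x \<in> carrier M" "y \<in> carrier M" for x y
  proof -
    have "x \<ominus>\<^bsub>M\<^esub> y = \<ominus>\<^bsub>M\<^esub> (y \<ominus>\<^bsub>M\<^esub> x)" "y \<ominus>\<^bsub>M\<^esub> x = \<ominus>\<^bsub>M\<^esub> (x \<ominus>\<^bsub>M\<^esub> y)"
      using that by (auto simp: a_minus_def M.M.minus_add M.M.a_comm)
    then show ?thesis using M.submoduleE(3)[OF assms(2)] by metis
  qed
  have tri: "x \<ominus>\<^bsub>M\<^esub> z \<in> N"
    if "x \<ominus>\<^bsub>M\<^esub> y \<in> N" "y \<ominus>\<^bsub>M\<^esub> z \<in> N" "x \<in> carrier M" "y \<in> carrier M" "z \<in> carrier M" for x y z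
  proof -
    have "x \<ominus>\<^bsub>M\<^esub> z = (x \<ominus>\<^bsub>M\<^esub> y) \<oplus>\<^bsub>M\<^esub> (y \<ominus>\<^bsub>M\<^esub> z)"
      using that by (simp add: a_minus_def M.M.a_assoc M.M.r_neg1)
    then show ?thesis using that N by auto
  qed
  have peq: "p x = p y \<longleftrightarrow> x \<ominus>\<^bsub>M\<^esub> y \<in> N" if xy: "x \<in> carrier M" "y \<in> carrier M" for x y
  proof
    assume "p x = p y"
    then show "x \<ominus>\<^bsub>M\<^esub> y \<in> N" using p[OF xy(1)] p[OF xy(2)] swap tri xy by metis
  next
    assume "x \<ominus>\<^bsub>M\<^esub> y \<in> N"
    then have "z \<in> carrier M \<and> z \<ominus>\<^bsub>M\<^esub> x \<in> N \<longleftrightarrow> z \<in> carrier M \<and> z \<ominus>\<^bsub>M\<^esub> y \<in> N" for z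
      using swap tri xy by metis
    then show "p x = p y" unfolding p_def by simp
  qed
  have pp: "p (p x) = p x" if "x \<in> carrier M" for x
    using peq[of "p x" x] p that by auto
  have padd: "p (p x \<oplus>\<^bsub>M\<^esub> p y) = p (x \<oplus>\<^bsub>M\<^esub> y)" if xy: "x \<in> carrier M" "y \<in> carrier M" for x y
  proof (subst peq)
    have "p x \<oplus>\<^bsub>M\<^esub> p y \<ominus>\<^bsub>M\<^esub> (x \<oplus>\<^bsub>M\<^esub> y) = (p x \<ominus>\<^bsub>M\<^esub> x) \<oplus>\<^bsub>M\<^esub> (p y \<ominus>\<^bsub>M\<^esub> y)"
      using p[OF xy(1)] p[OF xy(2)] xy
      by (simp add: a_minus_def M.M.minus_add M.M.a_ac)
    then show "p x \<oplus>\<^bsub>M\<^esub> p y \<ominus>\<^bsub>M\<^esub> (x \<oplus>\<^bsub>M\<^esub> y) \<in> N" using p xy N by auto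
  qed (use p xy in auto)
  have psm: "p (r \<odot>\<^bsub>M\<^esub> p x) = p (r \<odot>\<^bsub>M\<^esub> x)" if "r \<in> carrier R" "x \<in> carrier M" for r x
  proof (subst peq)
    have "r \<odot>\<^bsub>M\<^esub> p x \<ominus>\<^bsub>M\<^esub> r \<odot>\<^bsub>M\<^esub> x = r \<odot>\<^bsub>M\<^esub> (p x \<ominus>\<^bsub>M\<^esub> x)"
      using p[OF that(2)] that by (simp add: a_minus_def M.smult_r_distr M.smult_r_minus)
    then show "r \<odot>\<^bsub>M\<^esub> p x \<ominus>\<^bsub>M\<^esub> r \<odot>\<^bsub>M\<^esub> x \<in> N" using p that N by auto
  qed (use p that in auto)
  have padd1: "p (p x \<oplus>\<^bsub>M\<^esub> y) = p (x \<oplus>\<^bsub>M\<^esub> y)" and padd2: "p (x \<oplus>\<^bsub>M\<^esub> p y) = p (x \<oplus>\<^bsub>M\<^esub> y)"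
    if xy: "x \<in> carrier M" "y \<in> carrier M" for x y
    using padd[of "p x" y] padd[of x y] padd[of x "p y"] p xy pp by auto
  have psm2: "p (r \<odot>\<^bsub>M\<^esub> p x \<oplus>\<^bsub>M\<^esub> s \<odot>\<^bsub>M\<^esub> p x) = p (r \<odot>\<^bsub>M\<^esub> x \<oplus>\<^bsub>M\<^esub> s \<odot>\<^bsub>M\<^esub> x)"
    and psm3: "p (r \<odot>\<^bsub>M\<^esub> (s \<odot>\<^bsub>M\<^esub> p x)) = p (r \<odot>\<^bsub>M\<^esub> (s \<odot>\<^bsub>M\<^esub> x))"
    if "r \<in> carrier R" "s \<in> carrier R" "x \<in> carrier M" for r s x
    using padd[of "r \<odot>\<^bsub>M\<^esub> p x" "s \<odot>\<^bsub>M\<^esub> p x"] padd[of "r \<odot>\<^bsub>M\<^esub> x" "s \<odot>\<^bsub>M\<^esub> x"]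
      psm[of r x] psm[of s x] psm[of "r \<otimes>\<^bsub>R\<^esub> s" x] p[OF that(3)] that
    by (simp_all add: M.smult_assoc1)
  define Q :: "('r, 'v) module" where "Q = \<lparr>carrier = p ` carrier M, mult = undefined, one = undefined, zero = p \<zero>\<^bsub>M\<^esub>,
    add = (\<lambda>x y. p (x \<oplus>\<^bsub>M\<^esub> y)), smult = (\<lambda>r x. p (r \<odot>\<^bsub>M\<^esub> x))\<rparr>"
  have "abelian_group Q"
  proof (rule abelian_groupI)
    fix x assume "x \<in> carrier Q"
    then obtain x' where "x' \<in> carrier M" "x = p x'" by (auto simp: Q_def)
    then show "\<exists>y\<in>carrier Q. y \<oplus>\<^bsub>Q\<^esub> x = \<zero>\<^bsub>Q\<^esub>"
      by (intro bexI[where x = "p (\<ominus>\<^bsub>M\<^esub> x')"]) (auto simp: Q_def padd M.l_neg)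
  qed (auto simp: Q_def padd padd1 padd2 pp p, simp_all add: M.a_ac)
  then have "module R Q"
    by (intro moduleI)
       (auto simp: Q_def padd padd1 padd2 pp psm psm2 psm3 p M.smult_l_distr M.smult_r_distr M.smult_assoc1
             intro: M.is_cring)
  moreover have "p \<in> mod_hom R M Q"
    by (rule mod_homI) (auto simp: Q_def padd psm)
  moreover have "p ` carrier M = carrier Q" by (simp add: Q_def)
  moreover have "p x = \<zero>\<^bsub>Q\<^esub> \<longleftrightarrow> x \<in> N" if "x \<in> carrier M" for x
    using peq[of x "\<zero>\<^bsub>M\<^esub>"] M.M.minus_equality[of "\<zero>\<^bsub>M\<^esub>" "\<zero>\<^bsub>M\<^esub>"] that
    by (simp add: Q_def a_minus_def)
  ultimately show ?thesis using that by blast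
qed

section \<open>Direct sums of two modules\<close>

lemma module_sum:
  assumes "module R M" "module R N"
  shows "module R (mod_sum M N)"
proof -
  interpret M: module R M by fact
  interpret N: module R N by fact
  have "abelian_group (mod_sum M N)"
  proof (rule abelian_groupI)
    fix x assume "x \<in> carrier (mod_sum M N)"
    then obtain u v where "u \<in> carrier M" "v \<in> carrier N" "x = (u, v)"
      by (auto simp: mod_sum_def)
    then show "\<exists>y\<in>carrier (mod_sum M N). y \<oplus>\<^bsub>mod_sum M N\<^esub> x = \<zero>\<^bsub>mod_sum M N\<^esub>"
      by (intro bexI[where x = "(\<ominus>\<^bsub>M\<^esub> u, \<ominus>\<^bsub>N\<^esub> v)"]) (auto simp: mod_sum_def M.M.l_neg N.M.l_neg)
  qed (auto simp: mod_sum_def M.M.a_ac N.M.a_ac)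
  then show ?thesis
    by (intro moduleI)
       (auto simp: mod_sum_def M.smult_l_distr M.smult_r_distr M.smult_assoc1
             N.smult_l_distr N.smult_r_distr N.smult_assoc1 intro: M.is_cring)
qed

lemma mod_hom_fst: "fst \<in> mod_hom R (mod_sum M N) M"
  and mod_hom_snd: "snd \<in> mod_hom R (mod_sum M N) N"
  by (auto simp: mod_hom_def mod_sum_def)

lemma mod_hom_Pair:
  "f \<in> mod_hom R L M \<Longrightarrow> g \<in> mod_hom R L N \<Longrightarrow> (\<lambda>x. (f x, g x)) \<in> mod_hom R L (mod_sum M N)"
  by (auto simp: mod_hom_def mod_sum_def)

lemma mod_sum_simps [simp]:
  "carrier (mod_sum M N) = carrier M \<times> carrier N"
  "\<zero>\<^bsub>mod_sum M N\<^esub> = (\<zero>\<^bsub>M\<^esub>, \<zero>\<^bsub>N\<^esub>)"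
  "(x, y) \<oplus>\<^bsub>mod_sum M N\<^esub> (x', y') = (x \<oplus>\<^bsub>M\<^esub> x', y \<oplus>\<^bsub>N\<^esub> y')"
  "r \<odot>\<^bsub>mod_sum M N\<^esub> (x, y) = (r \<odot>\<^bsub>M\<^esub> x, r \<odot>\<^bsub>N\<^esub> y)"
  by (simp_all add: mod_sum_def)

lemma mod_hom_sum:
  assumes "module R P" "f \<in> mod_hom R M P" "g \<in> mod_hom R N P"
  shows "(\<lambda>(x, y). f x \<oplus>\<^bsub>P\<^esub> g y) \<in> mod_hom R (mod_sum M N) P"
proof -
  interpret P: module R P by fact
  show ?thesis
    by (rule mod_homI)
       (use mod_hom_closed[OF assms(2)] mod_hom_closed[OF assms(3)] in
         \<open>auto simp: mod_hom_add[OF assms(2)] mod_hom_add[OF assms(3)]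
           mod_hom_smult[OF assms(2)] mod_hom_smult[OF assms(3)] P.smult_r_distr P.M.a_ac\<close>)
qed

section \<open>Finite generation\<close>

text \<open>An inductive span supports induction over a linear combination. As it never mentions the
  carrier of the module, restricting the carrier does not change it.\<close>

inductive_set lspan :: "('r, 'p) ring_scheme \<Rightarrow> ('r, 'v, 'q) module_scheme \<Rightarrow> 'v set \<Rightarrow> 'v set"
  for R M B where
    zero: "\<zero>\<^bsub>M\<^esub> \<in> lspan R M B"
  | step: "r \<in> carrier R \<Longrightarrow> v \<in> B \<Longrightarrow> x \<in> lspan R M B \<Longrightarrow> r \<odot>\<^bsub>M\<^esub> v \<oplus>\<^bsub>M\<^esub> x \<in> lspan R M B"

lemma (in module) lspan_subset:
  assumes "submodule N R M" "B \<subseteq> N"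
  shows "lspan R M B \<subseteq> N"
proof
  fix x assume "x \<in> lspan R M B"
  then show "x \<in> N"
    by induction (use assms submodule_iff in auto)
qed

lemma (in module) lspan_superset:
  assumes "B \<subseteq> carrier M" shows "B \<subseteq> lspan R M B"
proof
  fix v assume "v \<in> B"
  then show "v \<in> lspan R M B"
    using lspan.step[OF R.one_closed \<open>v \<in> B\<close> lspan.zero, of M] assms by auto
qed

lemma (in module) lspan_submodule:
  assumes B: "B \<subseteq> carrier M" shows "submodule (lspan R M B) R M"
proof -
  have sub: "lspan R M B \<subseteq> carrier M" by (rule lspan_subset[OF carrier_is_submodule B])
  have add: "x \<oplus>\<^bsub>M\<^esub> y \<in> lspan R M B" if "x \<in> lspan R M B" "y \<in> lspan R M B" for x y
    using that(1)
  proof induction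
    case zero
    then show ?case using that(2) sub by auto
  next
    case (step r v x)
    have "r \<odot>\<^bsub>M\<^esub> v \<oplus>\<^bsub>M\<^esub> x \<oplus>\<^bsub>M\<^esub> y = r \<odot>\<^bsub>M\<^esub> v \<oplus>\<^bsub>M\<^esub> (x \<oplus>\<^bsub>M\<^esub> y)"
      using step that(2) sub B by (intro M.a_assoc) auto
    then show ?case using lspan.step[OF step(1,2,4)] by simp
  qed
  have "s \<odot>\<^bsub>M\<^esub> x \<in> lspan R M B" if "s \<in> carrier R" "x \<in> lspan R M B" for s x
    using that(2)
  proof induction
    case zero
    then show ?case using that(1) by (simp add: lspan.zero)
  next
    case (step r v x)
    have "s \<odot>\<^bsub>M\<^esub> (r \<odot>\<^bsub>M\<^esub> v \<oplus>\<^bsub>M\<^esub> x) = (s \<otimes> r) \<odot>\<^bsub>M\<^esub> v \<oplus>\<^bsub>M\<^esub> s \<odot>\<^bsub>M\<^esub> x"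
      using step that(1) sub B by (subst smult_r_distr) (auto simp: smult_assoc1)
    then show ?case using lspan.step[of "s \<otimes> r" R v B "s \<odot>\<^bsub>M\<^esub> x" M] step that by simp
  qed
  with add sub show ?thesis by (simp add: submodule_iff lspan.zero)
qed

lemma (in module) lspan_mono:
  assumes "A \<subseteq> B" "B \<subseteq> carrier M" shows "lspan R M A \<subseteq> lspan R M B"
  using assms lspan_superset by (intro lspan_subset lspan_submodule) auto

lemma lspan_restrict [simp]: "lspan R (M\<lparr>carrier := K\<rparr>) B = lspan R M B"
proof
  show "lspan R (M\<lparr>carrier := K\<rparr>) B \<subseteq> lspan R M B"
  proof
    fix x assume "x \<in> lspan R (M\<lparr>carrier := K\<rparr>) B"
    then show "x \<in> lspan R M B"
      by induction (auto intro: lspan.intros)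
  qed
  show "lspan R M B \<subseteq> lspan R (M\<lparr>carrier := K\<rparr>) B"
  proof
    fix x assume "x \<in> lspan R M B"
    then show "x \<in> lspan R (M\<lparr>carrier := K\<rparr>) B"
      by induction
        (use lspan.zero[of "M\<lparr>carrier := K\<rparr>" R B] lspan.step[of _ R _ B _ "M\<lparr>carrier := K\<rparr>"]
         in auto)
  qed
qed

lemma fin_gen_iff:
  assumes "module R M"
  shows "fin_gen R M \<longleftrightarrow> (\<exists>B. finite B \<and> B \<subseteq> carrier M \<and> carrier M \<subseteq> lspan R M B)"
proof -
  interpret module R M by fact
  have A: "(\<Oplus>\<^bsub>M\<^esub>v\<in>B. c v \<odot>\<^bsub>M\<^esub> v) \<in> lspan R M B"
    if "finite B" "B \<subseteq> carrier M" "c \<in> B \<rightarrow> carrier R" for B c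
    using that
  proof (induction B)
    case empty
    then show ?case by (simp add: lspan.zero)
  next
    case (insert v B)
    then have "(\<Oplus>\<^bsub>M\<^esub>v\<in>B. c v \<odot>\<^bsub>M\<^esub> v) \<in> lspan R M (insert v B)"
      using lspan_mono[of B "insert v B"] by auto
    moreover have "(\<Oplus>\<^bsub>M\<^esub>v\<in>insert v B. c v \<odot>\<^bsub>M\<^esub> v) = c v \<odot>\<^bsub>M\<^esub> v \<oplus>\<^bsub>M\<^esub> (\<Oplus>\<^bsub>M\<^esub>v\<in>B. c v \<odot>\<^bsub>M\<^esub> v)"
      using insert by (subst M.finsum_insert) auto
    ultimately show ?case using insert by (auto intro: lspan.step)
  qed
  have B: "\<exists>c\<in>B \<rightarrow> carrier R. x = (\<Oplus>\<^bsub>M\<^esub>v\<in>B. c v \<odot>\<^bsub>M\<^esub> v)"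
    if "finite B" "B \<subseteq> carrier M" "x \<in> lspan R M B" for B x
    using that(3)
  proof induction
    case zero
    have "(\<Oplus>\<^bsub>M\<^esub>v\<in>B. \<zero>\<^bsub>R\<^esub> \<odot>\<^bsub>M\<^esub> v) = \<zero>\<^bsub>M\<^esub>"
      using that(2) by (intro M.add.finprod_one_eqI) auto
    then show ?case by (intro bexI[of _ "\<lambda>_. \<zero>\<^bsub>R\<^esub>"]) auto
  next
    case (step r v x)
    then obtain c where c: "c \<in> B \<rightarrow> carrier R" "x = (\<Oplus>\<^bsub>M\<^esub>v\<in>B. c v \<odot>\<^bsub>M\<^esub> v)" by auto
    \<comment> \<open>\<open>v\<close> already carries a coefficient in the combination for
      \<open>x\<close>, so the new coefficient \<open>r\<close> is added to it.\<close>
    let ?c = "c(v := r \<oplus>\<^bsub>R\<^esub> c v)" and ?B = "B - {v}"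
    have ins: "B = insert v ?B" using step by auto
    have rest: "(\<Oplus>\<^bsub>M\<^esub>w\<in>?B. ?c w \<odot>\<^bsub>M\<^esub> w) = (\<Oplus>\<^bsub>M\<^esub>w\<in>?B. c w \<odot>\<^bsub>M\<^esub> w)"
      using c that by (intro M.finsum_cong') auto
    have cl: "(\<Oplus>\<^bsub>M\<^esub>w\<in>?B. c w \<odot>\<^bsub>M\<^esub> w) \<in> carrier M" "v \<in> carrier M" "c v \<in> carrier R"
      using c that step by (auto intro!: M.finsum_closed)
    have "(\<Oplus>\<^bsub>M\<^esub>w\<in>insert v ?B. ?c w \<odot>\<^bsub>M\<^esub> w) = ?c v \<odot>\<^bsub>M\<^esub> v \<oplus>\<^bsub>M\<^esub> (\<Oplus>\<^bsub>M\<^esub>w\<in>?B. ?c w \<odot>\<^bsub>M\<^esub> w)"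
      using c that step(1) cl by (intro M.finsum_insert) (auto simp: Pi_iff subset_iff)
    also have "\<dots> = r \<odot>\<^bsub>M\<^esub> v \<oplus>\<^bsub>M\<^esub> (c v \<odot>\<^bsub>M\<^esub> v \<oplus>\<^bsub>M\<^esub> (\<Oplus>\<^bsub>M\<^esub>w\<in>?B. c w \<odot>\<^bsub>M\<^esub> w))"
      unfolding rest using cl step(1) by (simp add: smult_l_distr M.a_assoc)
    also have "c v \<odot>\<^bsub>M\<^esub> v \<oplus>\<^bsub>M\<^esub> (\<Oplus>\<^bsub>M\<^esub>w\<in>?B. c w \<odot>\<^bsub>M\<^esub> w) = (\<Oplus>\<^bsub>M\<^esub>w\<in>insert v ?B. c w \<odot>\<^bsub>M\<^esub> w)"
      using c that cl by (intro M.finsum_insert[symmetric]) auto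
    finally have "r \<odot>\<^bsub>M\<^esub> v \<oplus>\<^bsub>M\<^esub> x = (\<Oplus>\<^bsub>M\<^esub>w\<in>B. ?c w \<odot>\<^bsub>M\<^esub> w)"
      unfolding c(2) ins[symmetric] by simp
    moreover have "?c \<in> B \<rightarrow> carrier R" using c(1) cl(3) step(1) by (auto simp: Pi_iff)
    ultimately show ?case by blast
  qed
  have "(\<forall>x\<in>carrier M. \<exists>c\<in>B \<rightarrow> carrier R. x = (\<Oplus>\<^bsub>M\<^esub>v\<in>B. c v \<odot>\<^bsub>M\<^esub> v)) \<longleftrightarrow> carrier M \<subseteq> lspan R M B"
    if "finite B" "B \<subseteq> carrier M" for B
    using A[OF that] B[OF that] by auto
  then show ?thesis unfolding fin_gen_def by (intro ex_cong1) auto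
qed

lemma lspan_image:
  assumes "module R M" "module R N" "f \<in> mod_hom R M N" "B \<subseteq> carrier M"
  shows "f ` lspan R M B = lspan R N (f ` B)"
proof -
  interpret M: module R M by fact
  interpret N: module R N by fact
  have fB: "f ` B \<subseteq> carrier N" using mod_hom_closed[OF assms(3)] assms(4) by auto
  show ?thesis
  proof
    have "lspan R M B \<subseteq> {x \<in> carrier M. f x \<in> lspan R N (f ` B)}"
      by (intro M.lspan_subset submodule_vimage[OF assms(1-3)] N.lspan_submodule fB)
        (use assms(4) N.lspan_superset[OF fB] in blast)
    then show "f ` lspan R M B \<subseteq> lspan R N (f ` B)" by auto
    show "lspan R N (f ` B) \<subseteq> f ` lspan R M B"
      using M.lspan_superset[OF assms(4)]
      by (intro N.lspan_subset submodule_image[OF assms(1-3)] M.lspan_submodule assms(4)) blast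
  qed
qed

lemma fin_gen_image:
  assumes "module R M" "module R N" "f \<in> mod_hom R M N" "f ` carrier M = carrier N" "fin_gen R M"
  shows "fin_gen R N"
proof -
  obtain B where B: "finite B" "B \<subseteq> carrier M" "carrier M \<subseteq> lspan R M B"
    using assms(5) fin_gen_iff[OF assms(1)] by auto
  then have "carrier N \<subseteq> lspan R N (f ` B)"
    unfolding assms(4)[symmetric] lspan_image[OF assms(1-3) B(2), symmetric] by auto
  then show ?thesis unfolding fin_gen_iff[OF assms(2)]
    using B assms(3) by (intro exI[of _ "f ` B"]) (auto dest: mod_hom_closed)
qed

lemma fin_gen_iso:
  assumes "module R M" "module R N" "mod_iso R M N" "fin_gen R M"
  shows "fin_gen R N"
  using assms fin_gen_image unfolding mod_iso_def bij_betw_def by blast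

lemma fin_gen_zero:
  assumes "module R M" "carrier M = {\<zero>\<^bsub>M\<^esub>}" shows "fin_gen R M"
  unfolding fin_gen_iff[OF assms(1)] using assms(2)
  by (intro exI[of _ "{}"]) (simp add: lspan.zero)

text \<open>Generators of the kernel together with preimages of generators of the image suffice:
  subtracting from \<open>x\<close> a combination of the preimages with the same image leaves an
  element of the kernel.\<close>

lemma fin_gen_extension:
  assumes "module R M" "module R N" "f \<in> mod_hom R M N"
    and ker: "fin_gen R (M\<lparr>carrier := {x \<in> carrier M. f x = \<zero>\<^bsub>N\<^esub>}\<rparr>)"
    and im: "fin_gen R (N\<lparr>carrier := f ` carrier M\<rparr>)"
  shows "fin_gen R M"
proof -
  interpret M: module R M by fact
  interpret N: module R N by fact
  have kmod: "module R (M\<lparr>carrier := {x \<in> carrier M. f x = \<zero>\<^bsub>N\<^esub>}\<rparr>)"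
    by (rule M.module_restrict[OF submodule_kernel[OF assms(1-3)]])
  have imod: "module R (N\<lparr>carrier := f ` carrier M\<rparr>)"
    by (rule N.module_restrict[OF submodule_image[OF assms(1-3) M.carrier_is_submodule]])
  obtain B where B: "finite B" "B \<subseteq> carrier M" "{x \<in> carrier M. f x = \<zero>\<^bsub>N\<^esub>} \<subseteq> lspan R M B"
    using ker unfolding fin_gen_iff[OF kmod] by auto
  obtain C where "finite C" "C \<subseteq> f ` carrier M" and C: "f ` carrier M \<subseteq> lspan R N C"
    using im unfolding fin_gen_iff[OF imod] by auto
  then obtain D where D: "finite D" "D \<subseteq> carrier M" "C = f ` D"
    using finite_subset_image by metis
  have "x \<in> lspan R M (B \<union> D)" if x: "x \<in> carrier M" for x
  proof -
    have sub: "submodule (lspan R M (B \<union> D)) R M" using B D by (intro M.lspan_submodule) auto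
    obtain y where y: "y \<in> lspan R M D" "f x = f y"
      using C x unfolding D(3) lspan_image[OF assms(1-3) D(2), symmetric] by auto
    then have y': "y \<in> carrier M" using M.lspan_subset[OF M.carrier_is_submodule D(2)] by auto
    have "x \<ominus>\<^bsub>M\<^esub> y \<in> lspan R M B"
      using B(3) y(2) x y' mod_hom_eq_iff[OF assms(1-3)] by auto
    then have "x \<ominus>\<^bsub>M\<^esub> y \<in> lspan R M (B \<union> D)" "y \<in> lspan R M (B \<union> D)"
      using y(1) M.lspan_mono[of B "B \<union> D"] M.lspan_mono[of D "B \<union> D"] B D by auto
    moreover have "x = (x \<ominus>\<^bsub>M\<^esub> y) \<oplus>\<^bsub>M\<^esub> y"
      using x y' by (simp add: a_minus_def M.M.a_assoc M.M.l_neg)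
    ultimately show ?thesis using sub M.submodule_iff by metis
  qed
  then show ?thesis unfolding fin_gen_iff[OF assms(1)]
    using B D by (intro exI[of _ "B \<union> D"]) auto
qed

definition noeth :: "('r, 'p) ring_scheme \<Rightarrow> ('r, 'v) module \<Rightarrow> bool" where
  "noeth R M \<longleftrightarrow> (\<forall>K. submodule K R M \<longrightarrow> fin_gen R (M\<lparr>carrier := K\<rparr>))"

text \<open>A submodule \<open>K\<close> inherits the sequence: its part killed by \<open>f\<close>
  lies in the kernel and its image lies in \<open>N\<close>. Both are finitely generated, so
  \<open>fin_gen_extension\<close> applies to \<open>K\<close>.\<close>

lemma noeth_extension:
  assumes "module R M" "module R N" "f \<in> mod_hom R M N"
    and ker: "noeth R (M\<lparr>carrier := {x \<in> carrier M. f x = \<zero>\<^bsub>N\<^esub>}\<rparr>)"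
    and im: "noeth R N"
  shows "noeth R M"
  unfolding noeth_def
proof (intro allI impI)
  interpret M: module R M by fact
  interpret N: module R N by fact
  fix K assume K: "submodule K R M"
  then have KM: "K \<subseteq> carrier M" by (simp add: M.submodule_iff)
  interpret K: module R "M\<lparr>carrier := K\<rparr>" by (rule M.module_restrict[OF K])
  have f: "f \<in> mod_hom R (M\<lparr>carrier := K\<rparr>) N" using assms(3) KM by (rule mod_hom_restrict)
  let ?k = "{x \<in> K. f x = \<zero>\<^bsub>N\<^esub>}"
  have "submodule ?k R (M\<lparr>carrier := K\<rparr>)"
    using submodule_kernel[OF K.module_axioms assms(2) f] by simp
  then have "submodule ?k R (M\<lparr>carrier := {x \<in> carrier M. f x = \<zero>\<^bsub>N\<^esub>}\<rparr>)"
    using KM M.submodule_restrict_iff[OF K] M.submodule_restrict_iff[OF submodule_kernel[OF assms(1-3)]]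
    by auto
  then have "fin_gen R (M\<lparr>carrier := ?k\<rparr>)" using ker by (auto simp: noeth_def)
  moreover have "fin_gen R (N\<lparr>carrier := f ` K\<rparr>)"
    using im submodule_image[OF assms(1-3) K] by (simp add: noeth_def)
  ultimately show "fin_gen R (M\<lparr>carrier := K\<rparr>)"
    using fin_gen_extension[OF K.module_axioms assms(2) f] by simp
qed

lemma noeth_image:
  assumes "module R M" "module R N" "f \<in> mod_hom R M N" "f ` carrier M = carrier N" "noeth R M"
  shows "noeth R N"
  unfolding noeth_def
proof (intro allI impI)
  interpret M: module R M by fact
  interpret N: module R N by fact
  fix K assume K: "submodule K R N"
  let ?L = "{x \<in> carrier M. f x \<in> K}"
  have L: "submodule ?L R M" by (rule submodule_vimage[OF assms(1-3) K])
  have img: "f ` ?L = K" using K assms(4) unfolding N.submodule_iff by auto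
  show "fin_gen R (N\<lparr>carrier := K\<rparr>)"
  proof (rule fin_gen_image)
    show "module R (M\<lparr>carrier := ?L\<rparr>)" by (rule M.module_restrict[OF L])
    show "module R (N\<lparr>carrier := K\<rparr>)" by (rule N.module_restrict[OF K])
    show "f \<in> mod_hom R (M\<lparr>carrier := ?L\<rparr>) (N\<lparr>carrier := K\<rparr>)"
      by (intro mod_hom_corestrict mod_hom_restrict assms(3)) auto
    show "f ` carrier (M\<lparr>carrier := ?L\<rparr>) = carrier (N\<lparr>carrier := K\<rparr>)" using img by simp
    show "fin_gen R (M\<lparr>carrier := ?L\<rparr>)" using L assms(5) by (simp add: noeth_def)
  qed
qed

lemma noeth_sum:
  assumes "module R M" "module R N" "noeth R M" "noeth R N"
  shows "noeth R (mod_sum M N)"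
proof (rule noeth_extension)
  interpret M: module R M by fact
  interpret N: module R N by fact
  interpret S: module R "mod_sum M N" by (rule module_sum[OF assms(1,2)])
  show "module R (mod_sum M N)" ..
  show "fst \<in> mod_hom R (mod_sum M N) M" by (rule mod_hom_fst)
  let ?K = "{x \<in> carrier (mod_sum M N). fst x = \<zero>\<^bsub>M\<^esub>}"
  have K: "submodule ?K R (mod_sum M N)"
    by (rule submodule_kernel[OF S.module_axioms assms(1) mod_hom_fst])
  show "noeth R (mod_sum M N\<lparr>carrier := ?K\<rparr>)"
  proof (rule noeth_image[OF assms(2) _ _ _ assms(4)])
    show "module R (mod_sum M N\<lparr>carrier := ?K\<rparr>)" by (rule S.module_restrict[OF K])
    show "(\<lambda>y. (\<zero>\<^bsub>M\<^esub>, y)) \<in> mod_hom R N (mod_sum M N\<lparr>carrier := ?K\<rparr>)"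
      by (rule mod_homI) auto
  qed (use assms in auto)
qed (use assms in auto)

lemma module_ideal_module: "cring R \<Longrightarrow> module R (ideal_module R (carrier R))"
proof -
  assume "cring R"
  then interpret cring R .
  show ?thesis
    by (intro moduleI abelian_groupI is_cring)
       (auto simp: ideal_module_def l_distr r_distr m_assoc a_ac
          intro: bexI[of _ "\<ominus>\<^bsub>R\<^esub> _"] l_neg)
qed

text \<open>Induction over the generators: the span of \<open>insert v B\<close> is the image of the
  direct sum of the ring and the span of \<open>B\<close>, and the Noetherian property passes to
  sums and to images.\<close>

lemma fin_gen_imp_noeth:
  assumes "noeth R (ideal_module R (carrier R))" "module R M" "fin_gen R M"
  shows "noeth R M"
proof -
  interpret M: module R M by fact
  have reg: "module R (ideal_module R (carrier R))" by (rule module_ideal_module[OF M.R.is_cring])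
  obtain B where "finite B" "B \<subseteq> carrier M" and B: "carrier M \<subseteq> lspan R M B"
    using assms(3) fin_gen_iff[OF assms(2)] by auto
  from this(1,2) have "noeth R (M\<lparr>carrier := lspan R M B\<rparr>)"
  proof (induction B)
    case empty
    have z: "lspan R M {} = {\<zero>\<^bsub>M\<^esub>}"
      using M.lspan_subset[OF M.submodule_zero_submodule] lspan.zero by fast
    have "fin_gen R (M\<lparr>carrier := K\<rparr>)" if "submodule K R M" "K \<subseteq> {\<zero>\<^bsub>M\<^esub>}" for K
      using that M.submodule_zero[OF that(1)] M.module_restrict[OF that(1)]
      by (intro fin_gen_zero) auto
    then show ?case unfolding z noeth_def M.submodule_restrict_iff[OF M.submodule_zero_submodule]
      by simp
  next
    case (insert v B)
    let ?L = "M\<lparr>carrier := lspan R M B\<rparr>" and ?N = "lspan R M (insert v B)"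
    have L: "submodule (lspan R M B) R M" and N: "submodule ?N R M"
      using insert by (auto intro!: M.lspan_submodule)
    have mL: "module R ?L" by (rule M.module_restrict[OF L])
    have LM: "lspan R M B \<subseteq> carrier M" using L by (simp add: M.submodule_iff)
    let ?S = "mod_sum (ideal_module R (carrier R)) ?L"
    let ?f = "\<lambda>(r, x). r \<odot>\<^bsub>M\<^esub> v \<oplus>\<^bsub>M\<^esub> x"
    have mS: "module R ?S" by (rule module_sum[OF reg mL])
    have f: "?f \<in> mod_hom R ?S M"
      using insert LM by (intro mod_hom_sum M.mod_hom_orbit mod_hom_inclusion M.module_axioms) auto
    interpret S: module R ?S by fact
    have "submodule (?f ` carrier ?S) R M"
      by (rule submodule_image[OF mS assms(2) f S.carrier_is_submodule])
    moreover have "insert v B \<subseteq> ?f ` carrier ?S"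
    proof -
      have "v = ?f (\<one>\<^bsub>R\<^esub>, \<zero>\<^bsub>M\<^esub>)" "w = ?f (\<zero>\<^bsub>R\<^esub>, w)" if "w \<in> B" for w
        using insert that by auto
      moreover have "v = ?f (\<one>\<^bsub>R\<^esub>, \<zero>\<^bsub>M\<^esub>)" using insert by auto
      moreover have "(\<one>\<^bsub>R\<^esub>, \<zero>\<^bsub>M\<^esub>) \<in> carrier ?S" by (simp add: ideal_module_def lspan.zero)
      moreover have "(\<zero>\<^bsub>R\<^esub>, w) \<in> carrier ?S" if "w \<in> B" for w
        using M.lspan_superset[of B] insert that by (auto simp: ideal_module_def)
      ultimately show ?thesis by (metis (no_types, lifting) image_eqI insert_iff subsetI)
    qed
    ultimately have "?N \<subseteq> ?f ` carrier ?S" by (rule M.lspan_subset)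
    moreover have "?f ` carrier ?S \<subseteq> ?N"
    proof -
      have "?f (r, x) \<in> ?N" if "r \<in> carrier R" "x \<in> lspan R M B" for r x
        using that insert M.lspan_mono[of B "insert v B"] by (auto intro!: lspan.step)
      then show ?thesis by (auto simp: ideal_module_def)
    qed
    ultimately have im: "?f ` carrier ?S = ?N" by auto
    show ?case
    proof (rule noeth_image)
      show "module R ?S" by fact
      show "module R (M\<lparr>carrier := ?N\<rparr>)" by (rule M.module_restrict[OF N])
      show "?f \<in> mod_hom R ?S (M\<lparr>carrier := ?N\<rparr>)" using im by (intro mod_hom_corestrict f) auto
      show "?f ` carrier ?S = carrier (M\<lparr>carrier := ?N\<rparr>)" using im by simp
      show "noeth R ?S" using insert by (intro noeth_sum reg mL assms(1)) auto
    qed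
  qed
  moreover have "lspan R M B = carrier M"
    using B M.lspan_subset[OF M.carrier_is_submodule \<open>B \<subseteq> carrier M\<close>] by auto
  ultimately show ?thesis by simp
qed

section \<open>Membership up to isomorphism\<close>

text \<open>
  Modules over arbitrary types are compared with a subcategory through their isomorphic copies,
  so that constructions such as direct sums need not be carried out inside the type \<open>'v\<close>.
\<close>

definition memb :: "('r, 'p) ring_scheme \<Rightarrow> ('r, 'v) module set \<Rightarrow> ('r, 'w) module \<Rightarrow> bool" where
  "memb R X M \<longleftrightarrow> (\<exists>N\<in>X. mod_iso R M N)"

text \<open>The injection \<open>\<iota>\<close> records that the type of the objects is at least as
  large as the ring. With an infinite Noetherian ring, every finitely generated module and all its
  submodules then have copies in that type.\<close>

locale noeth_cring = cring R for R :: "('r, 'p) ring_scheme" +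
  fixes \<iota> :: "'r \<Rightarrow> 'v"
  assumes infinite_carrier: "infinite (carrier R)"
    and inj_\<iota>: "inj \<iota>"
    and noeth_regular: "noeth R (ideal_module R (carrier R))"
begin

lemma module_regular: "module R (ideal_module R (carrier R))"
  by (rule module_ideal_module) (rule is_cring)

lemma fin_gen_submodule:
  fixes M :: "('r, 'w) module"
  assumes "module R M" "fin_gen R M" "submodule K R M"
  shows "fin_gen R (M\<lparr>carrier := K\<rparr>)"
  using fin_gen_imp_noeth[OF noeth_regular assms(1,2)] assms(3) by (simp add: noeth_def)

lemma ex_copy:
  fixes M :: "('r, 'w) module"
  assumes "module R M" "fin_gen R M"
  obtains N :: "('r, 'v) module" where "N \<in> fg_mod R" "module R N" "mod_iso R M N"
  using fg_mod_copy[OF infinite_carrier inj_\<iota> assms] by (auto simp: fg_mod_def)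

end

section \<open>Closure properties of a subcategory, tested up to isomorphism\<close>

locale subcat = noeth_cring R \<iota> for R :: "('r, 'p) ring_scheme" and \<iota> :: "'r \<Rightarrow> 'v" +
  fixes X :: "('r, 'v) module set"
  assumes X: "strict_full_subcat R X"
begin

lemma X_fg: "N \<in> X \<Longrightarrow> N \<in> fg_mod R" "N \<in> X \<Longrightarrow> module R N" "N \<in> X \<Longrightarrow> fin_gen R N"
  using X by (auto simp: strict_full_subcat_def fg_mod_def)

lemma X_iso: "M \<in> X \<Longrightarrow> N \<in> fg_mod R \<Longrightarrow> mod_iso R M N \<Longrightarrow> N \<in> X"
  using X by (auto simp: strict_full_subcat_def)

lemma memb_self: "N \<in> X \<Longrightarrow> memb R X N"
  unfolding memb_def using mod_iso_refl by blast

lemma memb_iff: "N \<in> fg_mod R \<Longrightarrow> memb R X N \<longleftrightarrow> N \<in> X"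
proof
  assume N: "N \<in> fg_mod R" "memb R X N"
  then obtain M where M: "M \<in> X" "mod_iso R N M" by (auto simp: memb_def)
  have "mod_iso R M N" using mod_iso_sym[OF _ M(2)] N(1) by (simp add: fg_mod_def)
  then show "N \<in> X" by (rule X_iso[OF M(1) N(1)])
qed (rule memb_self)

lemma memb_cong:
  assumes "module R M" "mod_iso R M M'" "memb R X M"
  shows "memb R X M'"
  using assms mod_iso_trans mod_iso_sym unfolding memb_def by blast

lemma memb_fin_gen:
  assumes "module R M" "memb R X M" shows "fin_gen R M"
proof -
  obtain N where "N \<in> X" "mod_iso R M N" using assms by (auto simp: memb_def)
  then show ?thesis using fin_gen_iso X_fg assms(1) mod_iso_sym by blast
qed

text \<open>Closure under extensions speaks of sequences inside the type of the objects, so the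
  given sequence is conjugated by isomorphisms: \<open>h\<close> and \<open>k\<close> for the middle
  term, \<open>i\<close> for the kernel and \<open>n\<close> for the quotient.\<close>

lemma memb_extension:
  assumes ext: "closed_extensions R X"
    and "module R M" "module R N" "f \<in> mod_hom R M N" "f ` carrier M = carrier N"
    and ker: "memb R X (M\<lparr>carrier := {x \<in> carrier M. f x = \<zero>\<^bsub>N\<^esub>}\<rparr>)"
    and im: "memb R X N"
  shows "memb R X M"
proof -
  interpret M: module R M by fact
  let ?K = "{x \<in> carrier M. f x = \<zero>\<^bsub>N\<^esub>}"
  have K: "module R (M\<lparr>carrier := ?K\<rparr>)"
    by (rule M.module_restrict[OF submodule_kernel[OF assms(2-4)]])
  \<comment> \<open>The middle term must be finitely generated to have a copy; this follows from the
    two outer terms.\<close>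
  have "fin_gen R M"
    using memb_fin_gen[OF K ker] memb_fin_gen[OF assms(3) im] assms(5)
    by (intro fin_gen_extension[OF assms(2-4)]) auto
  then obtain M' :: "('r, 'v) module"
    where M': "M' \<in> fg_mod R" "module R M'" "mod_iso R M M'"
    using ex_copy[OF assms(2)] by blast
  obtain h where h: "h \<in> mod_hom R M M'" "bij_betw h (carrier M) (carrier M')"
    using M'(3) by (auto simp: mod_iso_def)
  obtain k where k: "k \<in> mod_hom R M' M" "bij_betw k (carrier M') (carrier M)"
    and kh: "\<And>x. x \<in> carrier M \<Longrightarrow> k (h x) = x"
    using mod_hom_inv_into[OF assms(2) h] bij_betw_inv_into[OF h(2)] inv_into_f_f h(2)
    by (metis bij_betw_def)
  have hk: "h (k y) = y" if y: "y \<in> carrier M'" for y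
  proof -
    obtain x where "x \<in> carrier M" "y = h x"
      using y bij_betw_imp_surj_on[OF h(2)] by blast
    then show ?thesis using kh by simp
  qed
  obtain L' where L': "L' \<in> X" "mod_iso R (M\<lparr>carrier := ?K\<rparr>) L'"
    using ker by (auto simp: memb_def)
  obtain i where i: "i \<in> mod_hom R L' (M\<lparr>carrier := ?K\<rparr>)" "bij_betw i (carrier L') ?K"
    using mod_iso_sym[OF K L'(2)] by (auto simp: mod_iso_def)
  obtain N' n where N': "N' \<in> X" "n \<in> mod_hom R N N'" "bij_betw n (carrier N) (carrier N')"
    using im by (auto simp: memb_def mod_iso_def)
  have nz: "n y = \<zero>\<^bsub>N'\<^esub> \<longleftrightarrow> y = \<zero>\<^bsub>N\<^esub>" if "y \<in> carrier N" for y
    using N'(3) that mod_hom_inj_on_iff[OF assms(3) X_fg(2)[OF N'(1)] N'(2)]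
      mod_hom_zero[OF assms(3) X_fg(2)[OF N'(1)] N'(2)] by (auto simp: bij_betw_def)
  have fk: "f x \<in> carrier N" if "x \<in> carrier M" for x using that assms(4) mod_hom_closed by fast
  have kM: "k y \<in> carrier M" if "y \<in> carrier M'" for y using that k(1) mod_hom_closed by fast
  have "short_exact R L' (h \<circ> i) M' (n \<circ> (f \<circ> k)) N'"
    unfolding short_exact_def
  proof (intro conjI)
    have "i \<in> mod_hom R L' M" using i(1) by (auto simp: mod_hom_def)
    then show "h \<circ> i \<in> mod_hom R L' M'" using h(1) by (rule mod_hom_comp)
    show "n \<circ> (f \<circ> k) \<in> mod_hom R M' N'"
      using k(1) assms(4) N'(2) by (intro mod_hom_comp)
    show "inj_on (h \<circ> i) (carrier L')"
      using i(2) h(2) by (intro comp_inj_on) (auto simp: bij_betw_def intro: inj_on_subset)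
    have "(h \<circ> i) ` carrier L' = h ` ?K" unfolding image_comp[symmetric] using i(2) by (simp add: bij_betw_def)
    also have "\<dots> = {x \<in> carrier M'. f (k x) = \<zero>\<^bsub>N\<^esub>}"
    proof (intro equalityI subsetI)
      fix y assume "y \<in> h ` ?K"
      then show "y \<in> {x \<in> carrier M'. f (k x) = \<zero>\<^bsub>N\<^esub>}" using h(2) kh by (auto simp: bij_betw_def)
    next
      fix y assume "y \<in> {x \<in> carrier M'. f (k x) = \<zero>\<^bsub>N\<^esub>}"
      then show "y \<in> h ` ?K" using kM hk by (intro image_eqI[of _ _ "k y"]) auto
    qed
    also have "\<dots> = {x \<in> carrier M'. (n \<circ> (f \<circ> k)) x = \<zero>\<^bsub>N'\<^esub>}" using nz fk kM by auto
    finally show "(h \<circ> i) ` carrier L' = {x \<in> carrier M'. (n \<circ> (f \<circ> k)) x = \<zero>\<^bsub>N'\<^esub>}" .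
    show "(n \<circ> (f \<circ> k)) ` carrier M' = carrier N'"
      unfolding image_comp[symmetric] using k(2) assms(5) N'(3) by (simp add: bij_betw_def)
  qed
  then have "M' \<in> X" using ext L'(1) N'(1) M'(1) unfolding closed_extensions_def by blast
  then show ?thesis using M'(3) by (auto simp: memb_def)
qed

lemma memb_sum:
  assumes "closed_extensions R X" "module R M" "module R N" "memb R X M" "memb R X N"
  shows "memb R X (mod_sum M N)"
proof (rule memb_extension[OF assms(1) module_sum[OF assms(2,3)] assms(3) mod_hom_snd])
  interpret M: module R M by fact
  interpret N: module R N by fact
  show "snd ` carrier (mod_sum M N) = carrier N"
    using M.M.zero_closed by (auto intro: rev_image_eqI)
  have "mod_iso R M (mod_sum M N\<lparr>carrier := {x \<in> carrier (mod_sum M N). snd x = \<zero>\<^bsub>N\<^esub>}\<rparr>)"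
    by (rule mod_iso_image[OF assms(2) module_sum[OF assms(2,3)], of "\<lambda>x. (x, \<zero>\<^bsub>N\<^esub>)"])
      (auto intro!: mod_homI inj_onI)
  then show "memb R X (mod_sum M N\<lparr>carrier := {x \<in> carrier (mod_sum M N). snd x = \<zero>\<^bsub>N\<^esub>}\<rparr>)"
    by (rule memb_cong[OF assms(2)]) fact
  show "memb R X N" by fact
qed

text \<open>Replacing \<open>f\<close> by its conjugate \<open>n \<circ> (f \<circ> a)\<close>
  between objects of \<open>X\<close> changes image and kernel only up to isomorphism.\<close>

lemma IKE_transport:
  assumes IKE: "IKE_closed R X"
    and M: "module R M" "memb R X M" and N: "module R N" "memb R X N" and f: "f \<in> mod_hom R M N"
  shows memb_image: "memb R X (N\<lparr>carrier := f ` carrier M\<rparr>)"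
    and memb_kernel: "memb R X (M\<lparr>carrier := {x \<in> carrier M. f x = \<zero>\<^bsub>N\<^esub>}\<rparr>)"
proof -
  interpret M: module R M by fact
  interpret N: module R N by fact
  obtain M' where M': "M' \<in> X" "mod_iso R M M'" using M by (auto simp: memb_def)
  obtain a where a: "a \<in> mod_hom R M' M" "bij_betw a (carrier M') (carrier M)"
    using mod_iso_sym[OF M(1) M'(2)] by (auto simp: mod_iso_def)
  obtain N' n where N': "N' \<in> X" "n \<in> mod_hom R N N'" "bij_betw n (carrier N) (carrier N')"
    using N by (auto simp: memb_def mod_iso_def)
  note mods = X_fg(2)[OF M'(1)] X_fg(2)[OF N'(1)]
  interpret M': module R M' by fact
  let ?g = "n \<circ> (f \<circ> a)"
  have g: "?g \<in> mod_hom R M' N'" using a f N' by (intro mod_hom_comp)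
  have im: "mod_image N' ?g M' \<in> X" and ker: "mod_kernel N' ?g M' \<in> X"
    using IKE M'(1) N'(1) g by (auto simp: IKE_closed_def)
  have fN: "f ` carrier M \<subseteq> carrier N" using mod_hom_closed[OF f] by auto
  have subf: "submodule (f ` carrier M) R N"
    by (rule submodule_image[OF M(1) N(1) f M.carrier_is_submodule])
  have "mod_iso R (N\<lparr>carrier := f ` carrier M\<rparr>) (N'\<lparr>carrier := ?g ` carrier M'\<rparr>)"
  proof (rule mod_iso_image[OF N.module_restrict[OF subf] mods(2)])
    show "n \<in> mod_hom R (N\<lparr>carrier := f ` carrier M\<rparr>) N'" using N'(2) fN by (rule mod_hom_restrict)
    show "inj_on n (carrier (N\<lparr>carrier := f ` carrier M\<rparr>))"
      using N'(3) fN by (auto simp: bij_betw_def intro: inj_on_subset)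
    show "n ` carrier (N\<lparr>carrier := f ` carrier M\<rparr>) = ?g ` carrier M'"
      unfolding image_comp[symmetric] using a(2) by (simp add: bij_betw_def)
  qed
  then show "memb R X (N\<lparr>carrier := f ` carrier M\<rparr>)"
    using im by (auto simp: memb_def mod_image_def)
  have nz: "n y = \<zero>\<^bsub>N'\<^esub> \<longleftrightarrow> y = \<zero>\<^bsub>N\<^esub>" if "y \<in> carrier N" for y
    using N'(3) that mod_hom_inj_on_iff[OF N(1) mods(2) N'(2)]
      mod_hom_zero[OF N(1) mods(2) N'(2)] by (auto simp: bij_betw_def)
  let ?K = "{x \<in> carrier M'. ?g x = \<zero>\<^bsub>N'\<^esub>}"
  have subK: "submodule ?K R M'" by (rule submodule_kernel[OF mods g])
  have K: "module R (M'\<lparr>carrier := ?K\<rparr>)" by (rule M'.module_restrict[OF subK])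
  have "a x \<in> carrier M" if "x \<in> carrier M'" for x using that a(1) mod_hom_closed by fast
  then have aK: "a ` ?K = {x \<in> carrier M. f x = \<zero>\<^bsub>N\<^esub>}"
  proof (intro equalityI subsetI)
    fix y assume "y \<in> {x \<in> carrier M. f x = \<zero>\<^bsub>N\<^esub>}"
    moreover from this obtain x where "x \<in> carrier M'" "y = a x" using a(2) by (auto simp: bij_betw_def)
    ultimately show "y \<in> a ` ?K" using nz fN by auto
  qed (use nz fN \<open>\<And>x. x \<in> carrier M' \<Longrightarrow> a x \<in> carrier M\<close> in auto)
  have "mod_iso R (M'\<lparr>carrier := ?K\<rparr>) (M\<lparr>carrier := {x \<in> carrier M. f x = \<zero>\<^bsub>N\<^esub>}\<rparr>)"
    using aK a(2)
    by (intro mod_iso_image[OF K M(1) mod_hom_restrict[OF a(1)]])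
      (auto simp: bij_betw_def intro: inj_on_subset)
  moreover have "memb R X (M'\<lparr>carrier := ?K\<rparr>)"
    using ker by (intro memb_self) (simp add: mod_kernel_def)
  ultimately show "memb R X (M\<lparr>carrier := {x \<in> carrier M. f x = \<zero>\<^bsub>N\<^esub>}\<rparr>)"
    using memb_cong K by blast
qed

text \<open>A summand is the image of the idempotent endomorphism projecting onto it, so closure
  under images yields closure under summands.\<close>

lemma memb_summand_IKE:
  assumes "IKE_closed R X" "module R A" "module R B" "memb R X (mod_sum A B)"
  shows "memb R X A"
proof -
  interpret A: module R A by fact
  interpret B: module R B by fact
  let ?S = "mod_sum A B" and ?f = "\<lambda>(x, y). (x, \<zero>\<^bsub>B\<^esub>)"
  have S: "module R ?S" by (rule module_sum[OF assms(2,3)])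
  interpret S: module R ?S by fact
  have f: "?f \<in> mod_hom R ?S ?S" by (rule mod_homI) auto
  have im: "?f ` carrier ?S = carrier A \<times> {\<zero>\<^bsub>B\<^esub>}"
    using B.M.zero_closed by (auto simp: image_iff)
  have sub: "submodule (carrier A \<times> {\<zero>\<^bsub>B\<^esub>}) R ?S"
    using submodule_image[OF S S f S.carrier_is_submodule] unfolding im .
  have "memb R X (?S\<lparr>carrier := carrier A \<times> {\<zero>\<^bsub>B\<^esub>}\<rparr>)"
    using memb_image[OF assms(1) S assms(4) S assms(4) f] unfolding im .
  moreover have "mod_iso R (?S\<lparr>carrier := carrier A \<times> {\<zero>\<^bsub>B\<^esub>}\<rparr>) A"
    unfolding mod_iso_def
    by (rule bexI[of _ fst]) (auto simp: bij_betw_def image_iff intro!: mod_homI inj_onI)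
  ultimately show ?thesis using memb_cong S.module_restrict[OF sub] by blast
qed

lemma IKE_closed_summands:
  assumes "IKE_closed R X" shows "closed_summands R X"
  unfolding closed_summands_def
proof (intro ballI impI)
  fix M A B :: "('r, 'v) module"
  assume *: "M \<in> X" "A \<in> fg_mod R" "B \<in> fg_mod R" "mod_iso R M (mod_sum A B)"
  have "memb R X (mod_sum A B)" by (rule memb_cong[OF X_fg(2)[OF *(1)] *(4) memb_self[OF *(1)]])
  moreover have "module R A" "module R B" using *(2,3) by (auto simp: fg_mod_def)
  ultimately have "memb R X A" using memb_summand_IKE[OF assms] by blast
  then show "A \<in> X" using memb_iff *(2) by simp
qed

end

lemma mod_iso_sum:
  assumes "mod_iso R A A'" "mod_iso R B B'"
  shows "mod_iso R (mod_sum A B) (mod_sum A' B')"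
proof -
  obtain f g where f: "f \<in> mod_hom R A A'" "bij_betw f (carrier A) (carrier A')"
    and g: "g \<in> mod_hom R B B'" "bij_betw g (carrier B) (carrier B')"
    using assms by (auto simp: mod_iso_def)
  have "map_prod f g \<in> mod_hom R (mod_sum A B) (mod_sum A' B')"
    using f(1) g(1) by (intro mod_homI) (auto simp: mod_hom_closed mod_hom_add mod_hom_smult)
  moreover have "bij_betw (map_prod f g) (carrier A \<times> carrier B) (carrier A' \<times> carrier B')"
    using f(2) g(2) by (rule bij_betw_map_prod)
  ultimately show ?thesis by (auto simp: mod_iso_def)
qed

lemma internal_sum_iso:
  assumes "module R M" "submodule A R M" "submodule B R M" "A \<inter> B = {\<zero>\<^bsub>M\<^esub>}"
    and "\<And>x. x \<in> carrier M \<Longrightarrow> \<exists>a\<in>A. \<exists>b\<in>B. x = a \<oplus>\<^bsub>M\<^esub> b"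
  shows "mod_iso R (mod_sum (M\<lparr>carrier := A\<rparr>) (M\<lparr>carrier := B\<rparr>)) M"
proof -
  interpret M: module R M by fact
  have A: "A \<subseteq> carrier M" and B: "B \<subseteq> carrier M" using assms(2,3) by (auto simp: M.submodule_iff)
  let ?S = "mod_sum (M\<lparr>carrier := A\<rparr>) (M\<lparr>carrier := B\<rparr>)" and ?f = "\<lambda>(x, y). x \<oplus>\<^bsub>M\<^esub> y"
  have S: "module R ?S" using assms(2,3) by (intro module_sum M.module_restrict)
  have f: "?f \<in> mod_hom R ?S M"
    using A B by (intro mod_hom_sum[OF assms(1)] mod_hom_inclusion)
  have "inj_on ?f (carrier ?S)"
    unfolding mod_hom_inj_on_iff[OF S assms(1) f]
  proof (clarsimp)
    fix x y assume xy: "x \<in> A" "y \<in> B" "x \<oplus>\<^bsub>M\<^esub> y = \<zero>\<^bsub>M\<^esub>"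
    then have "\<ominus>\<^bsub>M\<^esub> y = x" using A B by (intro M.M.minus_equality) auto
    then have "x \<in> B" using xy M.submoduleE(3)[OF assms(3)] by auto
    then have "x = \<zero>\<^bsub>M\<^esub>" using xy assms(4) by auto
    then show "x = \<zero>\<^bsub>M\<^esub> \<and> y = \<zero>\<^bsub>M\<^esub>" using xy B by auto
  qed
  moreover have "?f ` carrier ?S = carrier M"
    using assms(5) A B by (force simp: image_iff)
  ultimately show ?thesis using f by (auto simp: mod_iso_def bij_betw_def)
qed

section \<open>Subcategories closed under extensions and direct summands\<close>

locale ext_subcat = subcat R \<iota> X
  for R :: "('r, 'p) ring_scheme" and \<iota> :: "'r \<Rightarrow> 'v" and X +
  assumes ext: "closed_extensions R X" and summands: "closed_summands R X"
begin

lemma memb_summand: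
  assumes "module R A" "module R B" "memb R X (mod_sum A B)"
  shows "memb R X A" "memb R X B"
proof -
  \<comment> \<open>Both factors are images of the sum under the projections, hence finitely
    generated, and so have copies to which \<open>closed_summands\<close> applies.\<close>
  have summand: "memb R X C"
    if CD: "module R C" "module R D" "memb R X (mod_sum C D)" for C :: "('r, 'c) module" and D :: "('r, 'd) module"
  proof -
    interpret C: module R C by fact
    interpret D: module R D by fact
    have S: "module R (mod_sum C D)" by (rule module_sum[OF CD(1,2)])
    have fS: "fin_gen R (mod_sum C D)" by (rule memb_fin_gen[OF S CD(3)])
    have fst: "fst ` carrier (mod_sum C D) = carrier C" and snd: "snd ` carrier (mod_sum C D) = carrier D"
      using C.M.zero_closed D.M.zero_closed by (auto simp: image_iff)
    obtain C' :: "('r, 'v) module" where C': "C' \<in> fg_mod R" "mod_iso R C C'"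
      using ex_copy[OF CD(1) fin_gen_image[OF S CD(1) mod_hom_fst fst fS]] by blast
    obtain D' :: "('r, 'v) module" where D': "D' \<in> fg_mod R" "mod_iso R D D'"
      using ex_copy[OF CD(2) fin_gen_image[OF S CD(2) mod_hom_snd snd fS]] by blast
    obtain P where P: "P \<in> X" "mod_iso R (mod_sum C D) P" using CD(3) by (auto simp: memb_def)
    have "mod_iso R P (mod_sum C' D')"
      using mod_iso_trans[OF mod_iso_sym[OF S P(2)] mod_iso_sum[OF C'(2) D'(2)]] .
    then have "C' \<in> X" using summands P(1) C'(1) D'(1) unfolding closed_summands_def by blast
    then show ?thesis using C'(2) by (auto simp: memb_def)
  qed
  show "memb R X A" using summand[OF assms] .
  \<comment> \<open>Closure under summands releases the left factor; the right one is reached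
    through the swapped sum.\<close>
  have "prod.swap \<in> mod_hom R (mod_sum A B) (mod_sum B A)" by (rule mod_homI) auto
  moreover have "bij_betw prod.swap (carrier A \<times> carrier B) (carrier B \<times> carrier A)"
    by (simp add: bij_betw_def product_swap)
  ultimately have "mod_iso R (mod_sum A B) (mod_sum B A)" by (auto simp: mod_iso_def)
  then have "memb R X (mod_sum B A)" using memb_cong[OF module_sum[OF assms(1,2)]] assms(3) by blast
  then show "memb R X B" by (rule summand[OF assms(2,1)])
qed

text \<open>A zero module is a summand of every object: adding it to \<open>M\<close> does not
  change \<open>M\<close> up to isomorphism.\<close>

lemma memb_zero:
  assumes "module R Z" "carrier Z = {\<zero>\<^bsub>Z\<^esub>}"
  shows "memb R X Z"
proof -
  obtain M where M: "M \<in> X" using X by (auto simp: strict_full_subcat_def)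
  note mM = X_fg(2)[OF M]
  interpret Z: module R Z by fact
  interpret M: module R M by fact
  have "(\<lambda>x. (\<zero>\<^bsub>Z\<^esub>, x)) \<in> mod_hom R M (mod_sum Z M)" by (rule mod_homI) auto
  moreover have "bij_betw (\<lambda>x. (\<zero>\<^bsub>Z\<^esub>, x)) (carrier M) (carrier (mod_sum Z M))"
    using assms(2) by (auto simp: bij_betw_def inj_on_def)
  ultimately have "mod_iso R M (mod_sum Z M)" by (auto simp: mod_iso_def)
  then have "memb R X (mod_sum Z M)" using memb_cong[OF mM] memb_self[OF M] by blast
  then show ?thesis by (rule memb_summand(1)[OF assms(1) mM])
qed

end

unbundle fps_syntax

section \<open>Laurent series with prescribed support\<close>

text \<open>The semigroup ring, its shifts, the shifts of k[[t]] and the conductor all have this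
  form, so that intersections, sums and multiplication by powers of t become operations on sets of
  exponents.\<close>

definition fls_supp :: "int set \<Rightarrow> 'a::zero fls set" where
  "fls_supp E = {f. \<forall>n. f $$ n \<noteq> 0 \<longrightarrow> n \<in> E}"

text \<open>The monomial t^n as a Laurent series, with an exponent of either sign.\<close>

definition tpow :: "int \<Rightarrow> 'a::field fls" where
  "tpow n = fls_shift (- n) 1"

lemma tpow_nth [simp]: "tpow n $$ m = (if m = n then 1 else 0)"
  by (auto simp: tpow_def)

lemma tpow_mult_nth [simp]: "(tpow n * f) $$ m = f $$ (m - n)"
  by (simp add: tpow_def fls_X_intpow_times_conv_shift)

lemma tpow_mult_tpow: "tpow m * tpow n = tpow (m + n)"
  by (rule fls_eqI) auto

lemma tpow_0 [simp]: "tpow 0 = 1"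
  by (rule fls_eqI) auto

lemma tpow_nonzero [simp]: "tpow n \<noteq> 0"
  using tpow_nth[of n n] by (metis fls_zero_nth zero_neq_one)

lemma tpow_power: "tpow n ^ m = tpow (int m * n)"
  by (induction m) (simp_all add: tpow_mult_tpow algebra_simps)

lemma fls_suppI: "(\<And>n. f $$ n \<noteq> 0 \<Longrightarrow> n \<in> E) \<Longrightarrow> f \<in> fls_supp E"
  by (simp add: fls_supp_def)

lemma fls_suppD: "f \<in> fls_supp E \<Longrightarrow> n \<notin> E \<Longrightarrow> f $$ n = 0"
  by (auto simp: fls_supp_def)

lemma tpow_mem_fls_supp [simp]: "(tpow n :: 'a::field fls) \<in> fls_supp E \<longleftrightarrow> n \<in> E"
  by (auto simp: fls_supp_def)

lemma zero_mem_fls_supp [simp]: "0 \<in> fls_supp E"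
  by (simp add: fls_supp_def)

lemma fls_supp_mono: "E \<subseteq> F \<Longrightarrow> fls_supp E \<subseteq> fls_supp F"
  by (auto simp: fls_supp_def)

lemma fls_supp_Int: "fls_supp E \<inter> fls_supp F = fls_supp (E \<inter> F)"
  by (auto simp: fls_supp_def)

lemma add_mem_fls_supp: "f \<in> fls_supp E \<Longrightarrow> g \<in> fls_supp E \<Longrightarrow> f + g \<in> fls_supp E"
  for f :: "'a::group_add fls"
  by (auto simp: fls_supp_def) (metis add_0)

lemma uminus_mem_fls_supp: "f \<in> fls_supp E \<Longrightarrow> - f \<in> fls_supp E"
  for f :: "'a::group_add fls"
  by (simp add: fls_supp_def)

lemma mult_mem_fls_supp:
  fixes f g :: "'a::field fls"
  assumes "f \<in> fls_supp E" "g \<in> fls_supp F" "\<And>m n. m \<in> E \<Longrightarrow> n \<in> F \<Longrightarrow> m + n \<in> G"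
  shows "f * g \<in> fls_supp G"
proof (rule fls_suppI)
  fix n assume "(f * g) $$ n \<noteq> 0"
  then obtain i where "f $$ i * g $$ (n - i) \<noteq> 0"
    unfolding fls_times_nth(2) by (rule sum.not_neutral_contains_not_neutral)
  then have "i \<in> E" "n - i \<in> F" using assms(1,2) by (auto simp: fls_supp_def)
  then show "n \<in> G" using assms(3) by fastforce
qed

definition fls_restrict :: "int set \<Rightarrow> 'a::zero fls \<Rightarrow> 'a fls" where
  "fls_restrict E f = Abs_fls (\<lambda>n. if n \<in> E then f $$ n else 0)"

text \<open>Discarding coefficients keeps the support bounded below by the subdegree of
  \<open>f\<close>, so the truncated coefficient function still belongs to a Laurent series.\<close>

lemma fls_restrict_nth [simp]: "fls_restrict E f $$ n = (if n \<in> E then f $$ n else 0)"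
  unfolding fls_restrict_def
  by (subst nth_Abs_fls_lower_bound[of "fls_subdegree f"]) auto

lemma fls_supp_Un:
  fixes f :: "'a::group_add fls"
  assumes "f \<in> fls_supp (E \<union> F)"
  obtains g h where "g \<in> fls_supp E" "h \<in> fls_supp F" "f = g + h"
proof
  show "fls_restrict E f \<in> fls_supp E" "fls_restrict (- E) f \<in> fls_supp F"
    using assms by (auto simp: fls_supp_def split: if_splits)
  show "f = fls_restrict E f + fls_restrict (- E) f"
    by (rule fls_eqI) auto
qed

lemma mem_fls_supp_atLeast_iff: "f \<in> fls_supp {m..} \<longleftrightarrow> f = 0 \<or> m \<le> fls_subdegree f"
proof (cases "f = 0")
  case False
  show ?thesis
  proof
    assume "f \<in> fls_supp {m..}"
    then show "f = 0 \<or> m \<le> fls_subdegree f"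
      using False nth_fls_subdegree_nonzero[of f] by (auto simp: fls_supp_def)
  next
    assume *: "f = 0 \<or> m \<le> fls_subdegree f"
    show "f \<in> fls_supp {m..}"
    proof (rule fls_suppI)
      fix n assume "f $$ n \<noteq> 0"
      then have "fls_subdegree f \<le> n" by (rule fls_subdegree_leI)
      then show "n \<in> {m..}" using * False by auto
    qed
  qed
qed simp

section \<open>The numerical semigroup ring and its fractional ideals\<close>

text \<open>The semigroup is kept abstract here; its presentation by two generators enters with
  \<open>quo_step\<close>.\<close>

locale numerical_semigroup_ring =
  fixes H :: "nat set" and R :: "'k::field fls ring" and \<iota> :: "'k fls \<Rightarrow> 'v"
  assumes R_eq: "R = semigroup_ring H"
    and H_zero: "0 \<in> H"
    and H_add: "m \<in> H \<Longrightarrow> n \<in> H \<Longrightarrow> m + n \<in> H"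
    and H_cofinite: "\<exists>c. \<forall>n\<ge>c. n \<in> H"
    and inj_iota: "inj \<iota>"
begin

lemma carrier_R: "carrier R = fls_supp (int ` H)"
proof (intro equalityI subsetI)
  fix f assume "f \<in> carrier R"
  then show "f \<in> fls_supp (int ` H)"
    by (auto simp: R_eq semigroup_ring_def fls_supp_def split: if_splits intro!: rev_image_eqI[of "nat _"])
next
  fix f :: "'k fls" assume f: "f \<in> fls_supp (int ` H)"
  have "f = fps_to_fls (fls_regpart f)"
  proof (rule fls_eqI)
    show "f $$ n = fps_to_fls (fls_regpart f) $$ n" for n
      using fls_suppD[OF f, of n] by (cases "n \<in> int ` H") auto
  qed
  moreover have "\<forall>n. fls_regpart f $ n \<noteq> 0 \<longrightarrow> n \<in> H"
    using f by (auto simp: fls_supp_def)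
  ultimately show "f \<in> carrier R" unfolding R_eq semigroup_ring_def by auto
qed

lemma R_simps [simp]:
  "mult R = (*)" "one R = 1" "zero R = 0" "add R = (+)"
  by (simp_all add: R_eq semigroup_ring_def)

lemma one_mem_R: "1 \<in> carrier R"
  using tpow_mem_fls_supp[of 0 "int ` H"] H_zero by (auto simp: carrier_R)

lemma mult_mem_R: "r \<in> carrier R \<Longrightarrow> s \<in> carrier R \<Longrightarrow> r * s \<in> carrier R"
  unfolding carrier_R by (rule mult_mem_fls_supp) (auto simp: H_add simp flip: of_nat_add)

lemma cring_R: "cring R"
proof (intro cringI abelian_groupI comm_monoidI)
  fix x assume "x \<in> carrier R"
  then show "\<exists>y\<in>carrier R. y \<oplus>\<^bsub>R\<^esub> x = \<zero>\<^bsub>R\<^esub>"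
    by (intro bexI[of _ "- x"]) (auto simp: carrier_R uminus_mem_fls_supp)
qed (use one_mem_R mult_mem_R in \<open>auto simp: algebra_simps carrier_R add_mem_fls_supp\<close>)

text \<open>Some shift of k[[t]] inside the ring is what the arguments on finite generation and
  torsion work with; the least one is determined in \<open>conductor_eq\<close>.\<close>

lemma conductor_bound:
  obtains c :: int where "0 \<le> c" "fls_supp {c..} \<subseteq> carrier R"
proof -
  obtain c where c: "\<And>n. n \<ge> c \<Longrightarrow> n \<in> H" using H_cofinite by auto
  have "fls_supp {int c..} \<subseteq> carrier R"
    unfolding carrier_R using c by (intro fls_supp_mono) (auto intro!: rev_image_eqI[of "nat _"])
  then show ?thesis using that[of "int c"] by simp
qed

lemma carrier_R_bound: "carrier R \<subseteq> fls_supp {0..}"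
  unfolding carrier_R by (intro fls_supp_mono) auto

text \<open>The powers of t beyond the bound are pairwise distinct, which covers finite fields of
  coefficients as well.\<close>

lemma infinite_R: "infinite (carrier R)"
proof -
  obtain c where c: "0 \<le> c" "fls_supp {c..} \<subseteq> carrier R" by (rule conductor_bound)
  have "range (\<lambda>n::nat. tpow (c + int n)) \<subseteq> carrier R" using c(2) by (auto simp: subset_iff)
  moreover have "inj (\<lambda>n::nat. tpow (c + int n) :: 'k fls)"
    by (rule injI) (metis add_left_cancel of_nat_eq_iff tpow_nth zero_neq_one)
  ultimately show ?thesis using infinite_super range_inj_infinite by blast
qed

abbreviation fls_module :: "'k fls set \<Rightarrow> ('k fls, 'k fls) module" where
  "fls_module A \<equiv> ideal_module R A"

lemma fls_module_simps [simp]: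
  "carrier (fls_module A) = A" "add (fls_module A) = (+)" "zero (fls_module A) = 0" "smult (fls_module A) = (*)"
  by (simp_all add: ideal_module_def)

lemma fls_module_restrict [simp]: "(fls_module A)\<lparr>carrier := B\<rparr> = fls_module B"
  by (simp add: ideal_module_def)

lemma module_fls: "module R (fls_module UNIV)"
proof (intro moduleI cring_R abelian_groupI)
  fix x assume "x \<in> carrier (fls_module UNIV)"
  then show "\<exists>y\<in>carrier (fls_module UNIV). y \<oplus>\<^bsub>fls_module UNIV\<^esub> x = \<zero>\<^bsub>fls_module UNIV\<^esub>"
    by (intro bexI[of _ "- x"]) auto
qed (auto simp: algebra_simps)

text \<open>All fractional ideals, and more generally all R-submodules of k((t)), are handled as
  subsets of this single module; finite generation is a separate condition.\<close>

abbreviation fsub :: "'k fls set \<Rightarrow> bool" where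
  "fsub A \<equiv> submodule A R (fls_module UNIV)"

lemma fsub_iff:
  "fsub A \<longleftrightarrow> 0 \<in> A \<and> (\<forall>f\<in>A. \<forall>g\<in>A. f + g \<in> A) \<and> (\<forall>r\<in>carrier R. \<forall>f\<in>A. r * f \<in> A)"
  using module.submodule_iff[OF module_fls, of A] by simp

lemma fsub_zero: "fsub A \<Longrightarrow> 0 \<in> A"
  and fsub_add: "fsub A \<Longrightarrow> f \<in> A \<Longrightarrow> g \<in> A \<Longrightarrow> f + g \<in> A"
  and fsub_mult: "fsub A \<Longrightarrow> r \<in> carrier R \<Longrightarrow> f \<in> A \<Longrightarrow> r * f \<in> A"
  by (simp_all add: fsub_iff)

lemma const_mem_R: "fls_const k \<in> carrier R"
  using H_zero by (auto simp: carrier_R fls_supp_def)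

lemma fsub_const: "fsub A \<Longrightarrow> f \<in> A \<Longrightarrow> fls_const k * f \<in> A"
  by (rule fsub_mult[OF _ const_mem_R])

lemma fsub_uminus: "fsub A \<Longrightarrow> f \<in> A \<Longrightarrow> - f \<in> A"
  using fsub_const[of A f "-1"] by (simp add: fls_const_uminus[of "1::'k"] del: fls_const_uminus)

lemma fsub_diff: "fsub A \<Longrightarrow> f \<in> A \<Longrightarrow> g \<in> A \<Longrightarrow> f - g \<in> A"
  using fsub_add[OF _ _ fsub_uminus] by fastforce

lemma fsub_sum: "fsub A \<Longrightarrow> (\<And>i. i \<in> I \<Longrightarrow> f i \<in> A) \<Longrightarrow> sum f I \<in> A"
  by (induction I rule: infinite_finite_induct) (auto simp: fsub_zero fsub_add)

lemma module_fls_module: "fsub A \<Longrightarrow> module R (fls_module A)"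
  using module.module_restrict[OF module_fls, of A] by simp

lemma minus_fls_module: "fsub A \<Longrightarrow> f \<in> A \<Longrightarrow> g \<in> A \<Longrightarrow> f \<ominus>\<^bsub>fls_module A\<^esub> g = f - g"
proof -
  have "\<ominus>\<^bsub>fls_module UNIV\<^esub> g = - g"
    using abelian_group.minus_equality[OF module.axioms(2)[OF module_fls], of "- g" g] by simp
  moreover assume "fsub A" "f \<in> A" "g \<in> A"
  ultimately show ?thesis
    using module.a_minus_restrict[OF module_fls, of A f g] by (simp add: a_minus_def)
qed

lemma submodule_fls_module_iff: "fsub A \<Longrightarrow> submodule B R (fls_module A) \<longleftrightarrow> fsub B \<and> B \<subseteq> A"
  using module.submodule_restrict_iff[OF module_fls, of A B] by simp

lemma fsub_supp:
  assumes "\<And>h n. h \<in> H \<Longrightarrow> n \<in> E \<Longrightarrow> int h + n \<in> E"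
  shows "fsub (fls_supp E)"
  unfolding fsub_iff
proof (intro conjI ballI)
  fix r f :: "'k fls" assume "r \<in> carrier R" "f \<in> fls_supp E"
  then show "r * f \<in> fls_supp E"
    unfolding carrier_R by (rule mult_mem_fls_supp) (use assms in auto)
qed (auto intro: add_mem_fls_supp)

lemma fsub_atLeast [simp]: "fsub (fls_supp {m..})"
  by (rule fsub_supp) auto

lemma fsub_R: "fsub (carrier R)"
  unfolding carrier_R by (rule fsub_supp) (auto simp: H_add simp flip: of_nat_add)

lemma fsub_Int: "fsub A \<Longrightarrow> fsub B \<Longrightarrow> fsub (A \<inter> B)"
  by (simp add: fsub_iff)

section \<open>Sums and shifts of submodules of k((t))\<close>

definition fplus :: "'k fls set \<Rightarrow> 'k fls set \<Rightarrow> 'k fls set" where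
  "fplus A B = {f + g | f g. f \<in> A \<and> g \<in> B}"

lemma fsub_fplus:
  assumes "fsub A" "fsub B" shows "fsub (fplus A B)"
  unfolding fsub_iff
proof (intro conjI ballI)
  show "0 \<in> fplus A B" unfolding fplus_def using fsub_zero assms by force
  show "f + g \<in> fplus A B" if fg: "f \<in> fplus A B" "g \<in> fplus A B" for f g
  proof -
    obtain f1 f2 g1 g2 where "f1 \<in> A" "g1 \<in> A" "f2 \<in> B" "g2 \<in> B" "f = f1 + f2" "g = g1 + g2"
      using fg unfolding fplus_def by blast
    moreover from this have "f + g = (f1 + g1) + (f2 + g2)" by simp
    ultimately show ?thesis unfolding fplus_def using fsub_add assms by blast
  qed
  show "r * f \<in> fplus A B" if rf: "r \<in> carrier R" "f \<in> fplus A B" for r f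
  proof -
    obtain f1 f2 where "f1 \<in> A" "f2 \<in> B" "f = f1 + f2" using rf unfolding fplus_def by blast
    moreover from this have "r * f = r * f1 + r * f2" by (simp add: algebra_simps)
    ultimately show ?thesis unfolding fplus_def using fsub_mult assms rf(1) by blast
  qed
qed

lemma fplus_superset: "fsub A \<Longrightarrow> fsub B \<Longrightarrow> A \<subseteq> fplus A B" "fsub A \<Longrightarrow> fsub B \<Longrightarrow> B \<subseteq> fplus A B"
  unfolding fplus_def using fsub_zero by force+

lemma fplus_subset: "fsub C \<Longrightarrow> A \<subseteq> C \<Longrightarrow> B \<subseteq> C \<Longrightarrow> fplus A B \<subseteq> C"
  unfolding fplus_def using fsub_add by blast

lemma fsub_scale:
  assumes "fsub A" shows "fsub ((*) q ` A)"
  unfolding fsub_iff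
proof (intro conjI ballI)
  show "0 \<in> (*) q ` A" using fsub_zero[OF assms] by (auto intro: rev_image_eqI)
  show "f + g \<in> (*) q ` A" if "f \<in> (*) q ` A" "g \<in> (*) q ` A" for f g
    using that fsub_add[OF assms] by (auto simp: distrib_left[symmetric])
  show "r * f \<in> (*) q ` A" if "r \<in> carrier R" "f \<in> (*) q ` A" for r f
    using that fsub_mult[OF assms] by (auto simp: mult.left_commute)
qed

lemma scale_iso:
  assumes "fsub A" "q \<noteq> 0" shows "mod_iso R (fls_module A) (fls_module ((*) q ` A))"
  unfolding mod_iso_def
  by (rule bexI[of _ "(*) q"]) (use assms(2) in \<open>auto simp: bij_betw_def inj_on_def algebra_simps intro!: mod_homI\<close>)

lemma scale_atLeast: "(*) (tpow m) ` fls_supp {n..} = (fls_supp {m + n..} :: 'k fls set)"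
proof (intro equalityI subsetI)
  fix f :: "'k fls" assume f: "f \<in> fls_supp {m + n..}"
  have "f = tpow m * (tpow (- m) * f)" by (rule fls_eqI) auto
  moreover have "tpow (- m) * f \<in> fls_supp {n..}" using f by (force simp: fls_supp_def)
  ultimately show "f \<in> (*) (tpow m) ` fls_supp {n..}" by blast
qed (force simp: fls_supp_def)

text \<open>A series \<open>f\<close> of order at least c + ord q equals (f/q) q, and f/q has order
  at least c, hence lies in the ring. So every nonzero submodule of k((t)) contains a shift of
  k[[t]].\<close>

lemma contains_atLeast:
  assumes "fsub A" "q \<in> A" "q \<noteq> 0" "fls_supp {c..} \<subseteq> carrier R"
  shows "fls_supp {c + fls_subdegree q..} \<subseteq> A"
proof
  fix f :: "'k fls" assume f: "f \<in> fls_supp {c + fls_subdegree q..}"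
  have "f * inverse q \<in> fls_supp {c..}"
    using f assms(3) by (cases "f = 0") (auto simp: mem_fls_supp_atLeast_iff fls_inverse_subdegree)
  then have "f * inverse q * q \<in> A" using assms fsub_mult by blast
  then show "f \<in> A" using assms(3) by (simp add: mult.assoc)
qed

text \<open>Subtracting a scalar multiple of \<open>g\<close> removes the coefficient at t^s and
  leaves an element of t^(s+1) k[[t]]. One element of exact order \<open>s\<close> therefore
  enlarges the contained shift by one.\<close>

lemma atLeast_fill:
  assumes "fsub A" "fls_supp {s + 1..} \<subseteq> A" "g \<in> A" "g \<in> fls_supp {s..}" "g $$ s \<noteq> 0"
  shows "fls_supp {s..} \<subseteq> A"
proof
  fix f :: "'k fls" assume f: "f \<in> fls_supp {s..}"
  let ?k = "fls_const (f $$ s / g $$ s)"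
  have "f - ?k * g \<in> fls_supp {s + 1..}"
  proof (rule fls_suppI, rule ccontr)
    fix n assume n: "(f - ?k * g) $$ n \<noteq> 0" "n \<notin> {s + 1..}"
    then have "n = s \<or> n \<notin> {s..}" by auto
    then show False using n(1) assms(5) fls_suppD[OF assms(4), of n] fls_suppD[OF f, of n] by auto
  qed
  then have "f - ?k * g \<in> A" using assms(2) by blast
  then have "f - ?k * g + ?k * g \<in> A" using assms fsub_add fsub_const by blast
  then show "f \<in> A" by simp
qed

lemma fin_gen_atLeast: "fin_gen R (fls_module (fls_supp {s..}))"
proof -
  obtain c where c: "0 \<le> c" "fls_supp {c..} \<subseteq> carrier R" by (rule conductor_bound)
  \<comment> \<open>One more than the bound \<open>c\<close>, so that the generator t^s is present
    even for \<open>c = 0\<close>; the tail is then t^s times a ring element.\<close>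
  define b where "b = c + 1"
  have b: "b > 0" using c(1) by (simp add: b_def)
  let ?V = "fls_supp {s..} :: 'k fls set"
  let ?B = "(\<lambda>i. tpow (s + i)) ` {0..<b} :: 'k fls set"
  interpret V: module R "fls_module ?V" by (rule module_fls_module) simp
  have B: "?B \<subseteq> carrier (fls_module ?V)" by auto
  let ?L = "lspan R (fls_module ?V) ?B"
  have L: "fsub ?L" using V.lspan_submodule[OF B] by (simp add: submodule_fls_module_iff)
  have "f \<in> ?L" if f: "f \<in> ?V" for f
  proof -
    \<comment> \<open>Coefficients below \<open>s + b\<close> are handled by constants; for the rest, \<open>R\<close> contains all
        series of order at least \<open>c\<close>, so a single generator suffices.\<close>
    let ?g = "fls_restrict {s..<s + b} f" and ?h = "fls_restrict {s + b..} f"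
    have "?g = (\<Sum>i\<in>{0..<b}. fls_const (f $$ (s + i)) * tpow (s + i))"
    proof (rule fls_eqI)
      fix n
      have "(\<Sum>i\<in>{0..<b}. fls_const (f $$ (s + i)) * tpow (s + i)) $$ n
          = (\<Sum>i\<in>{0..<b}. if i = n - s then f $$ (s + i) else 0)"
        unfolding fls_nth_sum by (intro sum.cong) auto
      also have "\<dots> = (if n - s \<in> {0..<b} then f $$ n else 0)"
        by (subst sum.delta) auto
      finally show "?g $$ n = (\<Sum>i\<in>{0..<b}. fls_const (f $$ (s + i)) * tpow (s + i)) $$ n"
        by auto
    qed
    moreover have "tpow (s + i) \<in> ?L" if "i \<in> {0..<b}" for i
      using V.lspan_superset[OF B] that b by auto
    ultimately have g: "?g \<in> ?L" using L by (auto intro!: fsub_sum fsub_const)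
    have "tpow (- s) * ?h \<in> fls_supp {c..}"
      using b by (auto simp: fls_supp_def b_def split: if_splits)
    then have "tpow (- s) * ?h \<in> carrier R" using c(2) by auto
    moreover have "tpow s \<in> ?L" using V.lspan_superset[OF B] b by force
    ultimately have "tpow (- s) * ?h * tpow s \<in> ?L" using L fsub_mult by blast
    also have "tpow (- s) * ?h * tpow s = ?h * (tpow (- s) * tpow s)" by simp
    also have "\<dots> = ?h" by (simp only: tpow_mult_tpow) simp
    finally have "?g + ?h \<in> ?L" using g L fsub_add by blast
    also have "?g + ?h = f"
      using fls_suppD[OF f] by (intro fls_eqI) auto
    finally show ?thesis .
  qed
  then show ?thesis unfolding fin_gen_iff[OF V.module_axioms]
    using B by (intro exI[of _ ?B]) auto
qed

text \<open>Induction over the width \<open>d\<close>: the quotient of \<open>A\<close> by its part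
  of order at least s + 1 has dimension at most one over the field, so a single further generator
  \<open>u\<close> of exact order \<open>s\<close> suffices.\<close>

lemma fin_gen_between:
  assumes "fsub A" "fls_supp {s + int d..} \<subseteq> A" "A \<subseteq> fls_supp {s..}"
  shows "fin_gen R (fls_module A)"
  using assms
proof (induction d arbitrary: s A)
  case 0
  then have "A = fls_supp {s..}" by simp
  then show ?case using fin_gen_atLeast by simp
next
  case (Suc d)
  let ?A = "A \<inter> fls_supp {s + 1..}"
  have sub: "fsub ?A" using Suc by (intro fsub_Int) auto
  have "fls_supp {s + 1 + int d..} \<subseteq> A" using Suc.prems(2) by (simp add: algebra_simps)
  then have "fls_supp {s + 1 + int d..} \<subseteq> ?A"
    using fls_supp_mono[of "{s + 1 + int d..}" "{s + 1..}"] by auto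
  then have fin: "fin_gen R (fls_module ?A)" using sub by (intro Suc.IH) auto
  show ?case
  proof (cases "A \<subseteq> fls_supp {s + 1..}")
    case True
    then show ?thesis using fin by (simp add: Int_absorb2)
  next
    case False
    then obtain u where u: "u \<in> A" "u \<notin> fls_supp {s + 1..}" by auto
    have us: "u $$ s \<noteq> 0"
    proof
      assume *: "u $$ s = 0"
      have "u \<in> fls_supp {s + 1..}"
      proof (rule fls_suppI)
        fix n assume n: "u $$ n \<noteq> 0"
        then have "n \<in> {s..}" using u(1) Suc.prems(3) by (auto simp: fls_supp_def)
        moreover have "n \<noteq> s" using n * by auto
        ultimately show "n \<in> {s + 1..}" by auto
      qed
      then show False using u(2) by simp
    qed
    interpret A: module R "fls_module A" by (rule module_fls_module[OF Suc.prems(1)])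
    obtain B where B: "finite B" "B \<subseteq> ?A" "?A \<subseteq> lspan R (fls_module ?A) B"
      using fin fin_gen_iff[OF module_fls_module[OF sub]] by auto
    have uB: "insert u B \<subseteq> carrier (fls_module A)" using u B by auto
    let ?L = "lspan R (fls_module A) (insert u B)"
    have L: "fsub ?L" using A.lspan_submodule[OF uB] Suc.prems(1) by (simp add: submodule_fls_module_iff)
    have "lspan R (fls_module ?A) B = lspan R (fls_module A) B"
      using lspan_restrict[of R ?A "fls_module A" B] by simp
    then have AL: "?A \<subseteq> ?L" using B(3) A.lspan_mono[OF _ uB, of B] by auto
    have uL: "u \<in> ?L" using A.lspan_superset[OF uB] by auto
    have "f \<in> ?L" if f: "f \<in> A" for f
    proof -
      let ?k = "fls_const (f $$ s / u $$ s)"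
      have "f - ?k * u \<in> fls_supp {s + 1..}"
      proof (rule fls_suppI, rule ccontr)
        fix n assume n: "(f - ?k * u) $$ n \<noteq> 0" "n \<notin> {s + 1..}"
        then have "n = s \<or> n \<notin> {s..}" by auto
        moreover have fu: "f \<in> fls_supp {s..}" "u \<in> fls_supp {s..}" using f u(1) Suc.prems(3) by auto
        ultimately show False
          using n(1) us fls_suppD[OF fu(1), of n] fls_suppD[OF fu(2), of n] by auto
      qed
      then have "f - ?k * u \<in> ?A" using f u(1) Suc.prems(1) fsub_diff fsub_const by blast
      then have "f - ?k * u + ?k * u \<in> ?L" using AL uL L fsub_add fsub_const by blast
      then show ?thesis by simp
    qed
    then show ?thesis unfolding fin_gen_iff[OF A.module_axioms]
      using B(1) uB by (intro exI[of _ "insert u B"]) auto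
  qed
qed

text \<open>A nonzero element of \<open>A\<close> forces a shift of k[[t]] into \<open>A\<close>, so
  \<open>A\<close> lies between two shifts. Applied to ideals, this shows that the ring is
  Noetherian.\<close>

lemma fin_gen_bounded:
  assumes "fsub A" "A \<subseteq> fls_supp {s..}"
  shows "fin_gen R (fls_module A)"
proof (cases "A = {0}")
  case True
  then show ?thesis using module_fls_module[OF assms(1)] by (intro fin_gen_zero) auto
next
  case False
  then obtain q where q: "q \<in> A" "q \<noteq> 0" using fsub_zero[OF assms(1)] by auto
  obtain c where c: "0 \<le> c" "fls_supp {c..} \<subseteq> carrier R" by (rule conductor_bound)
  have "fls_supp {c + fls_subdegree q..} \<subseteq> A" by (rule contains_atLeast[OF assms(1) q c(2)])
  moreover have "s \<le> fls_subdegree q"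
    using q assms(2) by (auto simp: mem_fls_supp_atLeast_iff)
  ultimately show ?thesis
    using assms c(1) by (intro fin_gen_between[of A s "nat (c + fls_subdegree q - s)"]) auto
qed

lemma fin_gen_imp_bounded:
  assumes "fsub A" "fin_gen R (fls_module A)"
  obtains s where "A \<subseteq> fls_supp {s..}"
proof -
  obtain B where B: "finite B" "B \<subseteq> A" "A \<subseteq> lspan R (fls_module A) B"
    using assms(2) fin_gen_iff[OF module_fls_module[OF assms(1)]] by auto
  \<comment> \<open>Including 0 keeps the minimum defined when \<open>B\<close> is empty.\<close>
  define s where "s = Min (insert 0 (fls_subdegree ` B))"
  have "B \<subseteq> fls_supp {s..}"
    using B(1) by (auto simp: s_def mem_fls_supp_atLeast_iff)
  then have "lspan R (fls_module UNIV) B \<subseteq> fls_supp {s..}"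
    by (intro module.lspan_subset[OF module_fls]) auto
  moreover have "lspan R (fls_module A) B = lspan R (fls_module UNIV) B"
    using lspan_restrict[of R A "fls_module UNIV" B] by simp
  ultimately show ?thesis using that B(3) by blast
qed

lemma noeth_R: "noeth R (fls_module (carrier R))"
  unfolding noeth_def submodule_fls_module_iff[OF fsub_R] fls_module_restrict
  using fin_gen_bounded carrier_R_bound by blast

end

sublocale numerical_semigroup_ring \<subseteq> noeth_cring R \<iota>
  using cring_R infinite_R inj_iota noeth_R by (intro noeth_cring.intro noeth_cring_axioms.intro)

section \<open>Subquotients of the field of Laurent series\<close>

context numerical_semigroup_ring
begin

text \<open>Expresses that A/A' belongs to \<open>X\<close> up to isomorphism, by a surjection from
  \<open>A\<close> onto an object with prescribed kernel; no model of the quotient has to be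
  chosen.\<close>

definition quo :: "('k fls, 'v) module set \<Rightarrow> 'k fls set \<Rightarrow> 'k fls set \<Rightarrow> bool" where
  "quo X A A' \<longleftrightarrow> (\<exists>N\<in>X. \<exists>p\<in>mod_hom R (fls_module A) N. p ` A = carrier N \<and>
     (\<forall>x\<in>A. p x = \<zero>\<^bsub>N\<^esub> \<longleftrightarrow> x \<in> A'))"

end

locale semigroup_ring_subcat = numerical_semigroup_ring H R \<iota> + subcat R \<iota> X
  for H :: "nat set" and R :: "'k::field fls ring" and \<iota> :: "'k fls \<Rightarrow> 'v" and X
begin

text \<open>Any surjection from \<open>A\<close> with the right kernel is as good as the one in
  \<open>quo\<close>, because the kernel determines the target up to isomorphism.\<close>

lemma quo_iff:
  assumes A: "fsub A" and N: "module R N"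
    and p: "p \<in> mod_hom R (fls_module A) N" "p ` A = carrier N" "\<And>x. x \<in> A \<Longrightarrow> p x = \<zero>\<^bsub>N\<^esub> \<longleftrightarrow> x \<in> A'"
  shows "quo X A A' \<longleftrightarrow> memb R X N"
proof
  assume "quo X A A'"
  then obtain N' q where N': "N' \<in> X" and q: "q \<in> mod_hom R (fls_module A) N'" "q ` A = carrier N'"
    "\<And>x. x \<in> A \<Longrightarrow> q x = \<zero>\<^bsub>N'\<^esub> \<longleftrightarrow> x \<in> A'"
    unfolding quo_def by auto
  have "mod_iso R N N'"
    by (rule mod_iso_same_kernel[OF module_fls_module[OF A] N X_fg(2)[OF N'] p(1) _ q(1)])
      (use p q in auto)
  then show "memb R X N" using N' by (auto simp: memb_def)
next
  assume "memb R X N"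
  then obtain N' f where N': "N' \<in> X" "f \<in> mod_hom R N N'" "bij_betw f (carrier N) (carrier N')"
    by (auto simp: memb_def mod_iso_def)
  have f0: "f y = \<zero>\<^bsub>N'\<^esub> \<longleftrightarrow> y = \<zero>\<^bsub>N\<^esub>" if "y \<in> carrier N" for y
    using N'(3) that mod_hom_inj_on_iff[OF N X_fg(2)[OF N'(1)] N'(2)]
      mod_hom_zero[OF N X_fg(2)[OF N'(1)] N'(2)] by (auto simp: bij_betw_def)
  have "f \<circ> p \<in> mod_hom R (fls_module A) N'" using p(1) N'(2) by (rule mod_hom_comp)
  moreover have "(f \<circ> p) ` A = carrier N'"
    unfolding image_comp[symmetric] p(2) using N'(3) by (simp add: bij_betw_def)
  moreover have "(f \<circ> p) x = \<zero>\<^bsub>N'\<^esub> \<longleftrightarrow> x \<in> A'" if "x \<in> A" for x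
    using p(2,3) f0 that by auto
  ultimately show "quo X A A'" unfolding quo_def using N'(1) by blast
qed

lemma quo_zero_iff: "fsub A \<Longrightarrow> quo X A {0} \<longleftrightarrow> memb R X (fls_module A)"
  by (rule quo_iff[of A _ "\<lambda>x. x"]) (auto intro: module_fls_module mod_homI)

end

locale semigroup_ring_ext_subcat = numerical_semigroup_ring H R \<iota> + ext_subcat R \<iota> X
  for H :: "nat set" and R :: "'k::field fls ring" and \<iota> :: "'k fls \<Rightarrow> 'v" and X

sublocale semigroup_ring_ext_subcat \<subseteq> semigroup_ring_subcat H R \<iota> X ..

context semigroup_ring_ext_subcat
begin

text \<open>
  This is the exact sequence
  \<open>0 \<rightarrow> (A \<inter> B) / (A' \<inter> B') \<rightarrow> A / A' \<oplus> B / B' \<rightarrow> (A + B) / (A' + B') \<rightarrow> 0\<close>.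
\<close>

lemma quo_Int_fplus:
  assumes sub: "fsub A" "fsub B" "fsub A'" "fsub B'" "A' \<subseteq> A" "B' \<subseteq> B"
    and int: "quo X (A \<inter> B) (A' \<inter> B')" and sum: "quo X (fplus A B) (fplus A' B')"
  shows "quo X A A'" "quo X B B'"
proof -
  note modA = module_fls_module[OF sub(1)] and modB = module_fls_module[OF sub(2)]
  obtain QA :: "('k fls, 'k fls) module" and pA where QA: "module R QA" "pA \<in> mod_hom R (fls_module A) QA"
    "pA ` A = carrier QA" "\<And>x. x \<in> A \<Longrightarrow> pA x = \<zero>\<^bsub>QA\<^esub> \<longleftrightarrow> x \<in> A'"
    using ex_quotient[OF modA, of A'] submodule_fls_module_iff[OF sub(1)] sub(3,5) by auto
  obtain QB :: "('k fls, 'k fls) module" and pB where QB: "module R QB" "pB \<in> mod_hom R (fls_module B) QB"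
    "pB ` B = carrier QB" "\<And>x. x \<in> B \<Longrightarrow> pB x = \<zero>\<^bsub>QB\<^esub> \<longleftrightarrow> x \<in> B'"
    using ex_quotient[OF modB, of B'] submodule_fls_module_iff[OF sub(2)] sub(4,6) by auto
  obtain N p where N: "N \<in> X" and p: "p \<in> mod_hom R (fls_module (fplus A B)) N"
    "p ` fplus A B = carrier N" "\<And>x. x \<in> fplus A B \<Longrightarrow> p x = \<zero>\<^bsub>N\<^esub> \<longleftrightarrow> x \<in> fplus A' B'"
    using sum unfolding quo_def by auto
  note modN = X_fg(2)[OF N]
  note sup = fplus_superset[OF sub(1,2)] fplus_superset[OF sub(3,4)]
  obtain gA where gA: "gA \<in> mod_hom R QA N" "\<And>x. x \<in> A \<Longrightarrow> gA (pA x) = p x"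
  proof (rule mod_hom_factor[OF modA QA(1) modN QA(2)])
    show "p \<in> mod_hom R (fls_module A) N" using mod_hom_restrict[OF p(1), of A] sup by simp
  qed (use QA p(3) sup in \<open>auto dest!: subsetD\<close>)
  obtain gB where gB: "gB \<in> mod_hom R QB N" "\<And>x. x \<in> B \<Longrightarrow> gB (pB x) = p x"
  proof (rule mod_hom_factor[OF modB QB(1) modN QB(2)])
    show "p \<in> mod_hom R (fls_module B) N" using mod_hom_restrict[OF p(1), of B] sup by simp
  qed (use QB p(3) sup in \<open>auto dest!: subsetD\<close>)
  let ?S = "mod_sum QA QB" and ?g = "\<lambda>(u, v). gA u \<oplus>\<^bsub>N\<^esub> gB v"
  have S: "module R ?S" by (rule module_sum[OF QA(1) QB(1)])
  interpret S: module R ?S by (rule S)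
  have g: "?g \<in> mod_hom R ?S N" by (rule mod_hom_sum[OF modN gA(1) gB(1)])
  have gp: "?g (pA a, pB b) = p (a + b)" if "a \<in> A" "b \<in> B" for a b
  proof -
    have "a \<in> fplus A B" "b \<in> fplus A B" using sup that by auto
    then show ?thesis using that mod_hom_add[OF p(1), of a b] by (simp add: gA gB)
  qed
  have carS: "carrier ?S = (\<lambda>(a, b). (pA a, pB b)) ` (A \<times> B)"
    unfolding mod_sum_simps QA(3)[symmetric] QB(3)[symmetric] by auto
  have surj: "?g ` carrier ?S = carrier N"
  proof -
    have "?g ` carrier ?S = (\<lambda>(a, b). p (a + b)) ` (A \<times> B)"
      unfolding carS image_image by (rule image_cong) (use gp in auto)
    also have "\<dots> = p ` fplus A B" unfolding fplus_def by (auto simp: image_iff)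
    finally show ?thesis using p(2) by simp
  qed
  let ?K = "{x \<in> carrier ?S. ?g x = \<zero>\<^bsub>N\<^esub>}"
  have K: "module R (?S\<lparr>carrier := ?K\<rparr>)"
    by (rule S.module_restrict[OF submodule_kernel[OF S modN g]])
  \<comment> \<open>The antidiagonal z -> (z, -z) maps the intersection of \<open>A\<close> and
    \<open>B\<close> onto the kernel of the addition map \<open>?g\<close>, and kills exactly the
    elements that lie in both \<open>A'\<close> and \<open>B'\<close>.\<close>
  let ?q = "\<lambda>z. (pA z, pB (- z))"
  have neg: "- z \<in> B" if "z \<in> B" for z using that fsub_uminus[OF sub(2)] by auto
  have "quo X (A \<inter> B) (A' \<inter> B') \<longleftrightarrow> memb R X (?S\<lparr>carrier := ?K\<rparr>)"
  proof (rule quo_iff[OF fsub_Int[OF sub(1,2)] K])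
    have qK: "?q z \<in> ?K" if "z \<in> A \<inter> B" for z
    proof -
      have "p 0 = \<zero>\<^bsub>N\<^esub>"
        using p(3)[of 0] fsub_zero[OF fsub_fplus[OF sub(1,2)]] fsub_zero[OF fsub_fplus[OF sub(3,4)]] by simp
      then show ?thesis
        using gp[of z "- z"] that neg QA(3) QB(3) by auto
    qed
    show "?q \<in> mod_hom R (fls_module (A \<inter> B)) (?S\<lparr>carrier := ?K\<rparr>)"
    proof (intro mod_hom_corestrict mod_hom_Pair mod_homI)
      show "?q ` carrier (fls_module (A \<inter> B)) \<subseteq> ?K" using qK by auto
      show "pB (- (x \<oplus>\<^bsub>fls_module (A \<inter> B)\<^esub> y)) = pB (- x) \<oplus>\<^bsub>QB\<^esub> pB (- y)"
        if "x \<in> carrier (fls_module (A \<inter> B))" "y \<in> carrier (fls_module (A \<inter> B))" for x y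
        using mod_hom_add[OF QB(2), of "- x" "- y"] that neg by simp
      show "pB (- (r \<odot>\<^bsub>fls_module (A \<inter> B)\<^esub> x)) = r \<odot>\<^bsub>QB\<^esub> pB (- x)"
        if "r \<in> carrier R" "x \<in> carrier (fls_module (A \<inter> B))" for r x
        using mod_hom_smult[OF QB(2), of r "- x"] that neg by simp
    qed (use QA(2) QB(2) neg in \<open>auto simp: mod_hom_def\<close>)
    show "?q ` (A \<inter> B) = carrier (?S\<lparr>carrier := ?K\<rparr>)"
    proof (intro equalityI subsetI)
      fix y assume "y \<in> carrier (?S\<lparr>carrier := ?K\<rparr>)"
      then have y: "y \<in> carrier ?S" "?g y = \<zero>\<^bsub>N\<^esub>" by auto
      from y(1) obtain a b where ab: "a \<in> A" "b \<in> B" "y = (pA a, pB b)" unfolding carS by auto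
      have "a + b \<in> fplus A' B'"
        using y(2) gp[OF ab(1,2)] p(3)[of "a + b"] ab unfolding fplus_def by auto
      then obtain a' b' where ab': "a' \<in> A'" "b' \<in> B'" "a + b = a' + b'" unfolding fplus_def by auto
      \<comment> \<open>The representatives \<open>a\<close> and \<open>b\<close> are corrected by
        elements of \<open>A'\<close> and \<open>B'\<close> so that they become opposite; the
        corrected \<open>a\<close> is then the required preimage in the intersection.\<close>
      have z: "a - a' = b' - b" using ab'(3) by (simp add: algebra_simps)
      have "a - a' \<in> A" using fsub_diff[OF sub(1)] ab ab' sub(5) by auto
      moreover have "b' - b \<in> B" using fsub_diff[OF sub(2)] ab ab' sub(6) by auto
      ultimately have "a - a' \<in> A \<inter> B" using z by simp
      moreover have "?q (a - a') = y"
      proof -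
        have "pA (a - a') = pA a"
          using mod_hom_eq_iff[OF modA QA(1,2), of "a - a'" a] QA(4)[of "- a'"] ab(1) ab'(1) sub(5)
            \<open>a - a' \<in> A\<close> fsub_uminus[OF sub(3)] by (auto simp: minus_fls_module[OF sub(1)])
        moreover have "pB (- (a - a')) = pB b"
          using mod_hom_eq_iff[OF modB QB(1,2), of "- (a - a')" b] QB(4)[of "- b'"] ab(2) ab'(2) sub(6)
            neg[OF \<open>b' - b \<in> B\<close>] fsub_uminus[OF sub(4)] unfolding z by (auto simp: minus_fls_module[OF sub(2)])
        ultimately show ?thesis using ab(3) by simp
      qed
      ultimately show "y \<in> ?q ` (A \<inter> B)" by blast
    qed (use qK in auto)
    show "?q x = \<zero>\<^bsub>?S\<lparr>carrier := ?K\<rparr>\<^esub> \<longleftrightarrow> x \<in> A' \<inter> B'" if "x \<in> A \<inter> B" for x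
    proof -
      have "- x \<in> B' \<longleftrightarrow> x \<in> B'" using fsub_uminus[OF sub(4), of x] fsub_uminus[OF sub(4), of "- x"] by auto
      then show ?thesis using that QA(4)[of x] QB(4)[of "- x"] neg by simp
    qed
  qed
  then have "memb R X (?S\<lparr>carrier := ?K\<rparr>)" using int by simp
  \<comment> \<open>Both ends of the sequence belong to \<open>X\<close>, hence so does the direct
    sum in the middle, and with it each summand.\<close>
  then have "memb R X ?S" by (rule memb_extension[OF ext S modN g surj _ memb_self[OF N]])
  then have "memb R X QA" "memb R X QB" using memb_summand[OF QA(1) QB(1)] by auto
  then show "quo X A A'" "quo X B B'"
    using quo_iff[OF sub(1) QA] quo_iff[OF sub(2) QB] by auto
qed

section \<open>Torsionfree modules\<close>

text \<open>
  Intersecting with and adding \<open>t\<^sup>s\<^sup>+\<^sup>1 k[[t]]\<close> shrinks the interval in which a fractional ideal is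
  pinned down, until only shifts of \<open>k[[t]]\<close> are left.
\<close>

lemma memb_between:
  assumes S: "memb R X (fls_module (fls_supp {0..}))"
    and A: "fsub A" "fls_supp {s + int d..} \<subseteq> A" "A \<subseteq> fls_supp {s..}"
  shows "memb R X (fls_module A)"
proof -
  have V: "memb R X (fls_module (fls_supp {m..}))" for m
    using memb_cong[OF module_fls_module scale_iso[of _ "tpow m"] S] scale_atLeast[of m 0] by simp
  \<comment> \<open>Width one leaves only two cases: the quotient of consecutive shifts is
    one-dimensional over the field, so \<open>A\<close> is one of the two shifts.\<close>
  have one: "memb R X (fls_module A)"
    if A: "fsub A" "fls_supp {s + 1..} \<subseteq> A" "A \<subseteq> fls_supp {s..}" for A s
  proof (cases "\<exists>u\<in>A. u $$ s \<noteq> 0")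
    case True
    then have "A = fls_supp {s..}" using atLeast_fill[OF A(1,2)] A(3) by blast
    then show ?thesis using V by simp
  next
    case False
    have "A \<subseteq> fls_supp {s + 1..}"
    proof (intro subsetI fls_suppI)
      fix f n assume "f \<in> A" "f $$ n \<noteq> 0"
      then have "n \<noteq> s" "n \<in> {s..}" using False A(3) by (auto simp: fls_supp_def)
      then show "n \<in> {s + 1..}" by auto
    qed
    then have "A = fls_supp {s + 1..}" using A(2) by auto
    then show ?thesis using V by simp
  qed
  show ?thesis
    using A
  proof (induction d arbitrary: s A)
    case 0
    then have "A = fls_supp {s..}" by simp
    then show ?case using V by simp
  next
    case (Suc d)
    let ?V = "fls_supp {s + 1..} :: 'k fls set"
    have le: "{s + 1 + int d..} \<subseteq> {s + 1..}" by auto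
    have sub: "fsub (A \<inter> ?V)" "fsub (fplus A ?V)"
      using Suc.prems(1) by (auto intro: fsub_Int fsub_fplus)
    \<comment> \<open>The intersection has width \<open>d\<close> and falls under the induction
      hypothesis, while the sum below has width one and falls under \<open>one\<close>.\<close>
    have "memb R X (fls_module (A \<inter> ?V))"
      using Suc.prems(2) fls_supp_mono[OF le] sub(1)
      by (intro Suc.IH[of "A \<inter> ?V" "s + 1"]) (auto simp: algebra_simps)
    moreover have "?V \<subseteq> fls_supp {s..}" by (rule fls_supp_mono) auto
    then have "memb R X (fls_module (fplus A ?V))"
      using Suc.prems fplus_superset(2)[of A ?V] sub(2)
      by (intro one[of "fplus A ?V" s] fplus_subset) auto
    moreover have "fplus {0} {0} = {0 :: 'k fls}" by (simp add: fplus_def)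
    moreover have "fsub {0}" by (simp add: fsub_iff)
    ultimately have "quo X A {0}"
      using quo_Int_fplus(1)[of A ?V "{0}" "{0}"] Suc.prems(1) sub by (simp add: quo_zero_iff fsub_zero)
    then show ?case using quo_zero_iff[OF Suc.prems(1)] by simp
  qed
qed

lemma memb_fractional:
  assumes S: "memb R X (fls_module (fls_supp {0..}))" and A: "fsub A" "fin_gen R (fls_module A)"
  shows "memb R X (fls_module A)"
proof (cases "A = {0}")
  case True
  then show ?thesis using memb_zero[OF module_fls_module[OF A(1)]] by simp
next
  case False
  then obtain q where q: "q \<in> A" "q \<noteq> 0" using fsub_zero[OF A(1)] by auto
  obtain c where c: "0 \<le> c" "fls_supp {c..} \<subseteq> carrier R" by (rule conductor_bound)
  obtain s where s: "A \<subseteq> fls_supp {s..}" using fin_gen_imp_bounded[OF A] by blast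
  have "fls_supp {c + fls_subdegree q..} \<subseteq> A" by (rule contains_atLeast[OF A(1) q c(2)])
  moreover have "s \<le> fls_subdegree q" using q s by (auto simp: mem_fls_supp_atLeast_iff)
  ultimately show ?thesis
    using A(1) s c(1) by (intro memb_between[OF S, of A s "nat (c + fls_subdegree q - s)"]) auto
qed

end

section \<open>Rank-one filtrations of torsionfree modules\<close>

context numerical_semigroup_ring
begin

text \<open>Encodes that M/N is torsionfree without forming the quotient.\<close>

definition saturated :: "('k fls, 'w) module \<Rightarrow> 'w set \<Rightarrow> bool" where
  "saturated M N \<longleftrightarrow> submodule N R M \<and>
     (\<forall>r\<in>carrier R. \<forall>x\<in>carrier M. r \<noteq> 0 \<longrightarrow> r \<odot>\<^bsub>M\<^esub> x \<in> N \<longrightarrow> x \<in> N)"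

text \<open>\<open>N'\<close> is the preimage of the saturation of the line spanned by
  \<open>v\<close> in M/N, and \<open>f\<close> is the coordinate with respect to \<open>v\<close>
  over the fraction field. Thus N'/N embeds into k((t)) with \<open>v\<close> going to 1.\<close>

lemma saturated_extend:
  assumes M: "module R M" and N: "saturated M N" and v: "v \<in> carrier M" "v \<notin> N"
  obtains N' f where "saturated M N'" "N \<subseteq> N'" "v \<in> N'"
    "f \<in> mod_hom R (M\<lparr>carrier := N'\<rparr>) (fls_module UNIV)" "N = {x \<in> N'. f x = 0}"
proof -
  interpret M: module R M by fact
  have sub: "submodule N R M" and sat: "\<And>r x. r \<in> carrier R \<Longrightarrow> x \<in> carrier M \<Longrightarrow> r \<noteq> 0 \<Longrightarrow>
      r \<odot>\<^bsub>M\<^esub> x \<in> N \<Longrightarrow> x \<in> N"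
    using N by (auto simp: saturated_def)
  note Nc = sub[unfolded M.submodule_iff]
  have Rc: "r * s \<in> carrier R" "r + s \<in> carrier R" "r - s \<in> carrier R" "0 \<in> carrier R"
    if "r \<in> carrier R" "s \<in> carrier R" for r s
    using that mult_mem_R fsub_add[OF fsub_R] fsub_diff[OF fsub_R] fsub_zero[OF fsub_R] by auto
  note mult = M.smult_assoc1[unfolded R_simps] and ladd = M.smult_l_distr[unfolded R_simps]
  \<comment> \<open>\<open>rel x q\<close> expresses x = q v modulo \<open>N\<close> after clearing
    a nonzero denominator \<open>r\<close>.\<close>
  define rel where "rel x q \<longleftrightarrow> x \<in> carrier M \<and>
    (\<exists>r\<in>carrier R. \<exists>s\<in>carrier R. \<exists>n\<in>N. r \<noteq> 0 \<and> r \<odot>\<^bsub>M\<^esub> x = s \<odot>\<^bsub>M\<^esub> v \<oplus>\<^bsub>M\<^esub> n \<and> q = s / r)" for x q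
  have rel_add: "rel (x \<oplus>\<^bsub>M\<^esub> y) (q + q')" if pr: "rel x q" "rel y q'" for x y q q'
  proof -
    obtain r s n where 1: "r \<in> carrier R" "s \<in> carrier R" "n \<in> N" "r \<noteq> 0"
      "r \<odot>\<^bsub>M\<^esub> x = s \<odot>\<^bsub>M\<^esub> v \<oplus>\<^bsub>M\<^esub> n" "q = s / r" "x \<in> carrier M" using pr(1) by (auto simp: rel_def)
    obtain r' s' n' where 2: "r' \<in> carrier R" "s' \<in> carrier R" "n' \<in> N" "r' \<noteq> 0"
      "r' \<odot>\<^bsub>M\<^esub> y = s' \<odot>\<^bsub>M\<^esub> v \<oplus>\<^bsub>M\<^esub> n'" "q' = s' / r'" "y \<in> carrier M" using pr(2) by (auto simp: rel_def)
    have nc: "n \<in> carrier M" "n' \<in> carrier M" using 1 2 Nc by auto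
    have "(r * r') \<odot>\<^bsub>M\<^esub> (x \<oplus>\<^bsub>M\<^esub> y) = r' \<odot>\<^bsub>M\<^esub> (r \<odot>\<^bsub>M\<^esub> x) \<oplus>\<^bsub>M\<^esub> r \<odot>\<^bsub>M\<^esub> (r' \<odot>\<^bsub>M\<^esub> y)"
      using 1(1,7) 2(1,7) Rc by (simp add: M.smult_r_distr mult[symmetric] mult.commute)
    also have "\<dots> = (r' * s + r * s') \<odot>\<^bsub>M\<^esub> v \<oplus>\<^bsub>M\<^esub> (r' \<odot>\<^bsub>M\<^esub> n \<oplus>\<^bsub>M\<^esub> r \<odot>\<^bsub>M\<^esub> n')"
      unfolding 1(5) 2(5) using 1 2 Rc nc v by (simp add: M.smult_r_distr mult ladd M.M.a_ac)
    finally show ?thesis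
      unfolding rel_def using 1 2 Rc Nc
      by (intro conjI bexI[of _ "r * r'"] bexI[of _ "r' * s + r * s'"]
          bexI[of _ "r' \<odot>\<^bsub>M\<^esub> n \<oplus>\<^bsub>M\<^esub> r \<odot>\<^bsub>M\<^esub> n'"]) (auto simp: field_simps)
  qed
  have rel_smult: "rel (t \<odot>\<^bsub>M\<^esub> x) (t * q)" if pr: "t \<in> carrier R" "rel x q" for t x q
  proof -
    obtain r s n where 1: "r \<in> carrier R" "s \<in> carrier R" "n \<in> N" "r \<noteq> 0"
      "r \<odot>\<^bsub>M\<^esub> x = s \<odot>\<^bsub>M\<^esub> v \<oplus>\<^bsub>M\<^esub> n" "q = s / r" "x \<in> carrier M" using pr(2) by (auto simp: rel_def)
    have nc: "n \<in> carrier M" using 1 Nc by auto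
    have "r \<odot>\<^bsub>M\<^esub> (t \<odot>\<^bsub>M\<^esub> x) = t \<odot>\<^bsub>M\<^esub> (r \<odot>\<^bsub>M\<^esub> x)"
      using 1(1,7) pr(1) by (simp add: mult[symmetric] mult.commute)
    also have "\<dots> = (t * s) \<odot>\<^bsub>M\<^esub> v \<oplus>\<^bsub>M\<^esub> t \<odot>\<^bsub>M\<^esub> n"
      unfolding 1(5) using 1 pr(1) nc v by (simp add: M.smult_r_distr mult)
    finally show ?thesis
      unfolding rel_def using 1 pr(1) Rc Nc
      by (intro conjI bexI[of _ r] bexI[of _ "t * s"] bexI[of _ "t \<odot>\<^bsub>M\<^esub> n"]) auto
  qed
  \<comment> \<open>This is where saturation enters: a nonzero ring element carrying
    \<open>x\<close>, or \<open>v\<close>, into \<open>N\<close> forces \<open>x\<close>, or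
    \<open>v\<close>, itself into \<open>N\<close>, and the latter is excluded.\<close>
  have rel_N: "q = 0 \<longleftrightarrow> x \<in> N" if pr: "rel x q" for x q
  proof -
    obtain r s n where 1: "r \<in> carrier R" "s \<in> carrier R" "n \<in> N" "r \<noteq> 0"
      "r \<odot>\<^bsub>M\<^esub> x = s \<odot>\<^bsub>M\<^esub> v \<oplus>\<^bsub>M\<^esub> n" "q = s / r" "x \<in> carrier M" using pr by (auto simp: rel_def)
    have nc: "n \<in> carrier M" using 1 Nc by auto
    show ?thesis
    proof
      assume "q = 0"
      then have "r \<odot>\<^bsub>M\<^esub> x = n" using 1 nc v M.smult_l_null[of v] by (simp add: R_simps)
      then show "x \<in> N" using sat 1 by auto
    next
      assume x: "x \<in> N"
      have "s \<odot>\<^bsub>M\<^esub> v = r \<odot>\<^bsub>M\<^esub> x \<ominus>\<^bsub>M\<^esub> n"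
        unfolding 1(5) using 1 v nc by (simp add: a_minus_def M.M.a_assoc M.M.r_neg)
      moreover have "r \<odot>\<^bsub>M\<^esub> x \<in> N" using x 1(1) Nc by auto
      ultimately have "s \<odot>\<^bsub>M\<^esub> v \<in> N" using M.submodule_minus[OF sub _ 1(3)] by metis
      then show "q = 0" using sat[of s v] v 1 by auto
    qed
  qed
  \<comment> \<open>The difference of two coordinates of \<open>x\<close> is a coordinate of x - x =
    0, so it vanishes by \<open>rel_N\<close>.\<close>
  have rel_unique: "q = q'" if "rel x q" "rel x q'" for x q q'
  proof -
    have "rel (x \<oplus>\<^bsub>M\<^esub> fls_const (- 1) \<odot>\<^bsub>M\<^esub> x) (q + fls_const (- 1) * q')"
      using that const_mem_R by (intro rel_add rel_smult)
    moreover have "x \<oplus>\<^bsub>M\<^esub> fls_const (- 1) \<odot>\<^bsub>M\<^esub> x = \<zero>\<^bsub>M\<^esub>"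
    proof -
      have x: "x \<in> carrier M" using that by (simp add: rel_def)
      then have "x \<oplus>\<^bsub>M\<^esub> fls_const (- 1) \<odot>\<^bsub>M\<^esub> x = (1 + fls_const (- 1)) \<odot>\<^bsub>M\<^esub> x"
        using M.smult_one[OF x] by (simp only: R_simps ladd[OF one_mem_R const_mem_R x])
      also have "1 + fls_const (- 1) = (0 :: 'k fls)" by simp
      finally show ?thesis using M.smult_l_null[OF x] by simp
    qed
    ultimately have "q + fls_const (- 1) * q' = 0"
      using rel_N M.submodule_zero[OF sub] by metis
    then show ?thesis by simp
  qed
  define N' where "N' = {x. \<exists>q. rel x q}"
  define f where "f x = (THE q. rel x q)" for x
  have f: "f x = q" if "rel x q" for x q
    unfolding f_def using that rel_unique by blast
  have relN: "rel x 0" if "x \<in> N" for x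
    unfolding rel_def using that Nc v one_mem_R Rc(4) M.smult_l_null[OF v(1)] M.smult_one[of x]
    by (intro conjI bexI[of _ 1] bexI[of _ 0] bexI[of _ x]) auto
  have relv: "rel v 1"
    unfolding rel_def using Nc v one_mem_R
    by (intro conjI bexI[of _ 1] bexI[of _ 1] bexI[of _ "\<zero>\<^bsub>M\<^esub>"]) auto
  have sub': "submodule N' R M"
    unfolding M.submodule_iff
  proof (intro conjI ballI subsetI)
    show "x \<in> carrier M" if "x \<in> N'" for x using that by (auto simp: N'_def rel_def)
    show "\<zero>\<^bsub>M\<^esub> \<in> N'" unfolding N'_def using relN Nc by blast
    show "x \<oplus>\<^bsub>M\<^esub> y \<in> N'" if "x \<in> N'" "y \<in> N'" for x y
      using that rel_add unfolding N'_def by blast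
    show "r \<odot>\<^bsub>M\<^esub> x \<in> N'" if "r \<in> carrier R" "x \<in> N'" for r x
      using that rel_smult unfolding N'_def by blast
  qed
  have "x \<in> N'" if r: "r \<in> carrier R" "x \<in> carrier M" "r \<noteq> 0" "r \<odot>\<^bsub>M\<^esub> x \<in> N'" for r x
  proof -
    obtain q where "rel (r \<odot>\<^bsub>M\<^esub> x) q" using r by (auto simp: N'_def)
    then obtain r' s n where 1: "r' \<in> carrier R" "s \<in> carrier R" "n \<in> N" "r' \<noteq> 0"
      "r' \<odot>\<^bsub>M\<^esub> (r \<odot>\<^bsub>M\<^esub> x) = s \<odot>\<^bsub>M\<^esub> v \<oplus>\<^bsub>M\<^esub> n" by (auto simp: rel_def)
    then have "rel x (s / (r' * r))"
      unfolding rel_def using r Rc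
      by (intro conjI bexI[of _ "r' * r"] bexI[of _ s] bexI[of _ n]) (auto simp: mult)
    then show ?thesis by (auto simp: N'_def)
  qed
  then have "saturated M N'" using sub' by (auto simp: saturated_def)
  moreover have "N \<subseteq> N'" using relN by (auto simp: N'_def)
  moreover have "v \<in> N'" using relv by (auto simp: N'_def)
  moreover have "f \<in> mod_hom R (M\<lparr>carrier := N'\<rparr>) (fls_module UNIV)"
  proof (rule mod_homI)
    show "f (x \<oplus>\<^bsub>M\<lparr>carrier := N'\<rparr>\<^esub> y) = f x \<oplus>\<^bsub>fls_module UNIV\<^esub> f y"
      if xy: "x \<in> carrier (M\<lparr>carrier := N'\<rparr>)" "y \<in> carrier (M\<lparr>carrier := N'\<rparr>)" for x y
    proof -
      obtain q q' where "rel x q" "rel y q'" using xy by (auto simp: N'_def)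
      then show ?thesis using f rel_add by simp
    qed
    show "f (r \<odot>\<^bsub>M\<lparr>carrier := N'\<rparr>\<^esub> x) = r \<odot>\<^bsub>fls_module UNIV\<^esub> f x"
      if rx: "r \<in> carrier R" "x \<in> carrier (M\<lparr>carrier := N'\<rparr>)" for r x
    proof -
      obtain q where "rel x q" using rx by (auto simp: N'_def)
      then show ?thesis using f rel_smult rx by simp
    qed
  qed simp
  moreover have "N = {x \<in> N'. f x = 0}"
    using relN f rel_N by (auto simp: N'_def)
  ultimately show ?thesis by (rule that)
qed

text \<open>The generators are added one at a time, each time passing to the saturation;
  torsionfreeness makes the zero submodule a saturated start. Each factor N'/N embeds into k((t))
  via \<open>f\<close>.\<close>

lemma torsionfree_induct:
  fixes M :: "('k fls, 'w) module"
  assumes M: "module R M" "fin_gen R M"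
    and tf: "\<And>r x. r \<in> carrier R \<Longrightarrow> x \<in> carrier M \<Longrightarrow> r \<odot>\<^bsub>M\<^esub> x = \<zero>\<^bsub>M\<^esub> \<Longrightarrow> r = 0 \<or> x = \<zero>\<^bsub>M\<^esub>"
    and zero: "P {\<zero>\<^bsub>M\<^esub>}"
    and step: "\<And>N N' f. submodule N R M \<Longrightarrow> submodule N' R M \<Longrightarrow> P N \<Longrightarrow>
      f \<in> mod_hom R (M\<lparr>carrier := N'\<rparr>) (fls_module UNIV) \<Longrightarrow> N = {x \<in> N'. f x = 0} \<Longrightarrow> P N'"
  shows "P (carrier M)"
proof -
  interpret M: module R M by fact
  obtain B where B: "finite B" "B \<subseteq> carrier M" "carrier M \<subseteq> lspan R M B"
    using M(2) unfolding fin_gen_iff[OF M(1)] by auto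
  from B(1,2) have "\<exists>N. saturated M N \<and> B \<subseteq> N \<and> P N"
  proof (induction B)
    case empty
    then show ?case using zero tf M.submodule_zero_submodule by (auto simp: saturated_def)
  next
    case (insert v B)
    then obtain N where N: "saturated M N" "B \<subseteq> N" "P N" by auto
    show ?case
    proof (cases "v \<in> N")
      case False
      have "v \<in> carrier M" using insert by auto
      from saturated_extend[OF M(1) N(1) this False] obtain N' f
        where N': "saturated M N'" "N \<subseteq> N'" "v \<in> N'"
          "f \<in> mod_hom R (M\<lparr>carrier := N'\<rparr>) (fls_module UNIV)" "N = {x \<in> N'. f x = 0}" by blast
      have "P N'"
        by (rule step[OF _ _ N(3) N'(4,5)]) (use N(1) N'(1) in \<open>simp_all add: saturated_def\<close>)
      then show ?thesis using N(2) N'(1-3) by blast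
    qed (use N in auto)
  qed
  then obtain N where N: "submodule N R M" "B \<subseteq> N" "P N" by (auto simp: saturated_def)
  then have "N = carrier M"
    using B(3) M.lspan_subset[OF N(1,2)] by (auto simp: M.submodule_iff)
  then show ?thesis using N by simp
qed

text \<open>A strict step of the filtration ending at \<open>N'\<close> provides a map on
  \<open>N'\<close> that is not zero, and a step with N = N' changes nothing; so no homomorphism
  ever has to be extended to a larger module.\<close>

lemma torsionfree_ex_hom:
  fixes M :: "('k fls, 'w) module"
  assumes M: "module R M" "fin_gen R M" "carrier M \<noteq> {\<zero>\<^bsub>M\<^esub>}"
    and tf: "\<And>r x. r \<in> carrier R \<Longrightarrow> x \<in> carrier M \<Longrightarrow> r \<odot>\<^bsub>M\<^esub> x = \<zero>\<^bsub>M\<^esub> \<Longrightarrow> r = 0 \<or> x = \<zero>\<^bsub>M\<^esub>"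
  obtains f x where "f \<in> mod_hom R M (fls_module UNIV)" "x \<in> carrier M" "f x \<noteq> 0"
proof -
  have "carrier M = {\<zero>\<^bsub>M\<^esub>} \<or>
    (\<exists>f\<in>mod_hom R (M\<lparr>carrier := carrier M\<rparr>) (fls_module UNIV). \<exists>x\<in>carrier M. f x \<noteq> 0)"
    (is "?P (carrier M)")
  proof (rule torsionfree_induct[OF M(1,2) tf])
    fix N N' f assume "?P N" "f \<in> mod_hom R (M\<lparr>carrier := N'\<rparr>) (fls_module UNIV)" "N = {x \<in> N'. f x = 0}"
    then show "?P N'" by (cases "N = N'") auto
  qed auto
  then show ?thesis using that M(3) by auto
qed

end

context semigroup_ring_ext_subcat
begin

text \<open>Each factor of the rank-one filtration is isomorphic to the image of \<open>f\<close>,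
  which is a finitely generated fractional ideal because submodules of \<open>M\<close> are finitely
  generated.\<close>

lemma memb_torsionfree:
  assumes S: "memb R X (fls_module (fls_supp {0..}))"
    and M: "module R M" "fin_gen R M"
    and tf: "\<And>r x. r \<in> carrier R \<Longrightarrow> x \<in> carrier M \<Longrightarrow> r \<odot>\<^bsub>M\<^esub> x = \<zero>\<^bsub>M\<^esub> \<Longrightarrow> r = 0 \<or> x = \<zero>\<^bsub>M\<^esub>"
  shows "memb R X M"
proof -
  interpret M: module R M by fact
  have "memb R X (M\<lparr>carrier := carrier M\<rparr>)"
  proof (rule torsionfree_induct[OF M tf])
    show "memb R X (M\<lparr>carrier := {\<zero>\<^bsub>M\<^esub>}\<rparr>)"
      by (rule memb_zero[OF M.module_restrict[OF M.submodule_zero_submodule]]) simp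
  next
    fix N N' f
    assume *: "submodule N R M" "submodule N' R M" "memb R X (M\<lparr>carrier := N\<rparr>)"
      "f \<in> mod_hom R (M\<lparr>carrier := N'\<rparr>) (fls_module UNIV)" "N = {x \<in> N'. f x = 0}"
    have mN': "module R (M\<lparr>carrier := N'\<rparr>)" by (rule M.module_restrict[OF *(2)])
    interpret N': module R "M\<lparr>carrier := N'\<rparr>" by (rule mN')
    have im: "fsub (f ` N')"
      using submodule_image[OF mN' module_fls *(4) N'.carrier_is_submodule] by simp
    have f: "f \<in> mod_hom R (M\<lparr>carrier := N'\<rparr>) (fls_module (f ` N'))"
      using mod_hom_corestrict[OF *(4), of "f ` N'"] by simp
    have "fin_gen R (fls_module (f ` N'))"
      by (rule fin_gen_image[OF mN' module_fls_module[OF im] f _ fin_gen_submodule[OF M *(2)]]) simp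
    then have "memb R X (fls_module (f ` N'))" by (rule memb_fractional[OF S im])
    then show "memb R X (M\<lparr>carrier := N'\<rparr>)"
      by (intro memb_extension[OF ext mN' module_fls_module[OF im] f]) (use *(3,5) in auto)
  qed
  then show ?thesis by simp
qed

end

section \<open>Torsion modules\<close>

definition adjoin :: "('r, 'p) ring_scheme \<Rightarrow> ('r, 'v) module \<Rightarrow> 'v set \<Rightarrow> 'v \<Rightarrow> 'v set" where
  "adjoin R M N u = {r \<odot>\<^bsub>M\<^esub> u \<oplus>\<^bsub>M\<^esub> x | r x. r \<in> carrier R \<and> x \<in> N}"

lemma adjoin_props:
  assumes M: "module R M" and N: "submodule N R M" and u: "u \<in> carrier M"
  shows submodule_adjoin: "submodule (adjoin R M N u) R M"
    and adjoin_superset: "N \<subseteq> adjoin R M N u"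
    and adjoin_mem: "u \<in> adjoin R M N u"
proof -
  interpret M: module R M by fact
  have NM: "N \<subseteq> carrier M" using N by (simp add: M.submodule_iff)
  let ?S = "mod_sum (ideal_module R (carrier R)) (M\<lparr>carrier := N\<rparr>)"
  let ?f = "\<lambda>(r, x). r \<odot>\<^bsub>M\<^esub> u \<oplus>\<^bsub>M\<^esub> x"
  have S: "module R ?S"
    by (intro module_sum module_ideal_module M.R.is_cring M.module_restrict N)
  interpret S: module R ?S by fact
  have f: "?f \<in> mod_hom R ?S M"
    using u NM by (intro mod_hom_sum M M.mod_hom_orbit mod_hom_inclusion)
  have "?f ` carrier ?S = adjoin R M N u"
    by (auto simp: adjoin_def ideal_module_def image_iff)
  then show "submodule (adjoin R M N u) R M"
    using submodule_image[OF S M f S.carrier_is_submodule] by simp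
  have "\<zero>\<^bsub>R\<^esub> \<odot>\<^bsub>M\<^esub> u \<oplus>\<^bsub>M\<^esub> x \<in> adjoin R M N u" if "x \<in> N" for x
    unfolding adjoin_def using that by blast
  then show "N \<subseteq> adjoin R M N u" using u NM by (auto simp: subset_iff)
  have "\<one>\<^bsub>R\<^esub> \<odot>\<^bsub>M\<^esub> u \<oplus>\<^bsub>M\<^esub> \<zero>\<^bsub>M\<^esub> \<in> adjoin R M N u"
    unfolding adjoin_def using M.submodule_zero[OF N] by blast
  then show "u \<in> adjoin R M N u" using u by simp
qed

lemma adjoin_subset:
  assumes M: "module R M" and K: "submodule K R M" "N \<subseteq> K" "u \<in> K"
  shows "adjoin R M N u \<subseteq> K"
  using K unfolding adjoin_def module.submodule_iff[OF M] by blast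

section \<open>Torsion submodules and filtrations with residue field factors\<close>

context numerical_semigroup_ring
begin

definition tor :: "('k fls, 'w) module \<Rightarrow> 'w set" where
  "tor M = {x \<in> carrier M. \<exists>r\<in>carrier R. r \<noteq> 0 \<and> r \<odot>\<^bsub>M\<^esub> x = \<zero>\<^bsub>M\<^esub>}"

lemma torI: "x \<in> carrier M \<Longrightarrow> r \<in> carrier R \<Longrightarrow> r \<noteq> 0 \<Longrightarrow> r \<odot>\<^bsub>M\<^esub> x = \<zero>\<^bsub>M\<^esub> \<Longrightarrow> x \<in> tor M"
  by (auto simp: tor_def)

lemma tor_carrier: "x \<in> tor M \<Longrightarrow> x \<in> carrier M"
  by (simp add: tor_def)

text \<open>This is the maximal ideal m, because ring elements with nonzero constant term are
  invertible in the ring. Hence \<open>quo X (carrier R) maxid\<close> expresses that the residue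
  field belongs to \<open>X\<close>.\<close>

definition maxid :: "'k fls set" where
  "maxid = {r \<in> carrier R. r $$ 0 = 0}"

lemma tor_restrict: "N \<subseteq> carrier M \<Longrightarrow> tor (M\<lparr>carrier := N\<rparr>) = tor M \<inter> N"
  by (auto simp: tor_def)

lemma submodule_tor:
  assumes M: "module R M" shows "submodule (tor M) R M"
proof -
  interpret M: module R M by fact
  note mult = M.smult_assoc1[unfolded R_simps]
  show ?thesis
    unfolding M.submodule_iff
  proof (intro conjI ballI)
    show "tor M \<subseteq> carrier M" by (auto simp: tor_def)
    show "\<zero>\<^bsub>M\<^esub> \<in> tor M" using one_mem_R by (auto simp: tor_def intro!: bexI[of _ 1])
    show "x \<oplus>\<^bsub>M\<^esub> y \<in> tor M" if xy: "x \<in> tor M" "y \<in> tor M" for x y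
    proof -
      obtain r where r: "r \<in> carrier R" "r \<noteq> 0" "r \<odot>\<^bsub>M\<^esub> x = \<zero>\<^bsub>M\<^esub>" "x \<in> carrier M"
        using xy(1) by (auto simp: tor_def)
      obtain s where s: "s \<in> carrier R" "s \<noteq> 0" "s \<odot>\<^bsub>M\<^esub> y = \<zero>\<^bsub>M\<^esub>" "y \<in> carrier M"
        using xy(2) by (auto simp: tor_def)
      have "(r * s) \<odot>\<^bsub>M\<^esub> (x \<oplus>\<^bsub>M\<^esub> y) = (s * r) \<odot>\<^bsub>M\<^esub> x \<oplus>\<^bsub>M\<^esub> (r * s) \<odot>\<^bsub>M\<^esub> y"
        using r s mult_mem_R by (simp add: M.smult_r_distr mult.commute)
      also have "\<dots> = \<zero>\<^bsub>M\<^esub>" using r s by (simp add: mult)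
      finally show ?thesis using r s mult_mem_R by (auto simp: tor_def intro!: bexI[of _ "r * s"])
    qed
    show "t \<odot>\<^bsub>M\<^esub> x \<in> tor M" if tx: "t \<in> carrier R" "x \<in> tor M" for t x
    proof -
      obtain r where r: "r \<in> carrier R" "r \<noteq> 0" "r \<odot>\<^bsub>M\<^esub> x = \<zero>\<^bsub>M\<^esub>" "x \<in> carrier M"
        using tx(2) by (auto simp: tor_def)
      have "r \<odot>\<^bsub>M\<^esub> (t \<odot>\<^bsub>M\<^esub> x) = (t * r) \<odot>\<^bsub>M\<^esub> x"
        using r(1,4) tx(1) by (simp add: mult[symmetric] mult.commute)
      also have "\<dots> = \<zero>\<^bsub>M\<^esub>" using r tx(1) by (simp add: mult)
      finally show ?thesis using r tx(1) by (auto simp: tor_def)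
    qed
  qed
qed

text \<open>If \<open>r\<close> annihilates \<open>x\<close>, so does the whole ideal rR, and this
  ideal contains a shift of k[[t]].\<close>

lemma torsion_order:
  assumes M: "module R M" and x: "x \<in> tor M"
  obtains d :: nat where "\<And>f. f \<in> fls_supp {int d..} \<Longrightarrow> f \<in> carrier R"
    "\<And>f. f \<in> fls_supp {int d..} \<Longrightarrow> f \<odot>\<^bsub>M\<^esub> x = \<zero>\<^bsub>M\<^esub>"
proof -
  interpret M: module R M by fact
  obtain r where r: "r \<in> carrier R" "r \<noteq> 0" "r \<odot>\<^bsub>M\<^esub> x = \<zero>\<^bsub>M\<^esub>" "x \<in> carrier M"
    using x by (auto simp: tor_def)
  obtain c where c: "0 \<le> c" "fls_supp {c..} \<subseteq> carrier R" by (rule conductor_bound)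
  have r0: "0 \<le> fls_subdegree r"
    using r(1,2) carrier_R_bound by (auto simp: mem_fls_supp_atLeast_iff)
  let ?A = "(*) r ` carrier R"
  have A: "fls_supp {c + fls_subdegree r..} \<subseteq> ?A"
  proof (rule contains_atLeast[OF fsub_scale[OF fsub_R] _ r(2) c(2)])
    show "r \<in> ?A" using one_mem_R by (auto intro: rev_image_eqI)
  qed
  have d: "int (nat (c + fls_subdegree r)) = c + fls_subdegree r" using c(1) r0 by simp
  show ?thesis
  proof (rule that[of "nat (c + fls_subdegree r)"])
    fix f :: "'k fls" assume "f \<in> fls_supp {int (nat (c + fls_subdegree r))..}"
    then have "f \<in> ?A" unfolding d using A by auto
    then obtain s where s: "s \<in> carrier R" "f = s * r" by (auto simp: mult.commute)
    then show "f \<in> carrier R" using mult_mem_R r by simp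
    show "f \<odot>\<^bsub>M\<^esub> x = \<zero>\<^bsub>M\<^esub>"
      using s r M.smult_assoc1[of s r x] by simp
  qed
qed

text \<open>The torsion submodule is finitely generated, so the largest of finitely many bounds
  works. As a consequence it is the kernel of multiplication by t^d, an endomorphism of
  \<open>M\<close>.\<close>

lemma torsion_uniform:
  fixes M :: "('k fls, 'w) module"
  assumes M: "module R M" "fin_gen R M"
  obtains d :: nat where "\<And>f. f \<in> fls_supp {int d..} \<Longrightarrow> f \<in> carrier R"
    "\<And>f x. f \<in> fls_supp {int d..} \<Longrightarrow> x \<in> tor M \<Longrightarrow> f \<odot>\<^bsub>M\<^esub> x = \<zero>\<^bsub>M\<^esub>"
proof -
  interpret M: module R M by fact
  note sub = submodule_tor[OF M(1)]
  obtain B where B: "finite B" "B \<subseteq> tor M" "tor M \<subseteq> lspan R M B"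
    using fin_gen_submodule[OF M sub] unfolding fin_gen_iff[OF M.module_restrict[OF sub]] by auto
  have BM: "B \<subseteq> carrier M" using B(2) by (auto simp: tor_def)
  have "\<exists>d::nat. \<forall>f\<in>fls_supp {int d..}. f \<in> carrier R \<and> f \<odot>\<^bsub>M\<^esub> v = \<zero>\<^bsub>M\<^esub>" if "v \<in> B" for v
    using torsion_order[OF M(1), of v] that B(2) by (metis subsetD)
  then obtain D :: "'w \<Rightarrow> nat"
    where D: "\<And>v f. v \<in> B \<Longrightarrow> f \<in> fls_supp {int (D v)..} \<Longrightarrow> f \<in> carrier R \<and> f \<odot>\<^bsub>M\<^esub> v = \<zero>\<^bsub>M\<^esub>"
    by metis
  obtain c where c: "0 \<le> c" "fls_supp {c..} \<subseteq> carrier R" by (rule conductor_bound)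
  \<comment> \<open>\<open>nat c\<close> serves the first claim and keeps the maximum defined when
    there are no generators.\<close>
  define d where "d = Max (insert (nat c) (D ` B))"
  have fd: "f \<in> carrier R" if f: "f \<in> fls_supp {int d..}" for f
  proof -
    have "nat c \<le> d" unfolding d_def using B(1) by (intro Max_ge) auto
    then have "{int d..} \<subseteq> {c..}" by auto
    then show ?thesis using fls_supp_mono f c(2) by blast
  qed
  have "f \<odot>\<^bsub>M\<^esub> x = \<zero>\<^bsub>M\<^esub>" if f: "f \<in> fls_supp {int d..}" and x: "x \<in> tor M" for f x
  proof -
    note fR = fd[OF f]
    have "submodule {x \<in> carrier M. f \<odot>\<^bsub>M\<^esub> x = \<zero>\<^bsub>M\<^esub>} R M"
      by (rule submodule_kernel[OF M(1) M(1) M.mod_hom_scale[OF fR]])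
    moreover have "B \<subseteq> {x \<in> carrier M. f \<odot>\<^bsub>M\<^esub> x = \<zero>\<^bsub>M\<^esub>}"
    proof
      fix v assume v: "v \<in> B"
      then have "D v \<le> d" unfolding d_def using B(1) by (intro Max_ge) auto
      then have "f \<in> fls_supp {int (D v)..}" using fls_supp_mono[of "{int d..}" "{int (D v)..}"] f by auto
      then show "v \<in> {x \<in> carrier M. f \<odot>\<^bsub>M\<^esub> x = \<zero>\<^bsub>M\<^esub>}" using D v BM by auto
    qed
    ultimately have "lspan R M B \<subseteq> {x \<in> carrier M. f \<odot>\<^bsub>M\<^esub> x = \<zero>\<^bsub>M\<^esub>}" by (rule M.lspan_subset)
    then show ?thesis using B(3) x by auto
  qed
  with fd show ?thesis using that by blast
qed

text \<open>With \<lambda> the inverse of the constant term of \<open>r\<close>, the element 1 -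
  \<lambda> r lies in m; thus v = (1 - \<lambda> r) v + (\<lambda> r) v is a sum of two elements of
  \<open>N\<close>.\<close>

lemma maxid_unit:
  assumes M: "module R M" and N: "submodule N R M" and v: "v \<in> carrier M"
    and mv: "\<And>r. r \<in> maxid \<Longrightarrow> r \<odot>\<^bsub>M\<^esub> v \<in> N"
    and r: "r \<in> carrier R" "r \<notin> maxid" "r \<odot>\<^bsub>M\<^esub> v \<in> N"
  shows "v \<in> N"
proof -
  interpret M: module R M by fact
  note N' = N[unfolded M.submodule_iff]
  have r0: "r $$ 0 \<noteq> 0" using r by (simp add: maxid_def)
  let ?k = "fls_const (inverse (r $$ 0))"
  have kr: "?k * r \<in> carrier R" using const_mem_R mult_mem_R r(1) by blast
  have "1 - ?k * r \<in> carrier R" using fsub_diff[OF fsub_R one_mem_R kr] .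
  then have m: "1 - ?k * r \<in> maxid" using r0 by (simp add: maxid_def)
  have "1 - ?k * r + ?k * r = 1" by simp
  then have "v = (1 - ?k * r) \<odot>\<^bsub>M\<^esub> v \<oplus>\<^bsub>M\<^esub> (?k * r) \<odot>\<^bsub>M\<^esub> v"
    using M.smult_l_distr[of "1 - ?k * r" "?k * r" v] m kr v M.smult_one[OF v]
    by (simp add: maxid_def)
  moreover have "(?k * r) \<odot>\<^bsub>M\<^esub> v = ?k \<odot>\<^bsub>M\<^esub> (r \<odot>\<^bsub>M\<^esub> v)"
    using M.smult_assoc1[of ?k r v] const_mem_R r(1) v by simp
  ultimately show ?thesis using N' mv[OF m] r(3) const_mem_R by metis
qed

text \<open>A finitely generated torsion module is exhausted by submodules that grow by one vector
  \<open>u\<close> at a time with m u inside the previous submodule, so that all factors are copies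
  of the residue field.\<close>

lemma torsion_induct:
  fixes M :: "('k fls, 'w) module"
  assumes M: "module R M" "fin_gen R M" and tor: "tor M = carrier M"
    and zero: "P {\<zero>\<^bsub>M\<^esub>}"
    and step: "\<And>N u. submodule N R M \<Longrightarrow> P N \<Longrightarrow> u \<in> carrier M \<Longrightarrow> u \<notin> N \<Longrightarrow>
      (\<And>r. r \<in> maxid \<Longrightarrow> r \<odot>\<^bsub>M\<^esub> u \<in> N) \<Longrightarrow> P (adjoin R M N u)"
  shows "P (carrier M)"
proof -
  interpret M: module R M by fact
  \<comment> \<open>Induction on the order \<open>d\<close> from which ring elements carry
    \<open>u\<close> into \<open>N\<close>; for \<open>d = 0\<close> these include 1, so
    \<open>u\<close> lies in \<open>N\<close>. If \<open>d\<close> is not in \<open>H\<close>, no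
    ring element has order exactly \<open>d\<close>, and the bound \<open>Suc d\<close> improves to
    \<open>d\<close> by itself. Otherwise t^d u is adjoined first, which m carries into
    \<open>N\<close>.\<close>
  have single: "\<exists>N'. submodule N' R M \<and> P N' \<and> N \<subseteq> N' \<and> u \<in> N'"
    if "submodule N R M" "P N" "u \<in> carrier M" 
      "\<And>r. r \<in> carrier R \<Longrightarrow> r \<in> fls_supp {int d..} \<Longrightarrow> r \<odot>\<^bsub>M\<^esub> u \<in> N" for N u d
    using that
  proof (induction d arbitrary: N)
    case 0
    have "(1 :: 'k fls) \<in> fls_supp {int 0..}" using tpow_mem_fls_supp[of 0 "{int 0..}", where 'a = 'k] by simp
    then have "u \<in> N" using 0(4)[OF one_mem_R] M.smult_one[OF 0(3)] by simp
    then show ?case using 0 by blast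
  next
    case (Suc d)
    note u = Suc.prems(3)
    show ?case
    proof (cases "d \<in> H")
      case False
      have "r \<odot>\<^bsub>M\<^esub> u \<in> N" if r: "r \<in> carrier R" "r \<in> fls_supp {int d..}" for r
      proof -
        have "r \<in> fls_supp {int (Suc d)..}"
        proof (rule fls_suppI)
          fix n assume "r $$ n \<noteq> 0"
          then have "n \<in> int ` H" "n \<in> {int d..}" using r by (auto simp: carrier_R fls_supp_def)
          moreover from this have "n \<noteq> int d" using False by auto
          ultimately show "n \<in> {int (Suc d)..}" by auto
        qed
        then show ?thesis using Suc.prems(4) r(1) by blast
      qed
      then show ?thesis using Suc.IH Suc.prems by blast
    next
      case True
      have dR: "tpow (int d) \<in> carrier R" using True by (simp add: carrier_R)
      define u' where "u' = tpow (int d) \<odot>\<^bsub>M\<^esub> u"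
      have u': "u' \<in> carrier M" using dR u by (simp add: u'_def)
      obtain N1 where N1: "submodule N1 R M" "P N1" "N \<subseteq> N1" "u' \<in> N1"
      proof (cases "u' \<in> N")
        case False
        have "r \<odot>\<^bsub>M\<^esub> u' \<in> N" if r: "r \<in> maxid" for r
        proof -
          have rR: "r \<in> carrier R" using r by (simp add: maxid_def)
          have "r * tpow (int d) \<in> fls_supp {int (Suc d)..}"
          proof (rule fls_suppI)
            fix n assume "(r * tpow (int d)) $$ n \<noteq> 0"
            then have n: "r $$ (n - int d) \<noteq> 0" by (simp add: mult.commute[of r])
            then have "n - int d \<noteq> 0" using r by (auto simp: maxid_def)
            moreover have "n - int d \<ge> 0" using n rR carrier_R_bound by (force simp: fls_supp_def)
            ultimately show "n \<in> {int (Suc d)..}" by auto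
          qed
          then have "(r * tpow (int d)) \<odot>\<^bsub>M\<^esub> u \<in> N"
            using Suc.prems(4) mult_mem_R[OF rR dR] by blast
          then show ?thesis using M.smult_assoc1[of r "tpow (int d)" u] rR dR u by (simp add: u'_def)
        qed
        then have "P (adjoin R M N u')" using step Suc.prems(1,2) u' False by blast
        then show ?thesis
          using that adjoin_props[OF M(1) Suc.prems(1) u'] by blast
      qed (use that Suc.prems in blast)
      note N1' = N1(1)[unfolded M.submodule_iff]
      have "r \<odot>\<^bsub>M\<^esub> u \<in> N1" if r: "r \<in> carrier R" "r \<in> fls_supp {int d..}" for r
      proof -
        let ?k = "fls_const (r $$ int d)"
        let ?s = "r - ?k * tpow (int d)"
        have kR: "?k * tpow (int d) \<in> carrier R" using const_mem_R dR mult_mem_R by blast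
        have sR: "?s \<in> carrier R" using fsub_diff[OF fsub_R r(1) kR] .
        have "?s \<in> fls_supp {int (Suc d)..}"
        proof (rule fls_suppI)
          fix n assume n: "?s $$ n \<noteq> 0"
          then have "n \<noteq> int d" by auto
          moreover from this n have "r $$ n \<noteq> 0" by auto
          then have "n \<in> {int d..}" using r(2) by (auto simp: fls_supp_def)
          ultimately show "n \<in> {int (Suc d)..}" by auto
        qed
        then have "?s \<odot>\<^bsub>M\<^esub> u \<in> N1" using Suc.prems(4) sR N1(3) by blast
        moreover have "(?k * tpow (int d)) \<odot>\<^bsub>M\<^esub> u \<in> N1"
          using M.smult_assoc1[of ?k "tpow (int d)" u] const_mem_R dR u N1' N1(4) by (simp add: u'_def)
        ultimately have "?s \<odot>\<^bsub>M\<^esub> u \<oplus>\<^bsub>M\<^esub> (?k * tpow (int d)) \<odot>\<^bsub>M\<^esub> u \<in> N1" using N1' by blast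
        then show ?thesis using M.smult_l_distr[of ?s "?k * tpow (int d)" u] sR kR u by simp
      qed
      then obtain N' where "submodule N' R M" "P N'" "N1 \<subseteq> N'" "u \<in> N'"
        using Suc.IH[OF N1(1,2) u] by blast
      then show ?thesis using N1(3) by blast
    qed
  qed
  obtain B where B: "finite B" "B \<subseteq> carrier M" "carrier M \<subseteq> lspan R M B"
    using M(2) unfolding fin_gen_iff[OF M(1)] by auto
  from B(1,2) have "\<exists>N. submodule N R M \<and> P N \<and> B \<subseteq> N"
  proof (induction B)
    case empty
    then show ?case using zero M.submodule_zero_submodule by blast
  next
    case (insert v B)
    then obtain N where N: "submodule N R M" "P N" "B \<subseteq> N" by auto
    have v: "v \<in> carrier M" using insert by auto
    obtain d :: nat where d: "\<And>f. f \<in> fls_supp {int d..} \<Longrightarrow> f \<odot>\<^bsub>M\<^esub> v = \<zero>\<^bsub>M\<^esub>"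
      using torsion_order[OF M(1), of v] v tor by metis
    have "\<exists>N'. submodule N' R M \<and> P N' \<and> N \<subseteq> N' \<and> v \<in> N'"
      by (rule single[OF N(1,2) v, of d]) (simp add: d M.submodule_zero[OF N(1)])
    then show ?case using N(3) by blast
  qed
  then obtain N where N: "submodule N R M" "B \<subseteq> N" "P N" by auto
  then have "N = carrier M"
    using B(3) M.lspan_subset[OF N(1,2)] by (auto simp: M.submodule_iff)
  then show ?thesis using N by simp
qed

text \<open>Along the series every \<open>F i\<close> is torsion. For \<open>x\<close> in the next
  term and 0 < h in \<open>H\<close>, either t^h x lies in \<open>F i\<close>, or by simplicity t^h
  x generates \<open>F (Suc i)\<close> over \<open>F i\<close>; in both cases some nonzero ring
  element carries \<open>x\<close> into \<open>F i\<close>.\<close>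

lemma finite_length_imp_torsion:
  fixes M :: "('k fls, 'w) module"
  assumes M: "module R M" and fl: "finite_length R M"
  shows "tor M = carrier M"
proof -
  interpret M: module R M by fact
  obtain n :: nat and F where F: "F 0 = {\<zero>\<^bsub>M\<^esub>}" "F n = carrier M"
    and sub: "\<forall>i\<le>n. submodule (F i) R M"
    and series: "\<forall>i<n. F i \<subset> F (Suc i) \<and>
      (\<forall>N. submodule N R M \<and> F i \<subseteq> N \<and> N \<subseteq> F (Suc i) \<longrightarrow> N = F i \<or> N = F (Suc i))"
    using fl unfolding finite_length_def by auto
  have simple: "N = F i \<or> N = F (Suc i)"
    if "i < n" "submodule N R M" "F i \<subseteq> N" "N \<subseteq> F (Suc i)" for i N
    using series that by blast
  note torsub = submodule_tor[OF M]
  obtain c where "\<forall>n\<ge>c. n \<in> H" using H_cofinite by blast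
  then obtain h where h: "h \<in> H" "h > 0" by (intro that[of "Suc c"]) auto
  let ?t = "tpow (int h) :: 'k fls"
  have tR: "?t \<in> carrier R" using h by (simp add: carrier_R)
  have "F i \<subseteq> tor M" if "i \<le> n" for i
    using that
  proof (induction i)
    case 0
    then show ?case using F(1) M.submodule_zero[OF torsub] by simp
  next
    case (Suc i)
    then have i: "i < n" "F i \<subseteq> tor M" by auto
    have sub: "submodule (F i) R M" "submodule (F (Suc i)) R M" using sub i by auto
    have strict: "F i \<subset> F (Suc i)" using series i by blast
    have SM: "F (Suc i) \<subseteq> carrier M" using sub by (simp add: M.submodule_iff)
    show ?case
    proof
      fix x assume x: "x \<in> F (Suc i)"
      then have xM: "x \<in> carrier M" using SM by auto
      have kill: "x \<in> tor M" if r: "r \<in> carrier R" "r \<noteq> 0" "r \<odot>\<^bsub>M\<^esub> x \<in> tor M" for r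
      proof -
        obtain s where s: "s \<in> carrier R" "s \<noteq> 0" "s \<odot>\<^bsub>M\<^esub> (r \<odot>\<^bsub>M\<^esub> x) = \<zero>\<^bsub>M\<^esub>"
          using r(3) by (auto simp: tor_def)
        then have "(s * r) \<odot>\<^bsub>M\<^esub> x = \<zero>\<^bsub>M\<^esub>" using M.smult_assoc1[of s r x] r xM by simp
        then show ?thesis using s r xM mult_mem_R by (auto simp: tor_def intro!: bexI[of _ "s * r"])
      qed
      have tx: "?t \<odot>\<^bsub>M\<^esub> x \<in> F (Suc i)" using sub(2) x tR by (simp add: M.submodule_iff)
      show "x \<in> tor M"
      proof (cases "?t \<odot>\<^bsub>M\<^esub> x \<in> F i")
        case True
        then show ?thesis using kill[OF tR] i(2) by auto
      next
        case False
        let ?A = "adjoin R M (F i) (?t \<odot>\<^bsub>M\<^esub> x)"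
        have tM: "?t \<odot>\<^bsub>M\<^esub> x \<in> carrier M" using tR xM by simp
        note A = adjoin_props[OF M sub(1) tM]
        have "?A \<subseteq> F (Suc i)"
          using strict sub(2) tx by (intro adjoin_subset M) auto
        then have "?A = F (Suc i)" using simple[OF i(1) A(1,2)] A(3) False by auto
        then have "x \<in> ?A" using x by simp
        then obtain r y where ry: "r \<in> carrier R" "y \<in> F i" "x = r \<odot>\<^bsub>M\<^esub> (?t \<odot>\<^bsub>M\<^esub> x) \<oplus>\<^bsub>M\<^esub> y"
          unfolding adjoin_def by auto
        \<comment> \<open>Now \<open>(1 - r t\<^sup>h) x \<in> F i\<close>, a Nakayama argument without inverting \<open>1 - r t\<^sup>h\<close>.\<close>
        have rt: "r * ?t \<in> carrier R" using ry(1) tR mult_mem_R by blast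
        have d: "1 - r * ?t \<in> carrier R" using fsub_diff[OF fsub_R one_mem_R rt] .
        have "r \<in> fls_supp {0..}" using ry(1) carrier_R_bound by blast
        then have "r $$ (- int h) = 0" using h(2) by (intro fls_suppD) auto
        then have "(1 - r * ?t) $$ 0 = 1" by (subst mult.commute) simp
        then have nz: "1 - r * ?t \<noteq> 0" by (metis fls_zero_nth zero_neq_one)
        have yM: "y \<in> carrier M" using ry(2) i(2) by (auto simp: tor_def)
        have rtx: "(r * ?t) \<odot>\<^bsub>M\<^esub> x = r \<odot>\<^bsub>M\<^esub> (?t \<odot>\<^bsub>M\<^esub> x)"
          using M.smult_assoc1[of r ?t x] ry(1) tR xM by simp
        have "1 - r * ?t + r * ?t = 1" by simp
        then have "(1 - r * ?t) \<odot>\<^bsub>M\<^esub> x \<oplus>\<^bsub>M\<^esub> (r * ?t) \<odot>\<^bsub>M\<^esub> x = x"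
          using M.smult_l_distr[of "1 - r * ?t" "r * ?t" x] d rt xM M.smult_one[OF xM] by simp
        also have "\<dots> = y \<oplus>\<^bsub>M\<^esub> (r * ?t) \<odot>\<^bsub>M\<^esub> x"
          using ry(3) rt xM yM unfolding rtx[symmetric] by (simp add: M.M.a_comm)
        finally have "(1 - r * ?t) \<odot>\<^bsub>M\<^esub> x = y" using d rt xM yM by simp
        then show ?thesis using kill[OF d nz] ry(2) i(2) by auto
      qed
    qed
  qed
  then have "carrier M \<subseteq> tor M" using F(2) by auto
  then show ?thesis by (auto simp: tor_def)
qed

text \<open>The filtration of \<open>torsion_induct\<close> is a composition series: m carries the
  new vector \<open>u\<close> into \<open>N\<close>, so an intermediate submodule without
  \<open>u\<close> can contain only multiples of \<open>u\<close> by elements of m, modulo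
  \<open>N\<close>, and these lie in \<open>N\<close>.\<close>

lemma torsion_imp_finite_length:
  fixes M :: "('k fls, 'w) module"
  assumes M: "module R M" "fin_gen R M" "tor M = carrier M"
  shows "finite_length R M"
proof -
  interpret M: module R M by fact
  let ?P = "\<lambda>K. \<exists>n::nat. \<exists>F. F 0 = {\<zero>\<^bsub>M\<^esub>} \<and> F n = K \<and> (\<forall>i\<le>n. submodule (F i) R M) \<and>
        (\<forall>i<n. F i \<subset> F (Suc i) \<and>
           (\<forall>N. submodule N R M \<and> F i \<subseteq> N \<and> N \<subseteq> F (Suc i) \<longrightarrow> N = F i \<or> N = F (Suc i)))"
  have "?P (carrier M)"
  proof (rule torsion_induct[OF M])
    show "?P {\<zero>\<^bsub>M\<^esub>}"
      using M.submodule_zero_submodule by (intro exI[of _ 0] exI[of _ "\<lambda>_. {\<zero>\<^bsub>M\<^esub>}"]) auto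
  next
    fix N u
    assume N: "submodule N R M" "?P N" and u: "u \<in> carrier M" "u \<notin> N"
      and m: "\<And>r. r \<in> maxid \<Longrightarrow> r \<odot>\<^bsub>M\<^esub> u \<in> N"
    note A = adjoin_props[OF M(1) N(1) u(1)]
    have simple: "K = N \<or> K = adjoin R M N u"
      if K: "submodule K R M" "N \<subseteq> K" "K \<subseteq> adjoin R M N u" for K
    proof (rule disjCI)
      assume "K \<noteq> adjoin R M N u"
      then have uK: "u \<notin> K" using adjoin_subset[OF M(1) K(1,2)] K(3) by blast
      have "x \<in> N" if x: "x \<in> K" for x
      proof -
        obtain r y where ry: "r \<in> carrier R" "y \<in> N" "x = r \<odot>\<^bsub>M\<^esub> u \<oplus>\<^bsub>M\<^esub> y"
          using x K(3) unfolding adjoin_def by blast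
        have yM: "y \<in> carrier M" using ry(2) N(1) by (auto simp: M.submodule_iff)
        have "r \<odot>\<^bsub>M\<^esub> u = x \<ominus>\<^bsub>M\<^esub> y"
          unfolding ry(3) using ry(1) yM u(1) by (simp add: a_minus_def M.M.a_assoc M.M.r_neg)
        then have "r \<odot>\<^bsub>M\<^esub> u \<in> K" using M.submodule_minus[OF K(1) x] ry(2) K(2) by auto
        then have "r \<in> maxid"
          using maxid_unit[OF M(1) K(1) u(1) _ ry(1)] m K(2) uK by blast
        then show ?thesis using m ry N(1) by (simp add: M.submodule_iff)
      qed
      then show "K = N" using K(2) by auto
    qed
    obtain n :: nat and F where F: "F 0 = {\<zero>\<^bsub>M\<^esub>}" "F n = N" "\<forall>i\<le>n. submodule (F i) R M"
      "\<forall>i<n. F i \<subset> F (Suc i) \<and>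
           (\<forall>N. submodule N R M \<and> F i \<subseteq> N \<and> N \<subseteq> F (Suc i) \<longrightarrow> N = F i \<or> N = F (Suc i))"
      using N(2) by blast
    let ?F = "F(Suc n := adjoin R M N u)"
    have "N \<subset> adjoin R M N u" using A u(2) by auto
    then show "?P (adjoin R M N u)"
      using F A(1) simple
      by (intro exI[of _ "Suc n"] exI[of _ ?F]) (auto simp: less_Suc_eq le_Suc_eq)
  qed
  then show ?thesis unfolding finite_length_def .
qed

text \<open>From here on finite length is treated as torsion, and composition series are no longer
  handled.\<close>

lemma fl_mod_eq: "(fl_mod R :: ('k fls, 'w) module set) = {M \<in> fg_mod R. tor M = carrier M}"
  using finite_length_imp_torsion torsion_imp_finite_length by (auto simp: fl_mod_def fg_mod_def)

lemma tf_mod_eq: "(tf_mod R :: ('k fls, 'w) module set) = {M \<in> fg_mod R. tor M = {\<zero>\<^bsub>M\<^esub>}}"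
proof -
  have "(\<forall>r\<in>carrier R. \<forall>x\<in>carrier M. r \<odot>\<^bsub>M\<^esub> x = \<zero>\<^bsub>M\<^esub> \<longrightarrow> r = \<zero>\<^bsub>R\<^esub> \<or> x = \<zero>\<^bsub>M\<^esub>) \<longleftrightarrow> tor M = {\<zero>\<^bsub>M\<^esub>}"
    if "M \<in> fg_mod R" for M :: "('k fls, 'w) module"
  proof -
    interpret M: module R M using that by (simp add: fg_mod_def)
    have "\<zero>\<^bsub>M\<^esub> \<in> tor M" by (rule M.submodule_zero[OF submodule_tor]) (rule M.module_axioms)
    then show ?thesis by (auto simp: tor_def)
  qed
  then show ?thesis unfolding tf_mod_def by auto
qed

end

context semigroup_ring_ext_subcat
begin

text \<open>Each step of the filtration has factor (R u + N)/N, and r -> r u identifies it with the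
  residue field: the multipliers carrying \<open>u\<close> into \<open>N\<close> are exactly those
  in m.\<close>

lemma memb_torsion:
  fixes M :: "('k fls, 'w) module"
  assumes k: "quo X (carrier R) maxid" and M: "module R M" "fin_gen R M" "tor M = carrier M"
  shows "memb R X M"
proof -
  interpret M: module R M by fact
  have "memb R X (M\<lparr>carrier := carrier M\<rparr>)"
  proof (rule torsion_induct[OF M])
    show "memb R X (M\<lparr>carrier := {\<zero>\<^bsub>M\<^esub>}\<rparr>)"
      by (rule memb_zero[OF M.module_restrict[OF M.submodule_zero_submodule]]) simp
  next
    fix N u
    assume N: "submodule N R M" "memb R X (M\<lparr>carrier := N\<rparr>)" and u: "u \<in> carrier M" "u \<notin> N"
      and m: "\<And>r. r \<in> maxid \<Longrightarrow> r \<odot>\<^bsub>M\<^esub> u \<in> N"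
    let ?A = "adjoin R M N u"
    note A = adjoin_props[OF M(1) N(1) u(1)]
    note AM = M.module_restrict[OF A(1)]
    obtain Q :: "('k fls, 'w) module" and p where Q: "module R Q" "p \<in> mod_hom R (M\<lparr>carrier := ?A\<rparr>) Q"
      "p ` ?A = carrier Q" "\<And>x. x \<in> ?A \<Longrightarrow> p x = \<zero>\<^bsub>Q\<^esub> \<longleftrightarrow> x \<in> N"
      using ex_quotient[OF AM, of N] M.submodule_restrict_iff[OF A(1)] N(1) A(2) by auto
    interpret Q: module R Q by fact
    have rA: "r \<odot>\<^bsub>M\<^esub> u \<in> ?A" if "r \<in> carrier R" for r
      using that A by (simp add: M.submodule_iff)
    have ker: "r \<odot>\<^bsub>M\<^esub> u \<in> N \<longleftrightarrow> r \<in> maxid" if "r \<in> carrier R" for r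
      using maxid_unit[OF M(1) N(1) u(1) m that] m u(2) by blast
    let ?q = "\<lambda>r. p (r \<odot>\<^bsub>M\<^esub> u)"
    have "quo X (carrier R) maxid \<longleftrightarrow> memb R X Q"
    proof (rule quo_iff[OF fsub_R Q(1)])
      have "(\<lambda>r. r \<odot>\<^bsub>M\<^esub> u) \<in> mod_hom R (fls_module (carrier R)) (M\<lparr>carrier := ?A\<rparr>)"
        using rA by (intro mod_hom_corestrict M.mod_hom_orbit u(1)) auto
      from mod_hom_comp[OF this Q(2)] show "?q \<in> mod_hom R (fls_module (carrier R)) Q"
        by (simp add: comp_def)
      show "?q ` carrier R = carrier Q"
      proof (intro equalityI subsetI)
        fix y assume "y \<in> carrier Q"
        then obtain x where x: "x \<in> ?A" "y = p x" using Q(3) by auto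
        then obtain r n where rn: "r \<in> carrier R" "n \<in> N" "x = r \<odot>\<^bsub>M\<^esub> u \<oplus>\<^bsub>M\<^esub> n"
          unfolding adjoin_def by auto
        have "n \<in> ?A" using rn(2) A(2) by auto
        then have "y = ?q r \<oplus>\<^bsub>Q\<^esub> p n"
          unfolding x(2) rn(3) using mod_hom_add[OF Q(2), of "r \<odot>\<^bsub>M\<^esub> u" n] rA[OF rn(1)] by simp
        also have "\<dots> = ?q r"
          using Q(4)[OF \<open>n \<in> ?A\<close>] rn(2) mod_hom_closed[OF Q(2)] rA[OF rn(1)] by simp
        finally show "y \<in> ?q ` carrier R" using rn(1) by blast
      qed (use rA mod_hom_closed[OF Q(2)] in auto)
      show "?q r = \<zero>\<^bsub>Q\<^esub> \<longleftrightarrow> r \<in> maxid" if "r \<in> carrier R" for r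
        using Q(4)[OF rA[OF that]] ker[OF that] by simp
    qed
    then have "memb R X Q" using k by simp
    moreover have "{x \<in> ?A. p x = \<zero>\<^bsub>Q\<^esub>} = N" using Q(4) A(2) by auto
    ultimately show "memb R X (M\<lparr>carrier := ?A\<rparr>)"
      using N(2) Q(3) by (intro memb_extension[OF ext AM Q(1,2)]) auto
  qed
  then show ?thesis by simp
qed

end

section \<open>IKE-closed subcategories\<close>

context semigroup_ring_ext_subcat
begin

text \<open>A module annihilated by m is a vector space over the residue field. A generating set of
  least cardinality acts as a basis: a vector \<open>v\<close> of it is not in the span of the
  others, so the line through \<open>v\<close> splits off, and this line is a copy of R/m.\<close>

lemma residue_field_summand:
  fixes M :: "('k fls, 'w) module"
  assumes M: "module R M" "memb R X M" "carrier M \<noteq> {\<zero>\<^bsub>M\<^esub>}"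
    and m: "\<And>r x. r \<in> maxid \<Longrightarrow> x \<in> carrier M \<Longrightarrow> r \<odot>\<^bsub>M\<^esub> x = \<zero>\<^bsub>M\<^esub>"
  shows "quo X (carrier R) maxid"
proof -
  interpret M: module R M by fact
  let ?gen = "\<lambda>B. finite B \<and> B \<subseteq> carrier M \<and> carrier M \<subseteq> lspan R M B"
  obtain B0 where "?gen B0" using memb_fin_gen[OF M(1,2)] fin_gen_iff[OF M(1)] by auto
  then obtain B where B: "?gen B" and min: "\<forall>B'. ?gen B' \<longrightarrow> card B \<le> card B'"
    using ex_has_least_nat[of ?gen B0 card] by auto
  have "B \<noteq> {}"
  proof
    assume "B = {}"
    then have "carrier M \<subseteq> {\<zero>\<^bsub>M\<^esub>}"
      using B(1) M.lspan_subset[OF M.submodule_zero_submodule, of "{}"] by auto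
    then show False using M(3) M.M.zero_closed by blast
  qed
  then obtain v where v: "v \<in> B" by auto
  then have vM: "v \<in> carrier M" using B(1) by auto
  let ?N = "lspan R M (B - {v})"
  have N: "submodule ?N R M" using B(1) by (intro M.lspan_submodule) auto
  note A = adjoin_props[OF M(1) N vM]
  have BA: "B \<subseteq> adjoin R M ?N v" using A M.lspan_superset[of "B - {v}"] B(1) by auto
  then have all: "carrier M \<subseteq> adjoin R M ?N v" using B(1) M.lspan_subset[OF A(1)] by blast
  have vN: "v \<notin> ?N"
  proof
    assume "v \<in> ?N"
    then have "B \<subseteq> ?N" using M.lspan_superset[of "B - {v}"] B(1) by auto
    then have "?gen (B - {v})" using B(1) M.lspan_subset[OF N] by blast
    then have "card B \<le> card (B - {v})" using min by blast
    then show False using v B(1) card_Diff1_less[of B v] by simp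
  qed
  let ?L = "(\<lambda>r. r \<odot>\<^bsub>M\<^esub> v) ` carrier R"
  have orb: "(\<lambda>r. r \<odot>\<^bsub>M\<^esub> v) \<in> mod_hom R (fls_module (carrier R)) M"
    by (rule M.mod_hom_orbit[OF vM])
  have L: "submodule ?L R M"
    using submodule_image[OF module_regular M(1) orb] module.carrier_is_submodule[OF module_regular] by simp
  have ker: "r \<in> maxid" if "r \<in> carrier R" "r \<odot>\<^bsub>M\<^esub> v \<in> ?N" for r
    using maxid_unit[OF M(1) N vM _ that(1) _ that(2)] m[OF _ vM] M.submodule_zero[OF N] vN by metis
  have LN: "?L \<inter> ?N = {\<zero>\<^bsub>M\<^esub>}"
    using ker m[OF _ vM] M.submodule_zero[OF N] M.submodule_zero[OF L] by auto
  have "mod_iso R (mod_sum (M\<lparr>carrier := ?L\<rparr>) (M\<lparr>carrier := ?N\<rparr>)) M"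
  proof (rule internal_sum_iso[OF M(1) L N LN])
    show "\<exists>a\<in>?L. \<exists>b\<in>?N. x = a \<oplus>\<^bsub>M\<^esub> b" if "x \<in> carrier M" for x
    proof -
      have "x \<in> adjoin R M ?N v" using all that by blast
      then show ?thesis unfolding adjoin_def by auto
    qed
  qed
  then have "mod_iso R M (mod_sum (M\<lparr>carrier := ?L\<rparr>) (M\<lparr>carrier := ?N\<rparr>))"
    by (rule mod_iso_sym[OF module_sum[OF M.module_restrict[OF L] M.module_restrict[OF N]]])
  then have "memb R X (mod_sum (M\<lparr>carrier := ?L\<rparr>) (M\<lparr>carrier := ?N\<rparr>))"
    using memb_cong M by blast
  then have memL: "memb R X (M\<lparr>carrier := ?L\<rparr>)"
    by (rule memb_summand(1)[OF M.module_restrict[OF L] M.module_restrict[OF N]])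
  have "quo X (carrier R) maxid \<longleftrightarrow> memb R X (M\<lparr>carrier := ?L\<rparr>)"
  proof (rule quo_iff[OF fsub_R M.module_restrict[OF L]])
    show "(\<lambda>r. r \<odot>\<^bsub>M\<^esub> v) \<in> mod_hom R (fls_module (carrier R)) (M\<lparr>carrier := ?L\<rparr>)"
      by (rule mod_hom_corestrict[OF orb]) simp
    show "r \<odot>\<^bsub>M\<^esub> v = \<zero>\<^bsub>M\<lparr>carrier := ?L\<rparr>\<^esub> \<longleftrightarrow> r \<in> maxid" if "r \<in> carrier R" for r
      using ker[OF that] m[OF _ vM] M.submodule_zero[OF N] by auto
  qed simp
  then show ?thesis using memL by simp
qed

end

locale semigroup_ring_IKE = semigroup_ring_subcat H R \<iota> X
  for H :: "nat set" and R :: "'k::field fls ring" and \<iota> :: "'k fls \<Rightarrow> 'v" and X +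
  assumes IKE: "IKE_closed R X"

sublocale semigroup_ring_IKE \<subseteq> semigroup_ring_ext_subcat H R \<iota> X
proof
  show "closed_extensions R X" using IKE by (simp add: IKE_closed_def)
  show "closed_summands R X" using IKE by (rule IKE_closed_summands)
qed

context semigroup_ring_IKE
begin

text \<open>By the uniform bound, the torsion submodule is the kernel of multiplication by t^d on
  \<open>M\<close>.\<close>

lemma memb_tor:
  fixes M :: "('k fls, 'w) module"
  assumes M: "module R M" "memb R X M"
  shows "memb R X (M\<lparr>carrier := tor M\<rparr>)"
proof -
  interpret M: module R M by fact
  obtain d where d: "\<And>f. f \<in> fls_supp {int d..} \<Longrightarrow> f \<in> carrier R"
    "\<And>f x. f \<in> fls_supp {int d..} \<Longrightarrow> x \<in> tor M \<Longrightarrow> f \<odot>\<^bsub>M\<^esub> x = \<zero>\<^bsub>M\<^esub>"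
    using torsion_uniform[OF M(1) memb_fin_gen[OF M]] by blast
  have "{x \<in> carrier M. tpow (int d) \<odot>\<^bsub>M\<^esub> x = \<zero>\<^bsub>M\<^esub>} = tor M"
    using d[of "tpow (int d)"] by (auto intro: torI[of _ _ "tpow (int d)"] dest: tor_carrier)
  then show ?thesis
    using memb_kernel[OF IKE M M M.mod_hom_scale[OF d(1)[of "tpow (int d)"]]] by simp
qed

lemma residue_field:
  fixes M :: "('k fls, 'w) module"
  assumes M: "module R M" "memb R X M" "tor M \<noteq> {\<zero>\<^bsub>M\<^esub>}"
  shows "quo X (carrier R) maxid"
proof -
  interpret M: module R M by fact
  note T = submodule_tor[OF M(1)]
  have TM: "tor M \<subseteq> carrier M" by (auto simp: tor_def)
  interpret T: module R "M\<lparr>carrier := tor M\<rparr>" by (rule M.module_restrict[OF T])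
  obtain d where d: "\<And>f. f \<in> fls_supp {int d..} \<Longrightarrow> f \<in> carrier R"
    "\<And>f x. f \<in> fls_supp {int d..} \<Longrightarrow> x \<in> tor M \<Longrightarrow> f \<odot>\<^bsub>M\<^esub> x = \<zero>\<^bsub>M\<^esub>"
    using torsion_uniform[OF M(1) memb_fin_gen[OF M(1,2)]] by blast
  \<comment> \<open>The thresholds from which some ring element still acts nontrivially on the
    torsion. The unit 1 puts 0 into the set, and the uniform bound \<open>d\<close> makes it
    finite.\<close>
  define S where "S = {e. \<exists>r\<in>carrier R. r \<in> fls_supp {int e..} \<and> (\<exists>x\<in>tor M. r \<odot>\<^bsub>M\<^esub> x \<noteq> \<zero>\<^bsub>M\<^esub>)}"
  have "S \<subseteq> {..d}"
  proof
    fix e assume "e \<in> S"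
    then obtain r x where r: "r \<in> fls_supp {int e..}" "x \<in> tor M" "r \<odot>\<^bsub>M\<^esub> x \<noteq> \<zero>\<^bsub>M\<^esub>"
      by (auto simp: S_def)
    show "e \<in> {..d}"
    proof (rule ccontr)
      assume "e \<notin> {..d}"
      then have "{int e..} \<subseteq> {int d..}" by auto
      then show False using r d(2) fls_supp_mono by blast
    qed
  qed
  then have fin: "finite S" using finite_subset by blast
  obtain x where x: "x \<in> tor M" "x \<noteq> \<zero>\<^bsub>M\<^esub>" using M(3) M.submodule_zero[OF T] by auto
  have "0 \<in> S"
    unfolding S_def using x one_mem_R carrier_R_bound M.smult_one[of x] TM
    by (auto intro!: bexI[of _ 1] bexI[of _ x])
  define e where "e = Max S"
  have "e \<in> S" "Suc e \<notin> S"
    using Max_in[OF fin] Max_ge[OF fin, of "Suc e"] \<open>0 \<in> S\<close> by (auto simp: e_def)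
  then obtain r y where r: "r \<in> carrier R" "r \<in> fls_supp {int e..}" "y \<in> tor M" "r \<odot>\<^bsub>M\<^esub> y \<noteq> \<zero>\<^bsub>M\<^esub>"
    and e: "\<And>s x. s \<in> carrier R \<Longrightarrow> s \<in> fls_supp {int (Suc e)..} \<Longrightarrow> x \<in> tor M \<Longrightarrow> s \<odot>\<^bsub>M\<^esub> x = \<zero>\<^bsub>M\<^esub>"
    unfolding S_def by blast
  let ?f = "\<lambda>x. r \<odot>\<^bsub>M\<^esub> x"
  let ?K = "?f ` tor M"
  have f: "?f \<in> mod_hom R (M\<lparr>carrier := tor M\<rparr>) (M\<lparr>carrier := tor M\<rparr>)"
    using T.mod_hom_scale[OF r(1)] by simp
  have "memb R X (M\<lparr>carrier := ?K\<rparr>)"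
    using memb_image[OF IKE T.module_axioms memb_tor[OF M(1,2)] T.module_axioms memb_tor[OF M(1,2)] f]
    by simp
  moreover have K: "submodule ?K R M"
    using submodule_image[OF T.module_axioms T.module_axioms f T.carrier_is_submodule]
      M.submodule_restrict_iff[OF T] by simp
  moreover have "?K \<noteq> {\<zero>\<^bsub>M\<^esub>}" using r(3,4) by auto
  \<comment> \<open>Multiplying \<open>r\<close> by an element of m pushes its order beyond the
    maximal threshold \<open>e\<close>.\<close>
  moreover have "s \<odot>\<^bsub>M\<^esub> (r \<odot>\<^bsub>M\<^esub> x) = \<zero>\<^bsub>M\<^esub>" if s: "s \<in> maxid" and x: "x \<in> tor M" for s x
  proof -
    have sR: "s \<in> carrier R" using s by (simp add: maxid_def)
    have "s \<in> fls_supp {1..}"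
    proof (rule fls_suppI)
      fix n assume "s $$ n \<noteq> 0"
      then have "n \<noteq> 0" "n \<in> {0..}" using s sR carrier_R_bound by (auto simp: maxid_def fls_supp_def)
      then show "n \<in> {1..}" by auto
    qed
    then have "s * r \<in> fls_supp {int (Suc e)..}"
      using r(2) by (rule mult_mem_fls_supp) auto
    then have "(s * r) \<odot>\<^bsub>M\<^esub> x = \<zero>\<^bsub>M\<^esub>" using e mult_mem_R[OF sR r(1)] x by blast
    then show ?thesis using M.smult_assoc1[of s r x] sR r(1) x TM by auto
  qed
  ultimately show ?thesis
    by (intro residue_field_summand[of "M\<lparr>carrier := ?K\<rparr>"] M.module_restrict) auto
qed

text \<open>The element \<open>g\<close> has exact order \<open>s\<close>. If \<open>A\<close>
  contains the shift from s + d + 1 on, then t^d g supplies the missing order s + d in A + t^d A.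
  The contained shift thus moves down by one at a time, until only t^s k[[t]] remains.\<close>

lemma memb_normalization_between:
  assumes A: "fsub A" "memb R X (fls_module A)" "fls_supp {s + int d..} \<subseteq> A" "A \<subseteq> fls_supp {s..}"
    and g: "g \<in> A" "g $$ s \<noteq> 0"
  shows "memb R X (fls_module (fls_supp {0..}))"
  using A g(1)
proof (induction d arbitrary: A)
  case 0
  then have "A = fls_supp {s..}" by simp
  then have "memb R X (fls_module (fls_supp {s..}))" using 0 by simp
  then show ?case
    using memb_cong[OF module_fls_module scale_iso[of "fls_supp {s..}" "tpow (- s)"]]
      scale_atLeast[of "- s" s] by simp
next
  case (Suc d)
  note sub = Suc.prems(1)
  let ?A = "fplus A ((*) (tpow (int d)) ` A)"
  \<comment> \<open>An exponent of at least d + 1 moves t^s k[[t]] into t^(s+d+1) k[[t]], which lies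
    in \<open>A\<close>; 2d + 1 is such an exponent.\<close>
  let ?q = "tpow (int d + int d + 1) :: 'k fls"
  have subA: "fsub ?A" by (intro fsub_fplus fsub_scale sub)
  have mA: "module R (fls_module A)" by (rule module_fls_module[OF sub])
  have tA: "(*) (tpow (int d)) ` A \<subseteq> fls_supp {s + int d..}"
    using image_mono[OF Suc.prems(4), of "(*) (tpow (int d))"] scale_atLeast[of "int d" s]
    by (simp add: add.commute)
  have Ad: "?A \<subseteq> fls_supp {s..}"
    using tA Suc.prems(4) fls_supp_mono[of "{s + int d..}" "{s..}"] by (intro fplus_subset) auto
  have qA: "?q * f \<in> A" if "f \<in> fls_supp {s..}" for f
  proof -
    have "?q * f \<in> fls_supp {s + int (Suc d)..}" using that by (force simp: fls_supp_def)
    then show ?thesis using Suc.prems(3) by auto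
  qed
  \<comment> \<open>Multiplication by a high power of \<open>t\<close> moves \<open>A + t\<^sup>d A\<close> back into \<open>A\<close>, where it is the image
      of a homomorphism from \<open>A \<oplus> A\<close>.\<close>
  let ?f = "\<lambda>(x, y). ?q * x + ?q * (tpow (int d) * y)"
  have f: "?f \<in> mod_hom R (mod_sum (fls_module A) (fls_module A)) (fls_module A)"
  proof (rule mod_homI)
    fix z assume z: "z \<in> carrier (mod_sum (fls_module A) (fls_module A))"
    then obtain x y where xy: "z = (x, y)" "x \<in> A" "y \<in> A" by auto
    have "x \<in> fls_supp {s..}" using xy Suc.prems(4) by auto
    moreover have "tpow (int d) * y \<in> fls_supp {s..}"
      using tA xy fls_supp_mono[of "{s + int d..}" "{s..}"] by auto
    ultimately show "?f z \<in> carrier (fls_module A)" using qA xy fsub_add[OF sub] by auto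
  qed (auto simp: algebra_simps)
  have "?f ` carrier (mod_sum (fls_module A) (fls_module A)) = (*) ?q ` ?A"
  proof (intro equalityI subsetI)
    fix w assume "w \<in> (*) ?q ` ?A"
    then obtain x y where "x \<in> A" "y \<in> A" "w = ?q * (x + tpow (int d) * y)" unfolding fplus_def by auto
    then show "w \<in> ?f ` carrier (mod_sum (fls_module A) (fls_module A))"
      by (intro image_eqI[of _ _ "(x, y)"]) (auto simp: algebra_simps)
  next
    fix w assume "w \<in> ?f ` carrier (mod_sum (fls_module A) (fls_module A))"
    then obtain x y where xy: "x \<in> A" "y \<in> A" "w = ?q * x + ?q * (tpow (int d) * y)" by auto
    have "x + tpow (int d) * y \<in> ?A" unfolding fplus_def using xy by blast
    moreover have "w = ?q * (x + tpow (int d) * y)" using xy by (simp add: algebra_simps)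
    ultimately show "w \<in> (*) ?q ` ?A" by blast
  qed
  then have "memb R X (fls_module ((*) ?q ` ?A))"
    using memb_image[OF IKE module_sum[OF mA mA] memb_sum[OF ext mA mA Suc.prems(2) Suc.prems(2)]
        mA Suc.prems(2) f] by simp
  moreover have "mod_iso R (fls_module ((*) ?q ` ?A)) (fls_module ?A)"
    by (rule mod_iso_sym[OF module_fls_module[OF subA] scale_iso[OF subA]]) simp
  ultimately have memA: "memb R X (fls_module ?A)"
    using memb_cong[OF module_fls_module[OF fsub_scale[OF subA]]] by blast
  have AA: "A \<subseteq> ?A" "(*) (tpow (int d)) ` A \<subseteq> ?A"
    using fplus_superset[OF sub fsub_scale[OF sub]] by auto
  have "fls_supp {s + int d..} \<subseteq> ?A"
  proof (rule atLeast_fill[OF subA])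
    show "fls_supp {s + int d + 1..} \<subseteq> ?A"
      using AA(1) Suc.prems(3) by (auto simp: algebra_simps)
    show "tpow (int d) * g \<in> ?A" using AA(2) Suc.prems(5) by auto
    show "tpow (int d) * g \<in> fls_supp {s + int d..}" using tA Suc.prems(5) by auto
    show "(tpow (int d) * g) $$ (s + int d) \<noteq> 0" using g(2) by simp
  qed
  then show ?case using AA(1) Suc.prems(5) by (intro Suc.IH[OF subA memA _ Ad]) auto
qed

text \<open>Multiplication by t^d kills the torsion, and its image \<open>?K\<close> is a
  torsionfree object of \<open>X\<close>. A nonzero map from \<open>?K\<close> to k((t)), shifted
  into the ring, can be multiplied onto a fixed vector \<open>x0\<close> of \<open>?K\<close>: this
  is an endomorphism of rank one whose image is a copy of the fractional ideal
  \<open>?J\<close>.\<close>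

lemma memb_normalization:
  fixes M :: "('k fls, 'w) module"
  assumes M: "module R M" "memb R X M" "tor M \<noteq> carrier M"
  shows "memb R X (fls_module (fls_supp {0..}))"
proof -
  interpret M: module R M by fact
  note mult = M.smult_assoc1[unfolded R_simps]
  obtain d where d: "\<And>f. f \<in> fls_supp {int d..} \<Longrightarrow> f \<in> carrier R"
    "\<And>f x. f \<in> fls_supp {int d..} \<Longrightarrow> x \<in> tor M \<Longrightarrow> f \<odot>\<^bsub>M\<^esub> x = \<zero>\<^bsub>M\<^esub>"
    using torsion_uniform[OF M(1) memb_fin_gen[OF M(1,2)]] by blast
  let ?t = "tpow (int d) :: 'k fls"
  have tR: "?t \<in> carrier R" using d(1)[of ?t] by simp
  have tt: "?t \<odot>\<^bsub>M\<^esub> x = \<zero>\<^bsub>M\<^esub>" if "x \<in> tor M" for x using d(2)[of ?t x] that by simp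
  let ?K = "(\<lambda>x. ?t \<odot>\<^bsub>M\<^esub> x) ` carrier M"
  have K: "submodule ?K R M"
    by (rule submodule_image[OF M(1) M(1) M.mod_hom_scale[OF tR] M.carrier_is_submodule])
  have KM: "?K \<subseteq> carrier M" using K by (simp add: M.submodule_iff)
  have memK: "memb R X (M\<lparr>carrier := ?K\<rparr>)"
    by (rule memb_image[OF IKE M(1,2) M(1,2) M.mod_hom_scale[OF tR]])
  have mK: "module R (M\<lparr>carrier := ?K\<rparr>)" by (rule M.module_restrict[OF K])
  interpret K: module R "M\<lparr>carrier := ?K\<rparr>" by (rule mK)
  have tf: "r = 0 \<or> y = \<zero>\<^bsub>M\<^esub>" if r: "r \<in> carrier R" "y \<in> ?K" "r \<odot>\<^bsub>M\<^esub> y = \<zero>\<^bsub>M\<^esub>" for r y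
  proof (rule disjCI)
    assume "y \<noteq> \<zero>\<^bsub>M\<^esub>"
    show "r = 0"
    proof (rule ccontr)
      assume "r \<noteq> 0"
      obtain x where x: "x \<in> carrier M" "y = ?t \<odot>\<^bsub>M\<^esub> x" using r(2) by auto
      have "(r * ?t) \<odot>\<^bsub>M\<^esub> x = \<zero>\<^bsub>M\<^esub>" using r x tR by (simp add: mult)
      then have "x \<in> tor M"
        using x \<open>r \<noteq> 0\<close> mult_mem_R[OF r(1) tR] by (auto simp: tor_def intro!: bexI[of _ "r * ?t"])
      then show False using tt x \<open>y \<noteq> \<zero>\<^bsub>M\<^esub>\<close> by simp
    qed
  qed
  have ne: "?K \<noteq> {\<zero>\<^bsub>M\<^esub>}"
  proof -
    obtain x where x: "x \<in> carrier M" "x \<notin> tor M" using M(3) by (auto simp: tor_def)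
    then have "?t \<odot>\<^bsub>M\<^esub> x \<noteq> \<zero>\<^bsub>M\<^esub>" using tR by (auto simp: tor_def)
    then show ?thesis using x by auto
  qed
  have finK: "fin_gen R (M\<lparr>carrier := ?K\<rparr>)" by (rule memb_fin_gen[OF mK memK])
  obtain \<phi> x0 where phi: "\<phi> \<in> mod_hom R (M\<lparr>carrier := ?K\<rparr>) (fls_module UNIV)" "x0 \<in> ?K" "\<phi> x0 \<noteq> 0"
  proof (rule torsionfree_ex_hom[OF mK finK])
    show "carrier (M\<lparr>carrier := ?K\<rparr>) \<noteq> {\<zero>\<^bsub>M\<lparr>carrier := ?K\<rparr>\<^esub>}" using ne by simp
    show "r = 0 \<or> x = \<zero>\<^bsub>M\<lparr>carrier := ?K\<rparr>\<^esub>"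
      if "r \<in> carrier R" "x \<in> carrier (M\<lparr>carrier := ?K\<rparr>)" "r \<odot>\<^bsub>M\<lparr>carrier := ?K\<rparr>\<^esub> x = \<zero>\<^bsub>M\<lparr>carrier := ?K\<rparr>\<^esub>" for r x
      using tf[of r x] that by simp
  qed (use that in auto)
  have x0: "x0 \<in> carrier M" "x0 \<noteq> \<zero>\<^bsub>M\<^esub>"
    using phi KM mod_hom_zero[OF mK module_fls phi(1)] by auto
  let ?I = "\<phi> ` ?K"
  have I: "fsub ?I" using submodule_image[OF mK module_fls phi(1) K.carrier_is_submodule] by simp
  have "fin_gen R (fls_module ?I)"
    using mod_hom_corestrict[OF phi(1), of ?I]
    by (intro fin_gen_image[OF mK module_fls_module[OF I] _ _ finK]) auto
  then obtain s where s: "?I \<subseteq> fls_supp {s..}" using fin_gen_imp_bounded[OF I] by blast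
  obtain c where c: "0 \<le> c" "fls_supp {c..} \<subseteq> carrier R" by (rule conductor_bound)
  \<comment> \<open>The shift by c - s brings the image of \<open>\<phi>\<close> into t^c k[[t]],
    hence into the ring, so that its elements can act on \<open>x0\<close>.\<close>
  let ?q = "tpow (c - s) :: 'k fls"
  let ?J = "(*) ?q ` ?I"
  have J: "fsub ?J" by (rule fsub_scale[OF I])
  have Jc: "?J \<subseteq> fls_supp {c..}"
    using image_mono[OF s, of "(*) ?q"] scale_atLeast[of "c - s" s] by simp
  have JR: "?J \<subseteq> carrier R" using Jc c(2) by auto
  have hJ: "(\<lambda>r. r \<odot>\<^bsub>M\<^esub> x0) \<in> mod_hom R (fls_module ?J) (M\<lparr>carrier := ?K\<rparr>)"
  proof (rule mod_homI)
    show "r \<odot>\<^bsub>M\<^esub> x0 \<in> carrier (M\<lparr>carrier := ?K\<rparr>)" if "r \<in> carrier (fls_module ?J)" for r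
    proof -
      have "r \<in> carrier R" using subsetD[OF JR] that unfolding fls_module_simps by blast
      then show ?thesis using phi(2) K.smult_closed[of r x0] by simp
    qed
    show "(r \<oplus>\<^bsub>fls_module ?J\<^esub> r') \<odot>\<^bsub>M\<^esub> x0 = r \<odot>\<^bsub>M\<^esub> x0 \<oplus>\<^bsub>M\<lparr>carrier := ?K\<rparr>\<^esub> r' \<odot>\<^bsub>M\<^esub> x0"
      if "r \<in> carrier (fls_module ?J)" "r' \<in> carrier (fls_module ?J)" for r r'
    proof -
      have "r \<in> carrier R" "r' \<in> carrier R"
        using subsetD[OF JR] that unfolding fls_module_simps by blast+
      then show ?thesis using M.smult_l_distr[of r r' x0] x0 by simp
    qed
    show "(r \<odot>\<^bsub>fls_module ?J\<^esub> r') \<odot>\<^bsub>M\<^esub> x0 = r \<odot>\<^bsub>M\<lparr>carrier := ?K\<rparr>\<^esub> (r' \<odot>\<^bsub>M\<^esub> x0)"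
      if "r \<in> carrier R" "r' \<in> carrier (fls_module ?J)" for r r'
    proof -
      have "r' \<in> carrier R" using subsetD[OF JR] that(2) unfolding fls_module_simps by blast
      then show ?thesis using that(1) mult[of r r' x0] x0 by simp
    qed
  qed
  have hphi: "(\<lambda>x. ?q * \<phi> x) \<in> mod_hom R (M\<lparr>carrier := ?K\<rparr>) (fls_module ?J)"
    using mod_hom_add[OF phi(1)] mod_hom_smult[OF phi(1)]
    by (intro mod_homI) (auto simp: algebra_simps)
  let ?psi = "(\<lambda>r. r \<odot>\<^bsub>M\<^esub> x0) \<circ> (\<lambda>x. ?q * \<phi> x)"
  have psi: "?psi \<in> mod_hom R (M\<lparr>carrier := ?K\<rparr>) (M\<lparr>carrier := ?K\<rparr>)"
    by (rule mod_hom_comp[OF hphi hJ])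
  have im: "?psi ` ?K = (\<lambda>r. r \<odot>\<^bsub>M\<^esub> x0) ` ?J"
    by (simp add: image_image)
  have "memb R X (M\<lparr>carrier := ?psi ` ?K\<rparr>)"
    using memb_image[OF IKE mK memK mK memK psi] by simp
  then have memJ': "memb R X (M\<lparr>carrier := (\<lambda>r. r \<odot>\<^bsub>M\<^esub> x0) ` ?J\<rparr>)" unfolding im .
  \<comment> \<open>No nonzero ring element annihilates \<open>x0\<close>, as \<open>?K\<close> is
    torsionfree; hence r -> r x0 is injective on \<open>?J\<close>.\<close>
  have "r = 0" if "r \<in> ?J" "r \<odot>\<^bsub>M\<^esub> x0 = \<zero>\<^bsub>M\<^esub>" for r
    using tf[OF subsetD[OF JR that(1)] phi(2) that(2)] x0(2) by simp
  then have "inj_on (\<lambda>r. r \<odot>\<^bsub>M\<^esub> x0) (carrier (fls_module ?J))"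
    unfolding mod_hom_inj_on_iff[OF module_fls_module[OF J] mK hJ] by (simp only: fls_module_simps) simp
  then have iso: "mod_iso R (fls_module ?J) (M\<lparr>carrier := (\<lambda>r. r \<odot>\<^bsub>M\<^esub> x0) ` ?J\<rparr>)"
    using mod_iso_image[OF module_fls_module[OF J] mK hJ, of "(\<lambda>r. r \<odot>\<^bsub>M\<^esub> x0) ` ?J"] by simp
  have subJ': "submodule ((\<lambda>r. r \<odot>\<^bsub>M\<^esub> x0) ` ?J) R M"
    using submodule_image[OF module_fls_module[OF J] mK hJ module.carrier_is_submodule[OF module_fls_module[OF J]]]
      M.submodule_restrict_iff[OF K] by simp
  have memJ: "memb R X (fls_module ?J)"
    by (rule memb_cong[OF M.module_restrict[OF subJ'] mod_iso_sym[OF module_fls_module[OF J] iso] memJ'])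
  define g where "g = ?q * \<phi> x0"
  have g: "g \<in> ?J" "g \<noteq> 0" using phi by (auto simp: g_def)
  \<comment> \<open>An element of least order plays the role of \<open>g\<close> in
    \<open>memb_normalization_between\<close>. Orders in \<open>?J\<close> are at least
    \<open>c\<close>, hence nonnegative, so comparing them through \<open>nat\<close> loses
    nothing.\<close>
  define G where "G = {h \<in> ?J. h \<noteq> 0}"
  have G0: "fls_subdegree h \<ge> c" if "h \<in> G" for h
  proof -
    have "h \<in> fls_supp {c..}" "h \<noteq> 0" using that subsetD[OF Jc] unfolding G_def by blast+
    then show ?thesis by (simp add: mem_fls_supp_atLeast_iff)
  qed
  obtain h where h: "h \<in> G" "\<And>h'. h' \<in> G \<Longrightarrow> nat (fls_subdegree h) \<le> nat (fls_subdegree h')"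
  proof -
    have "g \<in> G" using g unfolding G_def by blast
    then show ?thesis
      using ex_has_least_nat[of "\<lambda>h. h \<in> G" g "\<lambda>h. nat (fls_subdegree h)"] that by blast
  qed
  let ?s = "fls_subdegree h"
  have "?J \<subseteq> fls_supp {?s..}"
  proof
    fix h' assume h': "h' \<in> ?J"
    show "h' \<in> fls_supp {?s..}"
    proof (cases "h' = 0")
      case False
      then have "h' \<in> G" using h' by (simp only: G_def) simp
      then have "?s \<le> fls_subdegree h'"
        using h(2)[of h'] G0[of h'] c(1) by (simp add: nat_le_eq_zle)
      then show ?thesis by (simp add: mem_fls_supp_atLeast_iff)
    qed simp
  qed
  moreover have "fls_supp {?s + int (nat c)..} \<subseteq> ?J"
    using contains_atLeast[OF J _ _ c(2), of h] h(1) c(1) unfolding G_def by (simp add: add.commute)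
  moreover have "h \<in> ?J" "h $$ ?s \<noteq> 0" using h(1) unfolding G_def by simp_all
  ultimately show ?thesis using memb_normalization_between[OF J memJ] by blast
qed

lemma memb_torsion_IKE:
  assumes "N \<in> X" "tor N \<noteq> {\<zero>\<^bsub>N\<^esub>}" and M: "module R M" "fin_gen R M" "tor M = carrier M"
  shows "memb R X M"
  by (rule memb_torsion[OF residue_field[OF X_fg(2)[OF assms(1)] memb_self[OF assms(1)] assms(2)] M])

lemma memb_torsionfree_IKE:
  assumes N: "N \<in> X" "tor N \<noteq> carrier N" and M: "module R M" "fin_gen R M" "tor M = {\<zero>\<^bsub>M\<^esub>}"
  shows "memb R X M"
proof (rule memb_torsionfree[OF memb_normalization[OF X_fg(2)[OF N(1)] memb_self[OF N(1)] N(2)] M(1,2)])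
  show "r = 0 \<or> x = \<zero>\<^bsub>M\<^esub>" if "r \<in> carrier R" "x \<in> carrier M" "r \<odot>\<^bsub>M\<^esub> x = \<zero>\<^bsub>M\<^esub>" for r x
    using that M(3) by (auto simp: tor_def)
qed

text \<open>Multiplication by a power t^d annihilating the torsion gives an exact sequence with
  kernel tor M and torsionfree image t^d M, and both ends belong to \<open>X\<close>.\<close>

lemma memb_all:
  fixes M :: "('k fls, 'w) module"
  assumes N: "N \<in> X" "tor N \<noteq> {\<zero>\<^bsub>N\<^esub>}" and N': "N' \<in> X" "tor N' \<noteq> carrier N'"
    and M: "module R M" "fin_gen R M"
  shows "memb R X M"
proof -
  interpret M: module R M by fact
  note mult = M.smult_assoc1[unfolded R_simps]
  obtain d where d: "\<And>f. f \<in> fls_supp {int d..} \<Longrightarrow> f \<in> carrier R"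
    "\<And>f x. f \<in> fls_supp {int d..} \<Longrightarrow> x \<in> tor M \<Longrightarrow> f \<odot>\<^bsub>M\<^esub> x = \<zero>\<^bsub>M\<^esub>"
    using torsion_uniform[OF M] by blast
  let ?t = "tpow (int d) :: 'k fls"
  let ?f = "\<lambda>x. ?t \<odot>\<^bsub>M\<^esub> x"
  have tR: "?t \<in> carrier R" using d(1)[of ?t] by simp
  have tt: "?t \<odot>\<^bsub>M\<^esub> x = \<zero>\<^bsub>M\<^esub>" if "x \<in> tor M" for x using d(2)[of ?t x] that by simp
  note f = M.mod_hom_scale[OF tR]
  have K: "submodule (?f ` carrier M) R M"
    by (rule submodule_image[OF M(1) M(1) f M.carrier_is_submodule])
  have T: "submodule (tor M) R M" by (rule submodule_tor[OF M(1)])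
  have TM: "tor M \<subseteq> carrier M" by (auto simp: tor_def)
  have "tor M \<inter> ?f ` carrier M = {\<zero>\<^bsub>M\<^esub>}"
  proof -
    have "?f x = \<zero>\<^bsub>M\<^esub>" if x: "x \<in> carrier M" "?f x \<in> tor M" for x
    proof -
      obtain r where r: "r \<in> carrier R" "r \<noteq> 0" "r \<odot>\<^bsub>M\<^esub> ?f x = \<zero>\<^bsub>M\<^esub>"
        using x(2) by (auto simp: tor_def)
      then have "(r * ?t) \<odot>\<^bsub>M\<^esub> x = \<zero>\<^bsub>M\<^esub>" using x tR by (simp add: mult)
      then have "x \<in> tor M"
        using x r mult_mem_R[OF r(1) tR] by (auto simp: tor_def intro!: bexI[of _ "r * ?t"])
      then show ?thesis by (rule tt)
    qed
    then show ?thesis using M.submodule_zero[OF T] M.submodule_zero[OF K] by auto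
  qed
  then have "tor (M\<lparr>carrier := ?f ` carrier M\<rparr>) = {\<zero>\<^bsub>M\<^esub>}"
    using tor_restrict[of "?f ` carrier M" M] K by (simp add: M.submodule_iff)
  then have im: "memb R X (M\<lparr>carrier := ?f ` carrier M\<rparr>)"
    by (intro memb_torsionfree_IKE[OF N'] M.module_restrict[OF K] fin_gen_submodule[OF M K]) simp
  have "{x \<in> carrier M. ?f x = \<zero>\<^bsub>M\<^esub>} = tor M"
    using tt tR by (auto intro: torI[of _ _ ?t] dest: tor_carrier)
  moreover have "memb R X (M\<lparr>carrier := tor M\<rparr>)"
    using tor_restrict[OF TM]
    by (intro memb_torsion_IKE[OF N] M.module_restrict[OF T] fin_gen_submodule[OF M T]) simp
  ultimately show ?thesis
    by (intro memb_extension[OF ext M(1) M.module_restrict[OF K] mod_hom_corestrict[OF f] _ _ im]) auto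
qed

text \<open>Two questions decide: does \<open>X\<close> contain a module with nonzero torsion, and
  does it contain one that is not torsion? If neither occurs, every object equals its torsion
  submodule, which is zero.\<close>

lemma IKE_classification: "X \<in> {zero_mod R, fl_mod R, tf_mod R, fg_mod R}"
proof -
  have Xfg: "X \<subseteq> fg_mod R" using X_fg(1) by blast
  have in_X: "M \<in> X" if "M \<in> fg_mod R" "module R M \<Longrightarrow> fin_gen R M \<Longrightarrow> memb R X M" for M
    using that memb_iff by (auto simp: fg_mod_def)
  consider "\<forall>N\<in>X. tor N = {\<zero>\<^bsub>N\<^esub>}" "\<forall>N\<in>X. tor N = carrier N"
    | N where "N \<in> X" "tor N \<noteq> {\<zero>\<^bsub>N\<^esub>}" "\<forall>N\<in>X. tor N = carrier N"
    | N where "N \<in> X" "tor N \<noteq> carrier N" "\<forall>N\<in>X. tor N = {\<zero>\<^bsub>N\<^esub>}"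
    | N N' where "N \<in> X" "tor N \<noteq> {\<zero>\<^bsub>N\<^esub>}" "N' \<in> X" "tor N' \<noteq> carrier N'"
    by blast
  then show ?thesis
  proof cases
    case 1
    have "zero_mod R \<subseteq> X" using in_X memb_zero by (auto simp: zero_mod_def)
    moreover have "X \<subseteq> zero_mod R" using 1 Xfg by (auto simp: zero_mod_def)
    ultimately show ?thesis by auto
  next
    case 2
    have "fl_mod R \<subseteq> X" using in_X memb_torsion_IKE[OF 2(1,2)] by (auto simp: fl_mod_eq)
    moreover have "X \<subseteq> fl_mod R" using 2(3) Xfg by (auto simp: fl_mod_eq)
    ultimately show ?thesis by auto
  next
    case 3
    have "tf_mod R \<subseteq> X" using in_X memb_torsionfree_IKE[OF 3(1,2)] by (auto simp: tf_mod_eq)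
    moreover have "X \<subseteq> tf_mod R" using 3(3) Xfg by (auto simp: tf_mod_eq)
    ultimately show ?thesis by auto
  next
    case 4
    have "fg_mod R \<subseteq> X" using in_X memb_all[OF 4] by auto
    then show ?thesis using Xfg by auto
  qed
qed

end

section \<open>The classes of torsion and of torsionfree modules\<close>

text \<open>Images and kernels are submodules of objects of \<open>X\<close>. The converse half of
  the classification thus reduces to closure under submodules and extensions, which is the
  torsionfree property claimed at the end.\<close>

lemma closed_submodules_imp_IKE_closed:
  assumes "X \<subseteq> fg_mod R" "closed_submodules R X" "closed_extensions R X"
  shows "IKE_closed R X"
  unfolding IKE_closed_def
proof (intro conjI ballI)
  fix M N f assume *: "M \<in> X" "N \<in> X" "f \<in> mod_hom R M N"
  then have M: "module R M" and N: "module R N" using assms(1) by (auto simp: fg_mod_def)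
  show "mod_image N f M \<in> X"
    using submodule_image[OF M N *(3) module.carrier_is_submodule[OF M]] assms(2) *(2)
    by (simp add: mod_image_def closed_submodules_def)
  show "mod_kernel N f M \<in> X"
    using submodule_kernel[OF M N *(3)] assms(2) *(1)
    by (simp add: mod_kernel_def closed_submodules_def)
qed fact

lemma short_exactD:
  assumes "short_exact R L f M g N"
  shows "f \<in> mod_hom R L M" "g \<in> mod_hom R M N" "inj_on f (carrier L)" "g ` carrier M = carrier N"
    "\<And>x. x \<in> carrier M \<Longrightarrow> g x = \<zero>\<^bsub>N\<^esub> \<Longrightarrow> \<exists>l\<in>carrier L. x = f l"
  using assms by (auto simp: short_exact_def)

lemma ext_closure_eqI:
  assumes "strict_full_subcat R C" "{N \<in> fg_mod R. mod_iso R M N} \<subseteq> C"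
    "closed_summands R C" "closed_extensions R C"
    and "\<And>X. strict_full_subcat R X \<Longrightarrow> {N \<in> fg_mod R. mod_iso R M N} \<subseteq> X \<Longrightarrow>
      closed_summands R X \<Longrightarrow> closed_extensions R X \<Longrightarrow> C \<subseteq> X"
  shows "ext_closure R M = C"
  unfolding ext_closure_def using assms by blast

section \<open>Closure properties of the four classes of modules\<close>

context numerical_semigroup_ring
begin

lemma tor_hom:
  assumes "module R M" "module R N" "f \<in> mod_hom R M N" "x \<in> tor M"
  shows "f x \<in> tor N"
proof -
  obtain r where r: "r \<in> carrier R" "r \<noteq> 0" "r \<odot>\<^bsub>M\<^esub> x = \<zero>\<^bsub>M\<^esub>" "x \<in> carrier M"
    using assms(4) by (auto simp: tor_def)
  have "r \<odot>\<^bsub>N\<^esub> f x = \<zero>\<^bsub>N\<^esub>"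
    using mod_hom_smult[OF assms(3) r(1,4)] mod_hom_zero[OF assms(1-3)] r(3) by simp
  then show ?thesis using r mod_hom_closed[OF assms(3)] by (auto simp: tor_def)
qed

lemma tor_kernel:
  assumes "module R M" "module R N" "f \<in> mod_hom R M N" "x \<in> carrier M" "f x \<in> tor N"
    and ker: "\<And>y. y \<in> carrier M \<Longrightarrow> f y = \<zero>\<^bsub>N\<^esub> \<Longrightarrow> y \<in> tor M"
  shows "x \<in> tor M"
proof -
  interpret M: module R M by fact
  obtain r where r: "r \<in> carrier R" "r \<noteq> 0" "r \<odot>\<^bsub>N\<^esub> f x = \<zero>\<^bsub>N\<^esub>"
    using assms(5) by (auto simp: tor_def)
  then have "r \<odot>\<^bsub>M\<^esub> x \<in> tor M"
    using assms(4) by (intro ker) (simp_all add: mod_hom_smult[OF assms(3)])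
  then obtain s where s: "s \<in> carrier R" "s \<noteq> 0" "s \<odot>\<^bsub>M\<^esub> (r \<odot>\<^bsub>M\<^esub> x) = \<zero>\<^bsub>M\<^esub>"
    by (auto simp: tor_def)
  then have "(s * r) \<odot>\<^bsub>M\<^esub> x = \<zero>\<^bsub>M\<^esub>" using M.smult_assoc1[of s r x] r assms(4) by simp
  then show ?thesis using torI[OF assms(4) mult_mem_R[OF s(1) r(1)]] s r by simp
qed

lemma fg_modD: "M \<in> fg_mod R \<Longrightarrow> module R M" "M \<in> fg_mod R \<Longrightarrow> fin_gen R M"
  by (auto simp: fg_mod_def)

lemma fg_mod_submodule:
  assumes "M \<in> fg_mod R" "submodule N R M" shows "M\<lparr>carrier := N\<rparr> \<in> fg_mod R"
  using fin_gen_submodule[OF fg_modD[OF assms(1)] assms(2)]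
    module.module_restrict[OF fg_modD(1)[OF assms(1)] assms(2)] by (simp add: fg_mod_def)

lemma tor_zero: "module R M \<Longrightarrow> \<zero>\<^bsub>M\<^esub> \<in> tor M"
  by (rule module.submodule_zero[OF _ submodule_tor])

lemma ex_zero_mod: obtains Z :: "('k fls, 'v) module" where "Z \<in> zero_mod R"
proof -
  have sub: "fsub {0}" by (simp add: fsub_iff)
  have Z: "module R (fls_module {0})" by (rule module_fls_module[OF sub])
  obtain N :: "('k fls, 'v) module" where N: "N \<in> fg_mod R" "module R N" "mod_iso R (fls_module {0}) N"
    using ex_copy[OF Z fin_gen_zero[OF Z]] by auto
  then have "N \<in> zero_mod R" using mod_iso_carrier_zero[OF Z N(2,3)] by (simp add: zero_mod_def)
  then show ?thesis using that by blast
qed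

lemma zero_mod_subset: "zero_mod R \<subseteq> fl_mod R" "zero_mod R \<subseteq> tf_mod R"
proof -
  have "tor M = {\<zero>\<^bsub>M\<^esub>} \<and> tor M = carrier M" if "M \<in> zero_mod R" for M :: "('k fls, 'w) module"
  proof -
    have "M \<in> fg_mod R" "carrier M = {\<zero>\<^bsub>M\<^esub>}" using that by (auto simp: zero_mod_def)
    then show ?thesis using tor_zero[OF fg_modD(1), of M] by (auto dest: tor_carrier)
  qed
  then show "(zero_mod R :: ('k fls, 'w) module set) \<subseteq> fl_mod R"
    "(zero_mod R :: ('k fls, 'w) module set) \<subseteq> tf_mod R"
    by (auto simp: fl_mod_eq tf_mod_eq zero_mod_def)
qed

lemma strict_full_fl_mod: "strict_full_subcat R (fl_mod R :: ('k fls, 'v) module set)"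
  unfolding strict_full_subcat_def
proof (intro conjI ballI impI)
  fix M N :: "('k fls, 'v) module"
  assume *: "M \<in> fl_mod R" "N \<in> fg_mod R" "mod_iso R M N"
  then obtain f where f: "f \<in> mod_hom R M N" "f ` carrier M = carrier N"
    by (auto simp: mod_iso_def bij_betw_def)
  then have "carrier N \<subseteq> tor N"
    using *(1) tor_hom[OF _ fg_modD(1)[OF *(2)] f(1)] by (force simp: fl_mod_eq fg_mod_def)
  then show "N \<in> fl_mod R" using *(2) by (auto simp: fl_mod_eq dest: tor_carrier)
next
  show "(fl_mod R :: ('k fls, 'v) module set) \<noteq> {}" using ex_zero_mod zero_mod_subset by blast
qed (auto simp: fl_mod_eq)

lemma closed_submodules_fl_mod: "closed_submodules R (fl_mod R :: ('k fls, 'v) module set)"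
  unfolding closed_submodules_def
proof (intro ballI allI impI)
  fix M :: "('k fls, 'v) module" and N assume M: "M \<in> fl_mod R" and N: "submodule N R M"
  have fg: "M \<in> fg_mod R" and t: "tor M = carrier M" using M by (auto simp: fl_mod_eq)
  have "N \<subseteq> carrier M" by (rule module.submoduleE(1)[OF fg_modD(1)[OF fg] N])
  then show "M\<lparr>carrier := N\<rparr> \<in> fl_mod R"
    using fg_mod_submodule[OF fg N] t tor_restrict[of N M] by (auto simp: fl_mod_eq)
qed

lemma closed_extensions_fl_mod: "closed_extensions R (fl_mod R :: ('k fls, 'v) module set)"
  unfolding closed_extensions_def
proof (intro ballI allI impI)
  fix L N M :: "('k fls, 'v) module" and f g
  assume L: "L \<in> fl_mod R" and N: "N \<in> fl_mod R" and M: "M \<in> fg_mod R" and se: "short_exact R L f M g N"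
  note se = short_exactD[OF se]
  have mL: "module R L" and mN: "module R N" using L N by (auto simp: fl_mod_eq fg_mod_def)
  note mM = fg_modD(1)[OF M]
  have "x \<in> tor M" if x: "x \<in> carrier M" for x
  proof (rule tor_kernel[OF mM mN se(2) x])
    show "g x \<in> tor N" using mod_hom_closed[OF se(2) x] N by (simp add: fl_mod_eq)
    show "y \<in> tor M" if "y \<in> carrier M" "g y = \<zero>\<^bsub>N\<^esub>" for y
      using se(5)[OF that] tor_hom[OF mL mM se(1)] L by (auto simp: fl_mod_eq)
  qed
  then show "M \<in> fl_mod R" using M by (auto simp: fl_mod_eq dest: tor_carrier)
qed

lemma closed_summands_fl_mod: "closed_summands R (fl_mod R :: ('k fls, 'v) module set)"
  unfolding closed_summands_def
proof (intro ballI impI)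
  fix M A B :: "('k fls, 'v) module"
  assume M: "M \<in> fl_mod R" and A: "A \<in> fg_mod R" and B: "B \<in> fg_mod R" and iso: "mod_iso R M (mod_sum A B)"
  note mA = fg_modD(1)[OF A] and mB = fg_modD(1)[OF B]
  have mM: "module R M" using M by (auto simp: fl_mod_eq fg_mod_def)
  obtain f where f: "f \<in> mod_hom R M (mod_sum A B)" "f ` carrier M = carrier A \<times> carrier B"
    using iso by (auto simp: mod_iso_def bij_betw_def)
  have "x \<in> tor A" if x: "x \<in> carrier A" for x
  proof -
    have "(x, \<zero>\<^bsub>B\<^esub>) \<in> f ` carrier M"
      using x module.submodule_zero[OF mB module.carrier_is_submodule[OF mB]] by (simp add: f(2))
    then obtain y where "y \<in> carrier M" "f y = (x, \<zero>\<^bsub>B\<^esub>)" by auto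
    then show ?thesis
      using tor_hom[OF mM mA mod_hom_comp[OF f(1) mod_hom_fst], of y] M by (simp add: fl_mod_eq)
  qed
  then show "A \<in> fl_mod R" using A by (auto simp: fl_mod_eq dest: tor_carrier)
qed

lemma tf_modI:
  assumes "M \<in> fg_mod R" "\<And>x. x \<in> tor M \<Longrightarrow> x = \<zero>\<^bsub>M\<^esub>" shows "M \<in> tf_mod R"
proof -
  have "tor M = {\<zero>\<^bsub>M\<^esub>}"
    using tor_zero[OF fg_modD(1)[OF assms(1)]] by (intro equalityI subsetI) (auto dest: assms(2))
  then show ?thesis using assms(1) by (simp add: tf_mod_eq)
qed

lemma strict_full_tf_mod: "strict_full_subcat R (tf_mod R :: ('k fls, 'v) module set)"
  unfolding strict_full_subcat_def
proof (intro conjI ballI impI)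
  fix M N :: "('k fls, 'v) module"
  assume M: "M \<in> tf_mod R" and N: "N \<in> fg_mod R" and iso: "mod_iso R M N"
  have mM: "module R M" and t: "tor M = {\<zero>\<^bsub>M\<^esub>}" using M by (auto simp: tf_mod_eq fg_mod_def)
  note mN = fg_modD(1)[OF N]
  obtain f where f: "f \<in> mod_hom R N M" "inj_on f (carrier N)"
    using mod_iso_sym[OF mM iso] by (auto simp: mod_iso_def bij_betw_def)
  show "N \<in> tf_mod R"
  proof (rule tf_modI[OF N])
    fix x assume x: "x \<in> tor N"
    then have "f x = \<zero>\<^bsub>M\<^esub>" using tor_hom[OF mN mM f(1) x] t by auto
    then show "x = \<zero>\<^bsub>N\<^esub>"
      using f(2) tor_carrier[OF x] mod_hom_inj_on_iff[OF mN mM f(1)] by auto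
  qed
next
  show "(tf_mod R :: ('k fls, 'v) module set) \<noteq> {}" using ex_zero_mod zero_mod_subset by blast
qed (auto simp: tf_mod_eq)

lemma closed_submodules_tf_mod: "closed_submodules R (tf_mod R :: ('k fls, 'v) module set)"
  unfolding closed_submodules_def
proof (intro ballI allI impI)
  fix M :: "('k fls, 'v) module" and N assume M: "M \<in> tf_mod R" and N: "submodule N R M"
  have fg: "M \<in> fg_mod R" and t: "tor M = {\<zero>\<^bsub>M\<^esub>}" using M by (auto simp: tf_mod_eq)
  have "N \<subseteq> carrier M" by (rule module.submoduleE(1)[OF fg_modD(1)[OF fg] N])
  then show "M\<lparr>carrier := N\<rparr> \<in> tf_mod R"
    using t tor_restrict[of N M] by (intro tf_modI fg_mod_submodule[OF fg N]) auto
qed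

lemma closed_extensions_tf_mod: "closed_extensions R (tf_mod R :: ('k fls, 'v) module set)"
  unfolding closed_extensions_def
proof (intro ballI allI impI)
  fix L N M :: "('k fls, 'v) module" and f g
  assume L: "L \<in> tf_mod R" and N: "N \<in> tf_mod R" and M: "M \<in> fg_mod R" and se: "short_exact R L f M g N"
  note se = short_exactD[OF se]
  have mL: "module R L" and mN: "module R N" using L N by (auto simp: tf_mod_eq fg_mod_def)
  note mM = fg_modD(1)[OF M]
  show "M \<in> tf_mod R"
  proof (rule tf_modI[OF M])
    fix x assume x: "x \<in> tor M"
    then have "g x = \<zero>\<^bsub>N\<^esub>" using tor_hom[OF mM mN se(2) x] N by (auto simp: tf_mod_eq)
    then obtain l where l: "l \<in> carrier L" "x = f l" using se(5) tor_carrier[OF x] by blast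
    have "l \<in> tor L"
    proof (rule tor_kernel[OF mL mM se(1) l(1)])
      show "f l \<in> tor M" using x l by simp
      show "y \<in> tor L" if "y \<in> carrier L" "f y = \<zero>\<^bsub>M\<^esub>" for y
        using that se(3) mod_hom_inj_on_iff[OF mL mM se(1)] tor_zero[OF mL] by auto
    qed
    then have "l = \<zero>\<^bsub>L\<^esub>" using L by (auto simp: tf_mod_eq)
    then show "x = \<zero>\<^bsub>M\<^esub>" using l(2) mod_hom_zero[OF mL mM se(1)] by simp
  qed
qed

lemma closed_summands_tf_mod: "closed_summands R (tf_mod R :: ('k fls, 'v) module set)"
  unfolding closed_summands_def
proof (intro ballI impI)
  fix M A B :: "('k fls, 'v) module"
  assume M: "M \<in> tf_mod R" and A: "A \<in> fg_mod R" and B: "B \<in> fg_mod R" and iso: "mod_iso R M (mod_sum A B)"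
  note mA = fg_modD(1)[OF A] and mB = fg_modD(1)[OF B]
  interpret B: module R B by fact
  have mM: "module R M" and t: "tor M = {\<zero>\<^bsub>M\<^esub>}" using M by (auto simp: tf_mod_eq fg_mod_def)
  have mS: "module R (mod_sum A B)" by (rule module_sum[OF mA mB])
  obtain f where f: "f \<in> mod_hom R (mod_sum A B) M" "inj_on f (carrier (mod_sum A B))"
    using mod_iso_sym[OF mM iso] by (auto simp: mod_iso_def bij_betw_def)
  show "A \<in> tf_mod R"
  proof (rule tf_modI[OF A])
    fix x assume x: "x \<in> tor A"
    have "(\<lambda>x. (x, \<zero>\<^bsub>B\<^esub>)) \<in> mod_hom R A (mod_sum A B)" by (rule mod_homI) auto
    then have "(x, \<zero>\<^bsub>B\<^esub>) \<in> tor (mod_sum A B)" using tor_hom[OF mA mS _ x] by blast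
    then have "f (x, \<zero>\<^bsub>B\<^esub>) = \<zero>\<^bsub>M\<^esub>" using tor_hom[OF mS mM f(1)] t by blast
    then show "x = \<zero>\<^bsub>A\<^esub>"
      using f(2) tor_carrier[OF x] unfolding mod_hom_inj_on_iff[OF mS mM f(1)] by auto
  qed
qed

lemma strict_full_zero_mod: "strict_full_subcat R (zero_mod R :: ('k fls, 'v) module set)"
  unfolding strict_full_subcat_def
proof (intro conjI ballI impI)
  show "(zero_mod R :: ('k fls, 'v) module set) \<noteq> {}" using ex_zero_mod by blast
  fix M N :: "('k fls, 'v) module"
  assume "M \<in> zero_mod R" "N \<in> fg_mod R" "mod_iso R M N"
  then show "N \<in> zero_mod R"
    using mod_iso_carrier_zero[of R M N] by (simp add: zero_mod_def fg_mod_def)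
qed (auto simp: zero_mod_def)

lemma closed_submodules_zero_mod: "closed_submodules R (zero_mod R :: ('k fls, 'v) module set)"
  unfolding closed_submodules_def
proof (intro ballI allI impI)
  fix M :: "('k fls, 'v) module" and N assume M: "M \<in> zero_mod R" and N: "submodule N R M"
  have fg: "M \<in> fg_mod R" and z: "carrier M = {\<zero>\<^bsub>M\<^esub>}" using M by (auto simp: zero_mod_def)
  have "N \<subseteq> carrier M" "\<zero>\<^bsub>M\<^esub> \<in> N"
    using module.submoduleE(1)[OF fg_modD(1)[OF fg] N] module.submodule_zero[OF fg_modD(1)[OF fg] N] .
  then show "M\<lparr>carrier := N\<rparr> \<in> zero_mod R"
    using fg_mod_submodule[OF fg N] z by (auto simp: zero_mod_def)
qed

lemma closed_extensions_zero_mod: "closed_extensions R (zero_mod R :: ('k fls, 'v) module set)"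
  unfolding closed_extensions_def
proof (intro ballI allI impI)
  fix L N M :: "('k fls, 'v) module" and f g
  assume L: "L \<in> zero_mod R" and N: "N \<in> zero_mod R" and M: "M \<in> fg_mod R" and se: "short_exact R L f M g N"
  note se = short_exactD[OF se]
  have mL: "module R L" and z: "carrier L = {\<zero>\<^bsub>L\<^esub>}" "carrier N = {\<zero>\<^bsub>N\<^esub>}"
    using L N by (auto simp: zero_mod_def fg_mod_def)
  interpret M: module R M by (rule fg_modD(1)[OF M])
  have "x = \<zero>\<^bsub>M\<^esub>" if x: "x \<in> carrier M" for x
    using se(5)[OF x] mod_hom_closed[OF se(2) x] z mod_hom_zero[OF mL M.module_axioms se(1)] by auto
  then show "M \<in> zero_mod R" using M by (auto simp: zero_mod_def)
qed

lemma strict_full_fg_mod: "strict_full_subcat R (fg_mod R :: ('k fls, 'v) module set)"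
proof -
  have "(zero_mod R :: ('k fls, 'v) module set) \<subseteq> fg_mod R" by (auto simp: zero_mod_def)
  then show ?thesis using ex_zero_mod by (auto simp: strict_full_subcat_def)
qed

lemma torsionfree_subcat_four:
  assumes "X \<in> {zero_mod R, fl_mod R, tf_mod R, fg_mod R :: ('k fls, 'v) module set}"
  shows "strict_full_subcat R X" "torsionfree_subcat R X"
proof -
  have "closed_submodules R (fg_mod R :: ('k fls, 'v) module set)"
    "closed_extensions R (fg_mod R :: ('k fls, 'v) module set)"
    using fg_mod_submodule by (auto simp: closed_submodules_def closed_extensions_def)
  then show "strict_full_subcat R X" "torsionfree_subcat R X"
    using assms strict_full_fl_mod strict_full_tf_mod strict_full_zero_mod strict_full_fg_mod
      closed_submodules_fl_mod closed_submodules_tf_mod closed_submodules_zero_mod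
      closed_extensions_fl_mod closed_extensions_tf_mod closed_extensions_zero_mod
    by (auto simp: torsionfree_subcat_def)
qed

lemma IKE_closed_iff:
  "strict_full_subcat R X \<and> IKE_closed R X \<longleftrightarrow>
    X \<in> {zero_mod R, fl_mod R, tf_mod R, fg_mod R :: ('k fls, 'v) module set}"
proof
  assume "strict_full_subcat R X \<and> IKE_closed R X"
  then interpret semigroup_ring_IKE H R \<iota> X by unfold_locales auto
  show "X \<in> {zero_mod R, fl_mod R, tf_mod R, fg_mod R}" by (rule IKE_classification)
next
  assume X: "X \<in> {zero_mod R, fl_mod R, tf_mod R, fg_mod R :: ('k fls, 'v) module set}"
  have "X \<subseteq> fg_mod R" using torsionfree_subcat_four(1)[OF X] by (simp add: strict_full_subcat_def)
  then show "strict_full_subcat R X \<and> IKE_closed R X"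
    using torsionfree_subcat_four[OF X] closed_submodules_imp_IKE_closed[of X R]
    by (simp add: torsionfree_subcat_def)
qed

section \<open>The conductor\<close>

text \<open>For \<open>x\<close> of negative order, x^n has strictly smaller order than all other
  terms of a monic equation of degree \<open>n\<close>, so the terms cannot cancel.\<close>

lemma integral_closure_bound: "integral_closure_in R \<subseteq> fls_supp {0..}"
proof
  fix x assume "x \<in> integral_closure_in R"
  then obtain n :: nat and c where c: "\<And>i. i < n \<Longrightarrow> c i \<in> carrier R"
    and eq: "x ^ n + (\<Sum>i<n. c i * x ^ i) = 0"
    unfolding integral_closure_in_def by auto
  show "x \<in> fls_supp {0..}"
  proof (rule ccontr)
    assume "x \<notin> fls_supp {0..}"
    then have x: "x \<noteq> 0" "fls_subdegree x < 0" by (auto simp: mem_fls_supp_atLeast_iff)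
    let ?d = "fls_subdegree x"
    have "c i * x ^ i \<in> fls_supp {int n * ?d + 1..}" if i: "i < n" for i
    proof -
      have "c i \<in> fls_supp {0..}" using c[OF i] carrier_R_bound by blast
      moreover have "x ^ i \<in> fls_supp {int i * ?d..}"
        using x by (simp add: mem_fls_supp_atLeast_iff fls_subdegree_pow)
      moreover have "int n * ?d < int i * ?d" using i x(2) by (intro mult_strict_right_mono_neg) auto
      ultimately show ?thesis by (intro mult_mem_fls_supp) auto
    qed
    then have "(\<Sum>i<n. c i * x ^ i) \<in> fls_supp {int n * ?d + 1..}"
      by (intro fsub_sum) auto
    moreover have "x ^ n = - (\<Sum>i<n. c i * x ^ i)" using eq by (simp add: eq_neg_iff_add_eq_0)
    ultimately have "x ^ n \<in> fls_supp {int n * ?d + 1..}" using uminus_mem_fls_supp by metis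
    then show False using x by (simp add: mem_fls_supp_atLeast_iff fls_subdegree_pow)
  qed
qed

lemma fraction_field_R: "fraction_field_in R = UNIV"
proof -
  obtain c where c: "0 \<le> c" "fls_supp {c..} \<subseteq> carrier R" by (rule conductor_bound)
  have "f \<in> fraction_field_in R" for f :: "'k fls"
  proof -
    \<comment> \<open>The absolute value compensates a possible pole of \<open>f\<close> and keeps
      the order of \<open>?q\<close> at least \<open>c\<close>, so that numerator and denominator
      both lie in the ring.\<close>
    let ?q = "tpow (c + \<bar>fls_subdegree f\<bar>) :: 'k fls"
    have "?q \<in> fls_supp {c + \<bar>fls_subdegree f\<bar>..}" by simp
    moreover have "f \<in> fls_supp {fls_subdegree f..}" by (simp add: mem_fls_supp_atLeast_iff)
    ultimately have "?q * f \<in> fls_supp {c..}" by (rule mult_mem_fls_supp) auto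
    then have 1: "?q * f \<in> carrier R" using c(2) by auto
    have 2: "?q \<in> carrier R" using subsetD[OF c(2), of ?q] by simp
    have "f = (?q * f) / ?q" by simp
    then show ?thesis unfolding fraction_field_in_def using 1 2 tpow_nonzero by blast
  qed
  then show ?thesis by auto
qed

text \<open>t^j is a root of the monic polynomial X^(c+1) - t^((c+1) j). Its constant term lies in
  the ring, since (c+1) j is at least \<open>c\<close> for j > 0 and is 0 for j = 0.\<close>

lemma tpow_integral: "tpow (int j) \<in> integral_closure_in R"
proof -
  obtain c where c: "\<forall>n\<ge>c. n \<in> H" using H_cofinite by blast
  have mem: "tpow (int (Suc c) * int j) \<in> carrier R"
  proof (cases "j = 0")
    case False
    then have "Suc c * j \<in> H" using c by (simp add: trans_le_add2)
    then show ?thesis unfolding carrier_R tpow_mem_fls_supp of_nat_mult[symmetric] by blast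
  qed (simp add: one_mem_R)
  define d where "d i = (if i = 0 then - tpow (int (Suc c) * int j) else 0 :: 'k fls)" for i :: nat
  have "d i \<in> carrier R" for i
    using mem fsub_uminus[OF fsub_R] fsub_zero[OF fsub_R] by (simp add: d_def)
  moreover have "tpow (int j) ^ Suc c + (\<Sum>i<Suc c. d i * tpow (int j) ^ i) = 0"
    unfolding sum.lessThan_Suc_shift by (simp add: d_def tpow_power del: power_Suc)
  ultimately show ?thesis
    unfolding integral_closure_in_def fraction_field_R by blast
qed

text \<open>Two bounds on the integral closure suffice: it contains every t^j and lies in k[[t]].
  Multiplying \<open>x\<close> by all t^j shows that each exponent of \<open>x\<close>, together
  with all larger integers, belongs to \<open>H\<close>, so the exponent is at least the minimal
  \<open>c\<close>.\<close>

lemma conductor_eq: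
  obtains c :: nat where "conductor R = fls_supp {int c..}" "\<And>n. c \<le> n \<Longrightarrow> n \<in> H"
    "\<And>c'. (\<And>n. c' \<le> n \<Longrightarrow> n \<in> H) \<Longrightarrow> c \<le> c'"
proof -
  define c where "c = (LEAST c. \<forall>n\<ge>c. n \<in> H)"
  have c: "\<forall>n\<ge>c. n \<in> H" unfolding c_def using LeastI_ex[OF H_cofinite] .
  have least: "c \<le> c'" if "\<And>n. c' \<le> n \<Longrightarrow> n \<in> H" for c'
    unfolding c_def using that by (intro Least_le) blast
  have cR: "fls_supp {int c..} \<subseteq> carrier R"
    unfolding carrier_R using c by (intro fls_supp_mono) (auto intro!: rev_image_eqI[of "nat _"])
  have "conductor R = fls_supp {int c..}"
  proof (intro equalityI subsetI)
    fix x assume "x \<in> conductor R"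
    then have x: "x * s \<in> carrier R" if "s \<in> integral_closure_in R" for s
      using that by (auto simp: conductor_def)
    show "x \<in> fls_supp {int c..}"
    proof (rule fls_suppI)
      fix n assume n: "x $$ n \<noteq> 0"
      have *: "n + int j \<in> int ` H" for j
      proof -
        have "tpow (int j) * x \<in> fls_supp (int ` H)"
          using x[OF tpow_integral[of j]] by (simp add: carrier_R mult.commute)
        moreover have "(tpow (int j) * x) $$ (n + int j) \<noteq> 0" using n by simp
        ultimately show ?thesis unfolding fls_supp_def by blast
      qed
      have n0: "0 \<le> n" using *[of 0] by auto
      have "c \<le> nat n"
      proof (rule least)
        fix m assume "nat n \<le> m"
        then have "n + int (m - nat n) = int m" using n0 by auto
        with *[of "m - nat n"] have "int m \<in> int ` H" by (simp only:)
        then show "m \<in> H" by auto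
      qed
      then show "n \<in> {int c..}" using n0 by auto
    qed
  next
    fix x :: "'k fls" assume x: "x \<in> fls_supp {int c..}"
    have "x * s \<in> carrier R" if "s \<in> integral_closure_in R" for s
    proof -
      have "s \<in> fls_supp {0..}" using that integral_closure_bound by blast
      with x have "x * s \<in> fls_supp {int c..}" by (rule mult_mem_fls_supp) auto
      then show ?thesis using cR by blast
    qed
    then show "x \<in> conductor R" by (simp add: conductor_def fraction_field_R)
  qed
  then show ?thesis using that c least by blast
qed

lemma ext_closure_conductor:
  "(ext_closure R (ideal_module R (conductor R)) :: ('k fls, 'v) module set) = tf_mod R"
proof -
  obtain c where c: "conductor R = fls_supp {int c..}" by (rule conductor_eq)
  let ?C = "fls_module (fls_supp {int c..})"
  have mC: "module R ?C" by (rule module_fls_module) simp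
  have tC: "tor ?C = {0}" by (auto simp: tor_def intro: bexI[OF _ one_mem_R])
  show ?thesis
  proof (rule ext_closure_eqI[OF strict_full_tf_mod _ closed_summands_tf_mod closed_extensions_tf_mod])
    show "{N \<in> fg_mod R. mod_iso R (ideal_module R (conductor R)) N} \<subseteq> (tf_mod R :: ('k fls, 'v) module set)"
      unfolding c
    proof clarify
      fix N :: "('k fls, 'v) module" assume N: "N \<in> fg_mod R" and iso: "mod_iso R ?C N"
      note mN = fg_modD(1)[OF N]
      obtain f where f: "f \<in> mod_hom R N ?C" "inj_on f (carrier N)"
        using mod_iso_sym[OF mC iso] by (auto simp: mod_iso_def bij_betw_def)
      show "N \<in> tf_mod R"
      proof (rule tf_modI[OF N])
        fix x assume x: "x \<in> tor N"
        then have "f x = 0" using tor_hom[OF mN mC f(1) x] tC by auto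
        then show "x = \<zero>\<^bsub>N\<^esub>"
          using f(2) tor_carrier[OF x] mod_hom_inj_on_iff[OF mN mC f(1)] by auto
      qed
    qed
  next
    fix X :: "('k fls, 'v) module set"
    assume prem: "strict_full_subcat R X" "{N \<in> fg_mod R. mod_iso R (ideal_module R (conductor R)) N} \<subseteq> X"
      "closed_summands R X" "closed_extensions R X"
    interpret semigroup_ring_ext_subcat H R \<iota> X by unfold_locales (use prem in auto)
    obtain N :: "('k fls, 'v) module" where "N \<in> fg_mod R" "mod_iso R ?C N"
      using ex_copy[OF mC fin_gen_atLeast] by blast
    then have "memb R X ?C" using prem(2) unfolding c memb_def by blast
    then have S: "memb R X (fls_module (fls_supp {0..}))"
      using memb_cong[OF mC scale_iso[of "fls_supp {int c..}" "tpow (- int c)"]]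
        scale_atLeast[of "- int c" "int c"] by simp
    show "tf_mod R \<subseteq> X"
    proof
      fix M :: "('k fls, 'v) module" assume M: "M \<in> tf_mod R"
      then have fg: "M \<in> fg_mod R" and t: "tor M = {\<zero>\<^bsub>M\<^esub>}" by (auto simp: tf_mod_eq)
      have "memb R X M"
      proof (rule memb_torsionfree[OF S fg_modD[OF fg]])
        show "r = 0 \<or> x = \<zero>\<^bsub>M\<^esub>" if "r \<in> carrier R" "x \<in> carrier M" "r \<odot>\<^bsub>M\<^esub> x = \<zero>\<^bsub>M\<^esub>" for r x
          using torI[OF that(2,1) _ that(3)] t by blast
      qed
      then show "M \<in> X" using memb_iff[OF fg] by simp
    qed
  qed
qed

end

section \<open>Quotient modules\<close>

text \<open>Connects the coset model of the quotient with a surjection from the ring of prescribed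
  kernel, the form in which \<open>quo_iff\<close> compares subquotients.\<close>

lemma quot_module_props:
  assumes "cring R" "ideal I R"
  shows module_quot_module: "module R (quot_module R I)"
    and mod_hom_quot_module: "(+>\<^bsub>R\<^esub>) I \<in> mod_hom R (ideal_module R (carrier R)) (quot_module R I)"
    and surj_quot_module: "(+>\<^bsub>R\<^esub>) I ` carrier R = carrier (quot_module R I)"
    and kernel_quot_module: "\<And>x. x \<in> carrier R \<Longrightarrow> I +>\<^bsub>R\<^esub> x = \<zero>\<^bsub>quot_module R I\<^esub> \<longleftrightarrow> x \<in> I"
proof -
  interpret cring R by fact
  interpret I: ideal I R by fact
  interpret Q: ring "R Quot I" by (rule I.quotient_is_ring)
  have simps [simp]: "carrier (quot_module R I) = carrier (R Quot I)"
    "add (quot_module R I) = add (R Quot I)" "zero (quot_module R I) = zero (R Quot I)"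
    "smult (quot_module R I) = (\<lambda>r X. (I +>\<^bsub>R\<^esub> r) \<otimes>\<^bsub>R Quot I\<^esub> X)"
    by (simp_all add: quot_module_def ring.defs)
  interpret h: ring_hom_ring R "R Quot I" "(+>\<^bsub>R\<^esub>) I" by (rule I.rcos_ring_hom_ring)
  have "abelian_group (quot_module R I)"
  proof (rule abelian_groupI)
    fix x assume "x \<in> carrier (quot_module R I)"
    then show "\<exists>y\<in>carrier (quot_module R I). y \<oplus>\<^bsub>quot_module R I\<^esub> x = \<zero>\<^bsub>quot_module R I\<^esub>"
      by (intro bexI[of _ "\<ominus>\<^bsub>R Quot I\<^esub> x"]) (auto simp: Q.l_neg)
  qed (auto simp: Q.a_ac)
  then show "module R (quot_module R I)"
    by (intro moduleI is_cring) (auto simp: Q.l_distr Q.r_distr Q.m_assoc)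
  show "(+>\<^bsub>R\<^esub>) I \<in> mod_hom R (ideal_module R (carrier R)) (quot_module R I)"
    by (rule mod_homI) (auto simp: ideal_module_def)
  show "(+>\<^bsub>R\<^esub>) I ` carrier R = carrier (quot_module R I)"
    unfolding simps FactRing_def A_RCOSETS_def' by auto
  show "I +>\<^bsub>R\<^esub> x = \<zero>\<^bsub>quot_module R I\<^esub> \<longleftrightarrow> x \<in> I" if "x \<in> carrier R" for x
  proof -
    have zero: "\<zero>\<^bsub>quot_module R I\<^esub> = I"
      unfolding simps FactRing_def by (simp only: ring.simps)
    show ?thesis
      unfolding zero
    proof
      assume "I +>\<^bsub>R\<^esub> x = I"
      with I.a_rcos_self[OF that] show "x \<in> I" by (simp only:)
    qed (rule I.a_rcos_const)
  qed
qed

section \<open>Semigroups with two generators\<close>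

lemma semigroup_gen2_mem: "i * a + j * b \<in> semigroup_gen2 a b"
  by (auto simp: semigroup_gen2_def)

lemma semigroup_gen2_add:
  assumes "m \<in> semigroup_gen2 a b" "n \<in> semigroup_gen2 a b"
  shows "m + n \<in> semigroup_gen2 a b"
proof -
  obtain i j i' j' where "m = i * a + j * b" "n = i' * a + j' * b"
    using assms by (auto simp: semigroup_gen2_def)
  then have "m + n = (i + i') * a + (j + j') * b" by (simp add: algebra_simps)
  then show ?thesis using semigroup_gen2_mem by metis
qed

text \<open>Bezout gives a x = 1 modulo b. Then j = n x mod b satisfies j a = n modulo b and j a <=
  (b - 1) a <= (a - 1) b <= n, so n - j a is a nonnegative multiple of b.\<close>

lemma semigroup_gen2_large:
  assumes "coprime a b" "0 < b" "b \<le> a" "(a - 1) * b \<le> n"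
  shows "n \<in> semigroup_gen2 a b"
proof -
  obtain x y where xy: "a * x = b * y + 1"
    using bezout_nat[of a b] assms by auto
  define j where "j = (n * x) mod b"
  have "(j * a) mod b = (n * (a * x)) mod b"
    by (simp add: j_def mod_mult_left_eq mod_mult_right_eq algebra_simps)
  also have "\<dots> = (n + b * (n * y)) mod b" by (simp add: xy algebra_simps)
  also have "\<dots> = n mod b" by simp
  finally have m: "(j * a) mod b = n mod b" .
  have "j * a \<le> (b - 1) * a" using assms(2) by (intro mult_right_mono) (simp_all add: j_def less_Suc_eq_le[symmetric])
  also have "\<dots> \<le> (a - 1) * b" using assms(3) diff_mult_distrib[of b 1 a] diff_mult_distrib[of a 1 b]
    by (simp add: mult.commute[of b a] diff_le_mono2)
  also have "\<dots> \<le> n" by fact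
  finally have le: "j * a \<le> n" .
  then have "b dvd n - j * a" using m by (metis mod_eq_dvd_iff_nat)
  then obtain i where "n - j * a = b * i" by auto
  then have "n = j * a + i * b" using le by (simp add: mult.commute)
  then show ?thesis by (simp add: semigroup_gen2_mem)
qed

text \<open>The gap \<open>n\<close> is forced to be the Frobenius number ab - a - b. A
  representation of n + b cannot involve b, and one of n + a cannot involve a, as otherwise
  \<open>n\<close> would lie in the semigroup. This leaves (i + 1) a = (j' + 1) b, so b divides i +
  1.\<close>

lemma semigroup_gen2_gap:
  fixes n :: int
  assumes "coprime a b" "0 < a" "0 < b"
    and n: "n \<notin> int ` semigroup_gen2 a b" "n + int b \<in> int ` semigroup_gen2 a b"
      "n + int a \<in> int ` semigroup_gen2 a b"
  shows "n + int a = (int a - 1) * int b"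
proof -
  have no: False if "n = int i * int a + int j * int b" for i j
    using that n(1) semigroup_gen2_mem[of i a j b] by (metis image_eqI of_nat_add of_nat_mult)
  obtain i j where ij: "n + int b = int i * int a + int j * int b"
    using n(2) by (auto simp: semigroup_gen2_def)
  obtain i' j' where ij': "n + int a = int i' * int a + int j' * int b"
    using n(3) by (auto simp: semigroup_gen2_def)
  have "j = 0"
  proof (cases j)
    case (Suc l)
    then have "n = int i * int a + int l * int b" using ij by (simp add: algebra_simps)
    then show ?thesis using no by blast
  qed
  moreover have "i' = 0"
  proof (cases i')
    case (Suc l)
    then have "n = int l * int a + int j' * int b" using ij' by (simp add: algebra_simps)
    then show ?thesis using no by blast
  qed
  ultimately have "int ((i + 1) * a) = int ((j' + 1) * b)" using ij ij' by (simp add: algebra_simps)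
  then have "(i + 1) * a = (j' + 1) * b" by (simp only: of_nat_eq_iff)
  then have "b dvd (i + 1) * a" by simp
  then have "b dvd i + 1" using assms(1) by (metis coprime_commute coprime_dvd_mult_left_iff)
  then obtain k where k: "i + 1 = b * k" by auto
  \<comment> \<open>If i + 1 were at least 2b, then i = b + p and n = i a - b = p a + (a - 1) b
    would lie in the semigroup.\<close>
  have "k = 1"
  proof (rule ccontr)
    assume "k \<noteq> 1"
    moreover have "k \<noteq> 0" using k by (intro notI) simp
    ultimately obtain l where "k = Suc (Suc l)" by (metis One_nat_def not0_implies_Suc)
    then have "i + 1 = b + b + b * l" using k by simp
    then have "i = b + (b + b * l - 1)" using assms(3) by simp
    then obtain p where "i = b + p" by blast
    moreover obtain q where "a = Suc q" using assms(2) not0_implies_Suc by blast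
    ultimately have "n = int p * int a + int q * int b" using ij \<open>j = 0\<close> by (simp add: algebra_simps)
    then show False using no by blast
  qed
  then have "int i = int b - 1" using k by simp
  then have "n + int b = (int b - 1) * int a" using ij \<open>j = 0\<close> by simp
  then show ?thesis by (simp add: algebra_simps)
qed

context numerical_semigroup_ring
begin

lemma fplus_supp: "fplus (fls_supp E) (fls_supp F) = fls_supp (E \<union> F)"
proof (intro equalityI subsetI)
  fix f assume "f \<in> fplus (fls_supp E) (fls_supp F)"
  then show "f \<in> fls_supp (E \<union> F)"
    unfolding fplus_def using fls_supp_mono[of E "E \<union> F"] fls_supp_mono[of F "E \<union> F"]
    by (auto intro!: add_mem_fls_supp)
next
  fix f :: "'k fls" assume "f \<in> fls_supp (E \<union> F)"
  then obtain g h where "g \<in> fls_supp E" "h \<in> fls_supp F" "f = g + h" by (rule fls_supp_Un)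
  then show "f \<in> fplus (fls_supp E) (fls_supp F)" unfolding fplus_def by blast
qed

lemma scale_supp: "(*) (tpow m) ` fls_supp E = (fls_supp {n. n - m \<in> E} :: 'k fls set)"
proof (intro equalityI subsetI)
  fix f :: "'k fls" assume f: "f \<in> fls_supp {n. n - m \<in> E}"
  have "f = tpow m * (tpow (- m) * f)" by (rule fls_eqI) auto
  moreover have "tpow (- m) * f \<in> fls_supp E" using f by (force simp: fls_supp_def)
  ultimately show "f \<in> (*) (tpow m) ` fls_supp E" by blast
qed (auto simp: fls_supp_def)

end

context semigroup_ring_subcat
begin

lemma quo_scale:
  assumes A: "fsub A" and q: "q \<noteq> 0" and quo: "quo X A A'"
  shows "quo X ((*) q ` A) ((*) q ` A')"
proof -
  obtain N p where N: "N \<in> X" and p: "p \<in> mod_hom R (fls_module A) N" "p ` A = carrier N"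
    "\<And>x. x \<in> A \<Longrightarrow> p x = \<zero>\<^bsub>N\<^esub> \<longleftrightarrow> x \<in> A'"
    using quo unfolding quo_def by auto
  have qq: "inverse q * (q * x) = x" for x using q by (simp add: mult.assoc[symmetric])
  have "(*) (inverse q) \<in> mod_hom R (fls_module ((*) q ` A)) (fls_module A)"
  proof (rule mod_homI)
    show "inverse q * (r \<odot>\<^bsub>fls_module ((*) q ` A)\<^esub> x) = r \<odot>\<^bsub>fls_module A\<^esub> (inverse q * x)" for r x
      by (simp add: mult.left_commute)
  qed (auto simp: qq distrib_left)
  then have "p \<circ> (*) (inverse q) \<in> mod_hom R (fls_module ((*) q ` A)) N"
    using p(1) by (rule mod_hom_comp)
  moreover have "(p \<circ> (*) (inverse q)) ` (*) q ` A = carrier N"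
    using p(2) by (simp add: image_image qq)
  moreover have "(p \<circ> (*) (inverse q)) y = \<zero>\<^bsub>N\<^esub> \<longleftrightarrow> y \<in> (*) q ` A'" if "y \<in> (*) q ` A" for y
    using that p(3) q by (auto simp: qq)
  ultimately show ?thesis unfolding quo_def using N by blast
qed

end

context semigroup_ring_ext_subcat
begin

text \<open>
  One step of the passage from \<open>R / \<cc>\<close> to the residue field. Put \<open>x = t\<^sup>b\<close> and
  \<open>I = R \<inter> t\<^sup>m k[[t]]\<close>. Then \<open>x\<^sup>-\<^sup>1 I / I\<close> is the direct sum of its parts supported inside and
  outside of \<open>H\<close>, so that the extension of \<open>x\<^sup>-\<^sup>1 R / x\<^sup>-\<^sup>1 I\<close> by \<open>R / I\<close> with middle term
  \<open>R / (I : x) \<oplus> x\<^sup>-\<^sup>1 R / E\<close> exhibits \<open>R / (I : x)\<close> as a direct summand.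
\<close>

lemma quo_step:
  assumes H: "H = semigroup_gen2 a b" and ab: "coprime a b" "0 < a" "0 < b"
    and m: "m \<le> (int a - 1) * int b"
    and quo: "quo X (carrier R) (fls_supp (int ` H \<inter> {m..}))"
  shows "quo X (carrier R) (fls_supp (int ` H \<inter> {m - int b..}))"
proof -
  have gens: "a \<in> H" "b \<in> H"
    using semigroup_gen2_mem[of 1 a 0 b] semigroup_gen2_mem[of 0 a 1 b] by (simp_all add: H)
  have Hadd: "int h + n \<in> int ` H" if "h \<in> H" "n \<in> int ` H" for h n
    using that H_add by (auto simp flip: of_nat_add)
  let ?HB = "{n. n - (- int b) \<in> int ` H}"
  let ?A' = "int ` H \<inter> {m - int b..}"
  \<comment> \<open>The exponents of \<open>I\<close> together with those exponents of t^-b I that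
    are not in \<open>H\<close>. As \<open>?A'\<close> is the part of t^-b I inside
    \<open>H\<close>, the two sets meet in the exponents of \<open>I\<close> and have those of t^-b
    I as union.\<close>
  let ?E = "(int ` H \<inter> {m..}) \<union> {n. n + int b \<in> int ` H \<and> m - int b \<le> n \<and> n \<notin> int ` H}"
  have HB: "int ` H \<subseteq> ?HB" using Hadd[OF gens(2)] by (auto simp: add.commute)
  have subHB: "fsub (fls_supp ?HB)"
    using Hadd by (intro fsub_supp) (auto simp: add.assoc)
  have subA': "fsub (fls_supp ?A')"
    using Hadd by (intro fsub_supp) fastforce
  \<comment> \<open>A gap \<open>n\<close> could leave \<open>?E\<close> under addition of
    \<open>a\<close> only by entering \<open>H\<close> below \<open>m\<close>. But when n + a and n
    + b are both in \<open>H\<close>, the gap lemma gives n + a = (a - 1) b, which is at least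
    \<open>m\<close>.\<close>
  have Ea: "n + int a \<in> ?E" if n: "n \<in> ?E" for n
  proof (cases "n \<in> int ` H \<or> n + int a \<notin> int ` H")
    case True
    then show ?thesis
    proof
      assume "n \<in> int ` H"
      then show ?thesis using n Hadd[OF gens(1), of n] by (auto simp: add.commute)
    next
      assume *: "n + int a \<notin> int ` H"
      then have "n \<notin> int ` H" using Hadd[OF gens(1), of n] by (auto simp: add.commute)
      then have "n + int b \<in> int ` H" "m - int b \<le> n" using n by auto
      moreover from this have "n + int a + int b \<in> int ` H"
        using Hadd[OF gens(1), of "n + int b"] by (simp add: add_ac)
      ultimately show ?thesis using * by auto
    qed
  next
    case False
    then have "n + int a = (int a - 1) * int b"
      using n semigroup_gen2_gap[OF ab, of n] unfolding H by blast
    then show ?thesis using False m by auto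
  qed
  have Eb: "n + int b \<in> ?E" if n: "n \<in> ?E" for n
    using n Hadd[OF gens(2), of n] by (auto simp: add.commute)
  have E_mult: "n + int i * int a + int j * int b \<in> ?E" if n: "n \<in> ?E" for n i j
  proof -
    have "n + int i * int a \<in> ?E"
    proof (induction i)
      case (Suc i)
      then show ?case using Ea[OF Suc] by (simp add: algebra_simps)
    qed (use n in simp)
    then show ?thesis
    proof (induction j)
      case (Suc j)
      then show ?case using Eb[OF Suc.IH[OF Suc.prems]] by (simp add: algebra_simps)
    qed simp
  qed
  have subE: "fsub (fls_supp ?E)"
  proof (rule fsub_supp)
    fix h n assume h: "h \<in> H" and n: "n \<in> ?E"
    obtain i j where "h = i * a + j * b" using h by (auto simp: H semigroup_gen2_def)
    then have "int h + n = n + int i * int a + int j * int b" by simp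
    then show "int h + n \<in> ?E" using E_mult[OF n] by (simp only:)
  qed
  have R: "carrier R = fls_supp (int ` H)" by (rule carrier_R)
  show ?thesis
  proof (rule quo_Int_fplus(1)[OF fsub_R subHB subA' subE])
    show "fls_supp ?A' \<subseteq> carrier R" unfolding R by (rule fls_supp_mono) auto
    show "fls_supp ?E \<subseteq> fls_supp ?HB" using HB by (intro fls_supp_mono) auto
    have "int ` H \<inter> ?HB = int ` H" using HB by auto
    moreover have "?A' \<inter> ?E = int ` H \<inter> {m..}" by auto
    ultimately show "quo X (carrier R \<inter> fls_supp ?HB) (fls_supp ?A' \<inter> fls_supp ?E)"
      using quo unfolding R fls_supp_Int by (simp only:)
    \<comment> \<open>The sum side is R/I shifted by t^-b, so both ends of the sequence are copies
      of R/I.\<close>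
    have "quo X ((*) (tpow (- int b)) ` carrier R) ((*) (tpow (- int b)) ` fls_supp (int ` H \<inter> {m..}))"
      by (rule quo_scale[OF fsub_R tpow_nonzero quo])
    moreover have "int ` H \<union> ?HB = ?HB" using HB by auto
    moreover have "?A' \<union> ?E = {n. n - (- int b) \<in> int ` H \<inter> {m..}}"
      using Hadd[OF gens(2)] by (auto simp: add.commute)
    ultimately show "quo X (fplus (carrier R) (fls_supp ?HB)) (fplus (fls_supp ?A') (fls_supp ?E))"
      unfolding R fplus_supp scale_supp by (simp only:)
  qed
qed

end

context numerical_semigroup_ring
begin

text \<open>Steps of length \<open>b\<close> lead from the conductor down to a threshold
  \<open>e\<close> between 1 and \<open>b\<close>. As nonzero elements of \<open>H\<close> are at
  least \<open>b\<close>, the elements of the ring of order at least \<open>e\<close> then form the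
  maximal ideal.\<close>

lemma ext_closure_quot_conductor:
  assumes H: "H = semigroup_gen2 a b" and ab: "coprime a b" "1 < b" "b < a"
  shows "(ext_closure R (quot_module R (conductor R)) :: ('k fls, 'v) module set) = fl_mod R"
proof -
  obtain c where c: "conductor R = fls_supp {int c..}" "\<And>n. c \<le> n \<Longrightarrow> n \<in> H"
    "\<And>c'. (\<And>n. c' \<le> n \<Longrightarrow> n \<in> H) \<Longrightarrow> c \<le> c'" by (rule conductor_eq) blast
  \<comment> \<open>The bound under which \<open>quo_step\<close> applies; it persists because the
    threshold only decreases.\<close>
  have c_le: "c \<le> (a - 1) * b"
    using ab by (intro c(3)) (auto simp: H intro: semigroup_gen2_large)
  have H_ge: "h = 0 \<or> b \<le> h" if h: "h \<in> H" for h
  proof -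
    obtain i j where "h = i * a + j * b" using h by (auto simp: H semigroup_gen2_def)
    then show ?thesis using ab by (cases i; cases j) auto
  qed
  \<comment> \<open>Here \<open>b > 1\<close> enters: for b = 1 the conductor would be the whole
    ring.\<close>
  have "c \<noteq> 0"
  proof
    assume "c = 0"
    then have "1 \<in> H" using c(2)[of 1] by simp
    then show False using H_ge[of 1] ab(2) by simp
  qed
  have cH: "{int c..} \<subseteq> int ` H" using c(2) by (auto intro!: rev_image_eqI[of "nat _"])
  let ?I = "fls_supp {int c..} :: 'k fls set"
  have IR: "?I \<subseteq> carrier R" unfolding carrier_R using cH by (rule fls_supp_mono)
  have I: "ideal ?I R"
  proof (rule idealI)
    show "ring R" using cring_R by (rule cring.axioms)
    show "subgroup ?I (add_monoid R)"
    proof (rule add.subgroupI)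
      fix x assume x: "x \<in> ?I"
      then have "\<ominus>\<^bsub>R\<^esub> x = - x"
        using IR minus_equality[of "- x" x] fsub_uminus[OF fsub_R, of x] by auto
      then show "\<ominus>\<^bsub>R\<^esub> x \<in> ?I"
        using fsub_uminus[OF fsub_atLeast x] by (simp only:)
    next
      show "?I \<noteq> {}" using zero_mem_fls_supp by blast
    qed (use IR in \<open>auto simp: add_mem_fls_supp\<close>)
    show "x \<otimes>\<^bsub>R\<^esub> a \<in> ?I" "a \<otimes>\<^bsub>R\<^esub> x \<in> ?I" if "a \<in> ?I" "x \<in> carrier R" for a x
      using fsub_mult[OF fsub_atLeast that(2,1)] by (simp_all add: mult.commute)
  qed
  let ?Q = "quot_module R ?I"
  note Q = quot_module_props[OF cring_R I]
  have torQ: "tor ?Q = carrier ?Q"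
  proof -
    have "y \<in> tor ?Q" if y: "y \<in> carrier ?Q" for y
    proof -
      let ?t = "tpow (int c) :: 'k fls"
      have tR: "?t \<in> carrier R" using IR by auto
      obtain r where r: "r \<in> carrier R" "y = ?I +>\<^bsub>R\<^esub> r" using y Q(3) by auto
      have "?t * r \<in> ?I" using fsub_mult[OF fsub_atLeast r(1), of ?t "int c"] by (simp add: mult.commute)
      then have "?I +>\<^bsub>R\<^esub> (?t * r) = \<zero>\<^bsub>?Q\<^esub>" using Q(4) IR by blast
      moreover have "?I +>\<^bsub>R\<^esub> (?t * r) = ?t \<odot>\<^bsub>?Q\<^esub> y"
        using mod_hom_smult[OF Q(2) tR, of r] r by simp
      ultimately show ?thesis using torI[OF y tR] by simp
    qed
    then show ?thesis by (auto dest: tor_carrier)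
  qed
  show ?thesis
    unfolding c(1)
  proof (rule ext_closure_eqI[OF strict_full_fl_mod _ closed_summands_fl_mod closed_extensions_fl_mod])
    show "{N \<in> fg_mod R. mod_iso R ?Q N} \<subseteq> (fl_mod R :: ('k fls, 'v) module set)"
    proof clarify
      fix N :: "('k fls, 'v) module" assume N: "N \<in> fg_mod R" and iso: "mod_iso R ?Q N"
      obtain f where f: "f \<in> mod_hom R ?Q N" "f ` carrier ?Q = carrier N"
        using iso by (auto simp: mod_iso_def bij_betw_def)
      have "y \<in> tor N" if y: "y \<in> carrier N" for y
      proof -
        obtain x where "x \<in> carrier ?Q" "y = f x" using y unfolding f(2)[symmetric] by auto
        then show ?thesis using tor_hom[OF Q(1) fg_modD(1)[OF N] f(1), of x] torQ by simp
      qed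
      then show "N \<in> fl_mod R" using N by (auto simp: fl_mod_eq dest: tor_carrier)
    qed
  next
    fix X :: "('k fls, 'v) module set"
    assume prem: "strict_full_subcat R X" "{N \<in> fg_mod R. mod_iso R ?Q N} \<subseteq> X"
      "closed_summands R X" "closed_extensions R X"
    interpret semigroup_ring_ext_subcat H R \<iota> X by unfold_locales (use prem in auto)
    have "fin_gen R (fls_module (carrier R))"
      using fin_gen_bounded[OF fsub_R carrier_R_bound] .
    then have "fin_gen R ?Q"
      using Q(3) by (intro fin_gen_image[OF module_regular Q(1,2)]) auto
    then obtain N :: "('k fls, 'v) module" where "N \<in> fg_mod R" "mod_iso R ?Q N"
      using ex_copy[OF Q(1)] by blast
    then have "memb R X ?Q" using prem(2) unfolding memb_def by blast
    then have "quo X (carrier R) ?I"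
      using quo_iff[OF fsub_R Q(1,2,3,4)] by simp
    moreover have "int ` H \<inter> {int c..} = {int c..}" using cH by auto
    ultimately have base: "quo X (carrier R) (fls_supp (int ` H \<inter> {int c..}))" by simp
    have "int c \<le> int ((a - 1) * b)" using c_le by (simp only: of_nat_le_iff)
    also have "int ((a - 1) * b) = (int a - 1) * int b" using ab by (simp add: of_nat_diff)
    finally have c_le': "int c \<le> (int a - 1) * int b" .
    have iter: "quo X (carrier R) (fls_supp (int ` H \<inter> {int c - int n * int b..}))" for n
    proof (induction n)
      case (Suc n)
      have "int c - int n * int b \<le> (int a - 1) * int b"
        using c_le' by (smt (verit) of_nat_0_le_iff zero_le_mult_iff)
      then have "quo X (carrier R) (fls_supp (int ` H \<inter> {int c - int n * int b - int b..}))"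
        using ab by (intro quo_step[OF H ab(1) _ _ _ Suc]) auto
      then show ?case by (simp add: algebra_simps)
    qed (use base in simp)
    \<comment> \<open>Dividing c - 1 rather than \<open>c\<close> puts the final threshold into the
      range from 1 to \<open>b\<close>; a threshold of 0 would give R/R instead of the residue
      field.\<close>
    define n where "n = (c - 1) div b"
    have "c - 1 = n * b + (c - 1) mod b" by (simp add: n_def)
    moreover have "(c - 1) mod b < b" using ab by simp
    ultimately obtain e where e: "int c - int n * int b = int e" "0 < e" "e \<le> b"
    proof -
      have "int c = int n * int b + int (Suc ((c - 1) mod b))"
        using \<open>c - 1 = n * b + (c - 1) mod b\<close> \<open>c \<noteq> 0\<close>
        by (metis Suc_pred' add_Suc_right neq0_conv of_nat_add of_nat_mult)
      then show ?thesis using that[of "Suc ((c - 1) mod b)"] \<open>(c - 1) mod b < b\<close> by simp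
    qed
    have "fls_supp (int ` H \<inter> {int e..}) = (maxid :: 'k fls set)"
    proof (intro equalityI subsetI)
      fix f :: "'k fls" assume "f \<in> fls_supp (int ` H \<inter> {int e..})"
      then show "f \<in> maxid" using e(2) by (auto simp: maxid_def carrier_R fls_supp_def)
    next
      fix f assume f: "f \<in> maxid"
      show "f \<in> fls_supp (int ` H \<inter> {int e..})"
      proof (rule fls_suppI)
        fix n assume n: "f $$ n \<noteq> 0"
        then obtain h where h: "h \<in> H" "n = int h"
          using f by (auto simp: maxid_def carrier_R fls_supp_def)
        moreover have "h \<noteq> 0" using h(2) n f by (intro notI) (simp add: maxid_def)
        ultimately show "n \<in> int ` H \<inter> {int e..}" using H_ge[OF h(1)] e(3) by auto
      qed
    qed
    then have k: "quo X (carrier R) maxid" using iter[of n] unfolding e(1) by simp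
    show "fl_mod R \<subseteq> X"
    proof
      fix M :: "('k fls, 'v) module" assume "M \<in> fl_mod R"
      then have M: "M \<in> fg_mod R" "tor M = carrier M" by (auto simp: fl_mod_eq)
      then have "memb R X M" using memb_torsion[OF k fg_modD[OF M(1)]] by simp
      then show "M \<in> X" using memb_iff[OF M(1)] by simp
    qed
  qed
qed

end

text \<open>For b = 1 the ring is k[[t]] and equals its conductor, so the quotient is zero and
  generates only zero modules; this is why the first claim requires \<open>b > 1\<close>. The
  injection \<open>\<iota>\<close> makes the type \<open>'v\<close> large enough for a copy of every
  finitely generated module.\<close>

theorem theorem6p9:
  fixes a b :: nat and \<iota> :: "'k::field fls \<Rightarrow> 'v"
  fixes R :: "'k fls ring"
  defines "R \<equiv> semigroup_ring (semigroup_gen2 a b)"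
  assumes "a > b" and "b > 0" and "gcd a b = 1"
    and "inj \<iota>"
  shows "(b > 1 \<longrightarrow>
            (ext_closure R (quot_module R (conductor R)) :: ('k fls, 'v) module set) = fl_mod R) \<and>
         (ext_closure R (ideal_module R (conductor R)) :: ('k fls, 'v) module set) = tf_mod R \<and>
         {X :: ('k fls, 'v) module set. strict_full_subcat R X \<and> IKE_closed R X} =
           {zero_mod R, fl_mod R, tf_mod R, fg_mod R} \<and>
         (\<forall>X :: ('k fls, 'v) module set.
            strict_full_subcat R X \<and> IKE_closed R X \<longrightarrow> torsionfree_subcat R X)"
proof -
  have ab: "coprime a b" using assms(4) by (simp add: coprime_iff_gcd_eq_1)
  interpret numerical_semigroup_ring "semigroup_gen2 a b" R \<iota>
  proof
    show "0 \<in> semigroup_gen2 a b" using semigroup_gen2_mem[of 0 a 0 b] by simp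
    show "\<exists>c. \<forall>n\<ge>c. n \<in> semigroup_gen2 a b"
      using semigroup_gen2_large[OF ab] assms(2,3) by (intro exI[of _ "(a - 1) * b"]) auto
  qed (use assms semigroup_gen2_add in \<open>auto simp: R_def\<close>)
  have "{X :: ('k fls, 'v) module set. strict_full_subcat R X \<and> IKE_closed R X} =
      {zero_mod R, fl_mod R, tf_mod R, fg_mod R}"
    unfolding IKE_closed_iff by auto
  moreover have "torsionfree_subcat R X"
    if "strict_full_subcat R X \<and> IKE_closed R X" for X :: "('k fls, 'v) module set"
    using torsionfree_subcat_four(2) that unfolding IKE_closed_iff .
  ultimately show ?thesis
    using ext_closure_quot_conductor[OF refl ab] ext_closure_conductor assms(2) by auto
qed

end
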